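(* Let $B$ be a finite Blaschke product with $n$ zeros and let $\mathcal{M}$ be a weak*-closed subspace of $H^\infty$ invariant under $T_B$ (i.e. $B\mathcal M\subset\mathcal M$). Then there exist $B$-inner functions $J_1,\ldots,J_r$ ($r\le n$) such that \[\mathcal{M}=J_1H^\infty(B)\oplus\cdots\oplus J_rH^\infty(B),\] where $\oplus$ denotes a direct sum.
   Context: $H^2,H^\infty$ are the classical Hardy spaces on the unit circle. $B(z)=\prod_{i=1}^n\frac{z-a_i}{1-\overline{a_i}z}$ with $a_i$ in the open unit disc (the paper takes $a_1=0$). $H^\infty(B)=\{f\circ B: f\in H^\infty\}$. A function $\varphi\in H^\infty$ is $B$-inner if $\{B^m\varphi: m=0,1,2,\ldots\}$ is an orthonormal set in $H^2$. *)

theory Defs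
  imports "HOL-Analysis.Analysis"
begin

text \<open>Functions on the open unit disc are represented as complex functions that
  vanish identically outside the disc (canonical representatives).\<close>

definition Hinf :: "(complex \<Rightarrow> complex) set" where
  "Hinf = {f. f holomorphic_on ball 0 1 \<and> bounded (f ` ball 0 1)
              \<and> (\<forall>z. z \<notin> ball 0 1 \<longrightarrow> f z = 0)}"

definition blaschke :: "complex list \<Rightarrow> complex \<Rightarrow> complex" where
  "blaschke a z = (\<Prod>i<length a. (z - a!i) / (1 - cnj (a!i) * z))"

definition HinfB :: "(complex \<Rightarrow> complex) \<Rightarrow> (complex \<Rightarrow> complex) set" where
  "HinfB B = {(\<lambda>z. if z \<in> ball 0 1 then f (B z) else 0) | f. f \<in> Hinf}"

definition h2_inner :: "(complex \<Rightarrow> complex) \<Rightarrow> (complex \<Rightarrow> complex) \<Rightarrow> complex" where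
  "h2_inner f g = Lim (at_left 1) (\<lambda>r::real.
      (LINT t:{0..2*pi}|lborel. f (of_real r * cis t) * cnj (g (of_real r * cis t))) / (2 * pi))"

definition B_inner :: "(complex \<Rightarrow> complex) \<Rightarrow> (complex \<Rightarrow> complex) \<Rightarrow> bool" where
  "B_inner B \<phi> \<longleftrightarrow> \<phi> \<in> Hinf \<and>
     (\<forall>m k::nat. h2_inner (\<lambda>z. B z ^ m * \<phi> z) (\<lambda>z. B z ^ k * \<phi> z) = (if m = k then 1 else 0))"

definition L1_circle :: "(real \<Rightarrow> complex) set" where
  "L1_circle = {g. set_integrable lborel {0..2*pi} g}"

text \<open>Duality pairing between H-infinity (through its boundary function) and L^1.\<close>
definition wpair :: "(complex \<Rightarrow> complex) \<Rightarrow> (real \<Rightarrow> complex) \<Rightarrow> complex" where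
  "wpair f g = Lim (at_left 1) (\<lambda>r::real.
      (LINT t:{0..2*pi}|lborel. f (of_real r * cis t) * g t) / (2 * pi))"

text \<open>Closedness in the weak-star topology of H-infinity, i.e. the weakest topology
  making all functionals f -> wpair f g (g in L^1) continuous.\<close>
definition weakstar_closed :: "(complex \<Rightarrow> complex) set \<Rightarrow> bool" where
  "weakstar_closed M \<longleftrightarrow> M \<subseteq> Hinf \<and>
     (\<forall>f\<in>Hinf. (\<forall>G \<epsilon>. finite G \<and> G \<subseteq> L1_circle \<and> \<epsilon> > 0 \<longrightarrow>
                   (\<exists>h\<in>M. \<forall>g\<in>G. cmod (wpair f g - wpair h g) < \<epsilon>)) \<longrightarrow> f \<in> M)"

definition Hinf_subspace :: "(complex \<Rightarrow> complex) set \<Rightarrow> bool" where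
  "Hinf_subspace M \<longleftrightarrow> M \<subseteq> Hinf \<and> (\<lambda>z. 0) \<in> M \<and>
     (\<forall>f\<in>M. \<forall>g\<in>M. (\<lambda>z. f z + g z) \<in> M) \<and> (\<forall>c. \<forall>f\<in>M. (\<lambda>z. c * f z) \<in> M)"

end

theory Submission
  imports Defs "HOL-Complex_Analysis.Complex_Analysis"
begin

text \<open>
  Work in the Hilbert space \<open>H\<^sup>2\<close> of square-summable Taylor coefficients. Multiplication by \<open>B\<close> is an
  isometry \<open>T\<close> there, because \<open>1 - |B z|\<^sup>2 \<le> C (1 - |z|\<^sup>2)\<close>. Let \<open>K\<close> be the closure of \<open>M\<close> in \<open>H\<^sup>2\<close>
  and \<open>W\<close> the orthogonal complement of \<open>T K\<close> in \<open>K\<close>; the Wold decomposition makes an orthonormal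
  basis \<open>J\<^sub>i\<close> of \<open>W\<close> generate \<open>K\<close>. No boundary values are used: everything is read off from the
  resolvent \<open>R w a = a / (1 - cnj w * B)\<close>, which satisfies
  \<open>(1 - |w|\<^sup>2) <R w f, R w g> = <f, R w g> + <R w f, g> - <f, g>\<close>.

  Taking \<open>w = B z\<close> in this identity bounds \<open>\<Sum>|J\<^sub>i z|\<^sup>2\<close> by \<open>(1 - |B z|\<^sup>2) / (1 - |z|\<^sup>2)\<close>. So the
  \<open>J\<^sub>i\<close> are bounded, and integrating over circles gives \<open>dim W \<le> n\<close>. The coefficients of
  \<open>f \<in> K\<close> are \<open>F\<^sub>i w = <f, R w J\<^sub>i>\<close>, and they are bounded when \<open>f\<close> is.

  It remains to see that a bounded \<open>j \<in> K\<close> lies in \<open>M\<close>. If \<open>s\<^sub>n \<in> M\<close> tends to \<open>j\<close> in \<open>H\<^sup>2\<close> and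
  \<open>h\<^sub>n = s\<^sub>n - j\<close>, then \<open>H\<^sub>n w = 2 <h\<^sub>n, R w h\<^sub>n> - |h\<^sub>n|\<^sup>2\<close> is holomorphic, has nonnegative real part, and
  \<open>|h\<^sub>n z|\<^sup>2 \<le> C Re (H\<^sub>n (B z))\<close>. Hence the functions \<open>s\<^sub>n / (1 + H\<^sub>n \<circ> B)\<close> of \<open>M\<close> are uniformly bounded
  and converge pointwise to \<open>j\<close>, so they converge weak-star.
\<close>

section \<open>The Hilbert space of square-summable Taylor coefficients\<close>

text \<open>Both \<open>h2_inner\<close> and \<open>wpair\<close> are limits of integrals over
  circles of radius r < 1. Hence the inner character of B enters as a rate at which |B| tends to 1,
  stated inside the disc, and weak-star closedness enters through bounded pointwise limits, for
  which the limit r -> 1 must be uniform over a ball of H^infinity.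

  The resolvent is natural because <f, R w g> is the generating function of the numbers <f, B^m g>:
  it packs all Wold coefficients into one holomorphic function of w. Putting w = B z makes the
  denominator at z the real number 1 - |B z|^2, which ties resolvents to point values.

  The obstacle at the end is that convergence in H^2 gives no uniform bound. H_n is the Herglotz
  integral of |h_n|^2 pushed forward by B, so its real part is large wherever h_n is, although H_n
  tends to 0 at each point. Being a function of B, the damping factor built from it can multiply
  elements of M.

  The number n comes from the defect of B: it is at most 1 - |z|^2 times the sum of n squared moduli
  of normalised Szego kernels, one per zero.\<close>

lemma summable_sq_add:
  fixes a b :: "nat \<Rightarrow> complex"
  assumes "summable (\<lambda>k. (cmod (a k))\<^sup>2)" "summable (\<lambda>k. (cmod (b k))\<^sup>2)"
  shows "summable (\<lambda>k. (cmod (a k + b k))\<^sup>2)"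
proof (rule summable_comparison_test_ev)
  have "(cmod (x + y))\<^sup>2 \<le> 2 * ((cmod x)\<^sup>2 + (cmod y)\<^sup>2)" for x y
  proof -
    have "(cmod (x + y))\<^sup>2 \<le> (cmod x + cmod y)\<^sup>2"
      by (simp add: power_mono norm_triangle_ineq)
    also have "\<dots> \<le> 2 * ((cmod x)\<^sup>2 + (cmod y)\<^sup>2)"
      using sum_squares_bound[of "cmod x" "cmod y"] by (simp add: power2_sum algebra_simps)
    finally show ?thesis .
  qed
  then show "\<forall>\<^sub>F k in sequentially. norm ((cmod (a k + b k))\<^sup>2) \<le> 2 * ((cmod (a k))\<^sup>2 + (cmod (b k))\<^sup>2)"
    by auto
  show "summable (\<lambda>k. 2 * ((cmod (a k))\<^sup>2 + (cmod (b k))\<^sup>2))"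
    by (intro summable_mult summable_add assms)
qed

lemma summable_sq_scale:
  fixes a :: "nat \<Rightarrow> complex"
  assumes "summable (\<lambda>k. (cmod (a k))\<^sup>2)"
  shows "summable (\<lambda>k. (cmod (c * a k))\<^sup>2)"
  using summable_mult[OF assms, of "(cmod c)\<^sup>2"] by (simp add: norm_mult power_mult_distrib)

lemma summable_sq_mult:
  fixes a b :: "nat \<Rightarrow> complex"
  assumes "summable (\<lambda>k. (cmod (a k))\<^sup>2)" "summable (\<lambda>k. (cmod (b k))\<^sup>2)"
  shows "summable (\<lambda>k. cmod (a k * b k))"
proof (rule summable_comparison_test_ev)
  have "cmod (x * y) \<le> (cmod x)\<^sup>2 + (cmod y)\<^sup>2" for x y
    using sum_squares_bound[of "cmod x" "cmod y"]
      mult_nonneg_nonneg[OF norm_ge_zero[of x] norm_ge_zero[of y]]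
    unfolding norm_mult by linarith
  then show "\<forall>\<^sub>F k in sequentially. norm (cmod (a k * b k)) \<le> (cmod (a k))\<^sup>2 + (cmod (b k))\<^sup>2"
    by auto
  show "summable (\<lambda>k. (cmod (a k))\<^sup>2 + (cmod (b k))\<^sup>2)"
    by (intro summable_add assms)
qed

typedef h2 = "{a :: nat \<Rightarrow> complex. summable (\<lambda>k. (cmod (a k))\<^sup>2)}"
  morphisms coef Abs_h2
  by (rule exI[of _ "\<lambda>_. 0"]) simp

setup_lifting type_definition_h2

lemma summable_coef: "summable (\<lambda>k. (cmod (coef a k))\<^sup>2)"
  using coef[of a] by simp

lemma h2_eqI: "(\<And>k. coef a k = coef b k) \<Longrightarrow> a = b"
  using coef_inject by blast

lift_definition scaleC :: "complex \<Rightarrow> h2 \<Rightarrow> h2" (infixr "*\<^sub>C" 75) is "\<lambda>c a k. c * a k"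
  by (rule summable_sq_scale)

text \<open>The class \<open>real_inner\<close> has a real-valued product only. The complex product
  is therefore kept apart, and its real part becomes \<open>inner\<close>, so that the library's
  metric notions apply.\<close>

definition cip :: "h2 \<Rightarrow> h2 \<Rightarrow> complex" where
  "cip a b = (\<Sum>k. coef a k * cnj (coef b k))"

lemma summable_cip: "summable (\<lambda>k. coef a k * cnj (coef b k))"
  using summable_sq_mult[OF summable_coef[of a], of "\<lambda>k. cnj (coef b k)"] summable_coef[of b]
  by (simp add: summable_norm_cancel)

lemma Re_cip_self: "Re (cip a a) = (\<Sum>k. (cmod (coef a k))\<^sup>2)"
proof -
  have "Re (cip a a) = (\<Sum>k. Re (coef a k * cnj (coef a k)))"
    unfolding cip_def by (rule Re_suminf[OF summable_cip])
  then show ?thesis by (simp only: complex_norm_square[symmetric] Re_complex_of_real)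
qed

lemma cip_commute: "cip b a = cnj (cip a b)"
proof -
  have "(\<lambda>k. cnj (coef a k * cnj (coef b k))) sums cnj (cip a b)"
    unfolding cip_def sums_cnj by (rule summable_sums[OF summable_cip])
  then have "cnj (cip a b) = (\<Sum>k. cnj (coef a k * cnj (coef b k)))"
    by (rule sums_unique)
  then show ?thesis by (simp add: cip_def mult.commute)
qed

instantiation h2 :: real_inner
begin

lift_definition zero_h2 :: h2 is "\<lambda>_. 0" by simp
lift_definition plus_h2 :: "h2 \<Rightarrow> h2 \<Rightarrow> h2" is "\<lambda>a b k. a k + b k" by (rule summable_sq_add)
lift_definition uminus_h2 :: "h2 \<Rightarrow> h2" is "\<lambda>a k. - a k" by simp
definition minus_h2 :: "h2 \<Rightarrow> h2 \<Rightarrow> h2" where "minus_h2 a b = a + - b"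
lift_definition scaleR_h2 :: "real \<Rightarrow> h2 \<Rightarrow> h2" is "\<lambda>c a k. of_real c * a k"
  by (rule summable_sq_scale)
definition inner_h2 :: "h2 \<Rightarrow> h2 \<Rightarrow> real" where "inner_h2 a b = Re (cip a b)"
definition norm_h2 :: "h2 \<Rightarrow> real" where "norm_h2 a = sqrt (inner a a)"
definition dist_h2 :: "h2 \<Rightarrow> h2 \<Rightarrow> real" where "dist_h2 a b = norm (a - b)"
definition sgn_h2 :: "h2 \<Rightarrow> h2" where "sgn_h2 a = scaleR (inverse (norm a)) a"
definition uniformity_h2 :: "(h2 \<times> h2) filter"
  where "uniformity_h2 = (INF e\<in>{0 <..}. principal {(x, y). dist x y < e})"
definition open_h2 :: "h2 set \<Rightarrow> bool"
  where "open_h2 U \<longleftrightarrow> (\<forall>x\<in>U. eventually (\<lambda>(x', y). x' = x \<longrightarrow> y \<in> U) uniformity)"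

instance
proof
  fix a b c :: h2 and r s :: real
  show "a + b + c = a + (b + c)" "a + b = b + a" "0 + a = a" "- a + a = 0"
    "r *\<^sub>R (a + b) = r *\<^sub>R a + r *\<^sub>R b" "(r + s) *\<^sub>R a = r *\<^sub>R a + s *\<^sub>R a"
    "r *\<^sub>R s *\<^sub>R a = (r * s) *\<^sub>R a" "1 *\<^sub>R a = a"
    by (transfer; simp add: algebra_simps)+
  show "a - b = a + - b" by (rule minus_h2_def)
  show "dist a b = norm (a - b)" by (rule dist_h2_def)
  show "sgn a = scaleR (inverse (norm a)) a" by (rule sgn_h2_def)
  show "uniformity = (INF e\<in>{0 <..}. principal {(x, y). dist x (y :: h2) < e})"
    by (rule uniformity_h2_def)
  show "open U \<longleftrightarrow> (\<forall>x\<in>U. eventually (\<lambda>(x', y). x' = x \<longrightarrow> y \<in> U) uniformity)" for U :: "h2 set"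
    by (rule open_h2_def)
  show "norm a = sqrt (inner a a)" by (rule norm_h2_def)
  show "inner a b = inner b a" using cip_commute[of a b] by (simp add: inner_h2_def)
  show "inner (a + b) c = inner a c + inner b c"
    using suminf_add[OF summable_cip[of a c] summable_cip[of b c]]
    unfolding inner_h2_def plus_complex.sel(1)[symmetric]
    by (simp only: cip_def plus_h2.rep_eq distrib_right)
  show "inner (r *\<^sub>R a) b = r * inner a b"
    using suminf_mult[OF summable_cip[of a b], of "of_real r"]
    unfolding inner_h2_def by (simp only: cip_def scaleR_h2.rep_eq mult.assoc) simp
  show "0 \<le> inner a a"
    unfolding inner_h2_def Re_cip_self by (intro suminf_nonneg summable_coef) simp
  show "inner a a = 0 \<longleftrightarrow> a = 0"
  proof
    assume "inner a a = 0"
    then have "\<forall>k. (cmod (coef a k))\<^sup>2 = 0"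
      unfolding inner_h2_def Re_cip_self using suminf_eq_zero_iff[OF summable_coef[of a]] by auto
    then show "a = 0" by (intro h2_eqI) (simp add: zero_h2.rep_eq)
  next
    assume "a = 0"
    then show "inner a a = 0" by (simp add: inner_h2_def Re_cip_self zero_h2.rep_eq)
  qed
qed

end

lemmas coef_simps [simp] = zero_h2.rep_eq plus_h2.rep_eq uminus_h2.rep_eq scaleR_h2.rep_eq scaleC.rep_eq

lemma coef_minus [simp]: "coef (a - b) k = coef a k - coef b k"
  unfolding minus_h2_def by (simp only: coef_simps) simp

lemma norm_h2_sq: "(norm (a :: h2))\<^sup>2 = (\<Sum>k. (cmod (coef a k))\<^sup>2)"
  by (simp add: power2_norm_eq_inner inner_h2_def Re_cip_self)

lemma cip_add_left: "cip (a + b) c = cip a c + cip b c"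
  using suminf_add[OF summable_cip[of a c] summable_cip[of b c]]
  by (simp add: cip_def distrib_right)

lemma cip_scale_left: "cip (r *\<^sub>C a) b = r * cip a b"
  using suminf_mult[OF summable_cip[of a b], of r] by (simp add: cip_def mult.assoc)

lemma cip_add_right: "cip c (a + b) = cip c a + cip c b"
  by (metis cip_commute cip_add_left complex_cnj_add)

lemma cip_scale_right: "cip b (r *\<^sub>C a) = cnj r * cip b a"
  by (metis cip_commute cip_scale_left complex_cnj_mult)

lemma scaleC_minus_one: "- a = (-1) *\<^sub>C a"
  by (rule h2_eqI) simp

lemma cip_minus_left: "cip (- a) b = - cip a b"
  by (simp add: scaleC_minus_one cip_scale_left)

lemma cip_minus_right: "cip b (- a) = - cip b a"
  by (simp add: scaleC_minus_one cip_scale_right)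

lemma cip_diff_left: "cip (a - b) c = cip a c - cip b c"
  unfolding minus_h2_def by (simp only: cip_add_left cip_minus_left) simp

lemma cip_diff_right: "cip c (a - b) = cip c a - cip c b"
  unfolding minus_h2_def by (simp only: cip_add_right cip_minus_right) simp

lemma cip_zero [simp]: "cip 0 a = 0" "cip a 0 = 0"
  by (simp_all add: cip_def)

lemmas cip_simps = cip_add_left cip_add_right cip_diff_left cip_diff_right cip_scale_left cip_scale_right

lemma cip_sum_left: "cip (sum f A) b = (\<Sum>i\<in>A. cip (f i) b)"
  by (induction A rule: infinite_finite_induct) (simp_all add: cip_add_left)

lemma cip_self: "cip a a = of_real ((norm a)\<^sup>2)"
proof -
  have "Im (cip a a) = 0" using arg_cong[OF cip_commute[of a a], of Im] by simp
  then show ?thesis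
    by (simp add: complex_eq_iff power2_norm_eq_inner inner_h2_def)
qed

text \<open>The bridge by which orthogonality, continuity and isometry pass from the real to the
  complex product.\<close>

lemma cip_eq_inner: "cip a b = Complex (inner a b) (inner a (\<i> *\<^sub>C b))"
  by (simp add: inner_h2_def cip_scale_right complex_eq_iff)

lemma norm_scaleC: "norm (c *\<^sub>C a) = cmod c * norm a"
proof -
  have "cip (c *\<^sub>C a) (c *\<^sub>C a) = (c * cnj c) * cip a a"
    by (simp add: cip_scale_left cip_scale_right)
  then have "complex_of_real ((norm (c *\<^sub>C a))\<^sup>2) = of_real ((cmod c * norm a)\<^sup>2)"
    by (simp only: cip_self complex_norm_square[symmetric] power_mult_distrib of_real_mult)
  then have "(norm (c *\<^sub>C a))\<^sup>2 = (cmod c * norm a)\<^sup>2" by (simp only: of_real_eq_iff)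
  then show ?thesis by simp
qed

lemma cip_Cauchy_Schwarz: "cmod (cip a b) \<le> norm a * norm b"
proof (cases "cip a b = 0")
  case False
  \<comment> \<open>A unimodular factor that rotates the product onto the positive axis, where the
    real Cauchy-Schwarz inequality applies.\<close>
  define c where "c = cnj (cip a b) / cmod (cip a b)"
  have c: "cmod c = 1" using False by (simp add: c_def norm_divide)
  have "cip (c *\<^sub>C a) b = of_real (cmod (cip a b))"
    using False complex_norm_square[of "cip a b"]
    by (simp add: c_def cip_scale_left power2_eq_square mult.commute nonzero_divide_eq_eq)
  then have "cmod (cip a b) = inner (c *\<^sub>C a) b" by (simp add: inner_h2_def)
  also have "\<dots> \<le> norm (c *\<^sub>C a) * norm b" by (rule norm_cauchy_schwarz)
  finally show ?thesis by (simp add: norm_scaleC c)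
qed simp

lemma cmod_coef_le: "cmod (coef a k) \<le> norm a"
proof -
  have "(cmod (coef a k))\<^sup>2 \<le> (\<Sum>k. (cmod (coef a k))\<^sup>2)"
    using sum_le_suminf[OF summable_coef[of a], of "{k}"] by auto
  then show ?thesis unfolding norm_h2_sq[symmetric] by (rule power2_le_imp_le) simp
qed

lemma h2_of_bounded_partial_sums:
  assumes "\<And>N. (\<Sum>k<N. (cmod (a k))\<^sup>2) \<le> C\<^sup>2"
  obtains b where "coef b = a" "(norm b)\<^sup>2 \<le> C\<^sup>2"
proof -
  have s: "summable (\<lambda>k. (cmod (a k))\<^sup>2)"
    by (rule summableI_nonneg_bounded[OF _ assms]) simp
  then have c: "coef (Abs_h2 a) = a" by (simp add: Abs_h2_inverse)
  have "(norm (Abs_h2 a))\<^sup>2 \<le> C\<^sup>2"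
    unfolding norm_h2_sq c by (rule suminf_le_const[OF s assms])
  with c that show ?thesis by blast
qed

text \<open>Coordinates converge, and each finite sum of squares of \<open>X m - l\<close> inherits
  the Cauchy bound, since it is a limit of finite sums over \<open>X m - X n\<close>.\<close>

instance h2 :: complete_space
proof
  fix X :: "nat \<Rightarrow> h2" assume X: "Cauchy X"
  have "Cauchy (\<lambda>n. coef (X n) k)" for k
  proof (rule metric_CauchyI)
    fix e :: real assume "e > 0"
    then obtain N where N: "\<And>m n. m \<ge> N \<Longrightarrow> n \<ge> N \<Longrightarrow> dist (X m) (X n) < e"
      using X metric_CauchyD by blast
    have "dist (coef (X m) k) (coef (X n) k) \<le> dist (X m) (X n)" for m n
      using cmod_coef_le[of "X m - X n" k] by (simp add: dist_norm)
    then show "\<exists>N. \<forall>m\<ge>N. \<forall>n\<ge>N. dist (coef (X m) k) (coef (X n) k) < e"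
      using N by (meson le_less_trans)
  qed
  then have "\<forall>k. \<exists>l. (\<lambda>n. coef (X n) k) \<longlonglongrightarrow> l"
    by (simp add: Cauchy_convergent_iff convergent_def)
  then obtain l where l: "\<And>k. (\<lambda>n. coef (X n) k) \<longlonglongrightarrow> l k" by metis
  have close: "\<exists>b. coef b = (\<lambda>k. coef (X m) k - l k) \<and> norm b \<le> e"
    if "e > 0" and N: "\<And>n. n \<ge> N \<Longrightarrow> dist (X m) (X n) < e" for e m N
  proof -
    have "(\<Sum>k<K. (cmod (coef (X m) k - l k))\<^sup>2) \<le> e\<^sup>2" for K
    proof (rule tendsto_upperbound)
      show "(\<lambda>n. \<Sum>k<K. (cmod (coef (X m) k - coef (X n) k))\<^sup>2) \<longlonglongrightarrow> (\<Sum>k<K. (cmod (coef (X m) k - l k))\<^sup>2)"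
        by (intro tendsto_intros l)
      show "\<forall>\<^sub>F n in sequentially. (\<Sum>k<K. (cmod (coef (X m) k - coef (X n) k))\<^sup>2) \<le> e\<^sup>2"
        using eventually_ge_at_top[of N]
      proof eventually_elim
        case (elim n)
        have "(\<Sum>k<K. (cmod (coef (X m) k - coef (X n) k))\<^sup>2) \<le> (norm (X m - X n))\<^sup>2"
          unfolding norm_h2_sq using sum_le_suminf[OF summable_coef[of "X m - X n"], of "{..<K}"] by auto
        also have "\<dots> \<le> e\<^sup>2" using N[OF elim] by (intro power_mono) (auto simp: dist_norm)
        finally show ?case .
      qed
    qed auto
    then obtain b where "coef b = (\<lambda>k. coef (X m) k - l k)" "(norm b)\<^sup>2 \<le> e\<^sup>2"
      by (rule h2_of_bounded_partial_sums)
    then show ?thesis using \<open>e > 0\<close> by (metis less_imp_le power2_le_imp_le)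
  qed
  obtain N1 where "\<And>m n. m \<ge> N1 \<Longrightarrow> n \<ge> N1 \<Longrightarrow> dist (X m) (X n) < 1"
    using X metric_CauchyD zero_less_one by blast
  then obtain b where b: "coef b = (\<lambda>k. coef (X N1) k - l k)" using close[of 1 N1 N1] by auto
  \<comment> \<open>The coordinatewise limit is square-summable because a single difference from a
    member of the sequence is.\<close>
  define L where "L = X N1 - b"
  have L: "coef L k = l k" for k by (simp add: L_def b)
  have "X \<longlonglongrightarrow> L"
  proof (rule metric_LIMSEQ_I)
    fix e :: real assume "e > 0"
    then obtain N where N: "\<And>m n. m \<ge> N \<Longrightarrow> n \<ge> N \<Longrightarrow> dist (X m) (X n) < e/2"
      using metric_CauchyD[OF X half_gt_zero[of e]] by blast
    have "dist (X m) L < e" if "m \<ge> N" for m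
    proof -
      obtain d where d: "coef d = (\<lambda>k. coef (X m) k - l k)" "norm d \<le> e/2"
        using close[of "e/2" N m, OF half_gt_zero[OF \<open>e > 0\<close>] N[OF \<open>m \<ge> N\<close>]] by blast
      have "X m - L = d" by (rule h2_eqI) (simp add: L d(1))
      then show ?thesis using d(2) \<open>e > 0\<close> by (simp add: dist_norm)
    qed
    then show "\<exists>N. \<forall>m\<ge>N. dist (X m) L < e" by blast
  qed
  then show "convergent X" by (auto simp: convergent_def)
qed

section \<open>Orthogonal projection onto a closed subspace\<close>

lemma orthogonal_projection_exists:
  fixes S :: "'a::{real_inner,complete_space} set"
  assumes "subspace S" "closed S"
  obtains p where "p \<in> S" "\<And>s. s \<in> S \<Longrightarrow> inner (x - p) s = 0"
proof -
  define d where "d = infdist x S"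
  have ne: "S \<noteq> {}" using subspace_0[OF assms(1)] by auto
  have d0: "d \<ge> 0" by (simp add: d_def infdist_nonneg)
  have dle: "d \<le> dist x s" if "s \<in> S" for s using infdist_le[OF that] by (simp add: d_def)
  have "\<exists>s\<in>S. dist x s < d + 1 / real (Suc n)" for n
  proof -
    have "infdist x S < d + 1 / real (Suc n)" by (simp add: d_def)
    then show ?thesis
      unfolding infdist_notempty[OF ne] by (subst (asm) cINF_less_iff) (auto simp: ne intro!: bdd_belowI[of _ 0])
  qed
  then obtain s where sS: "\<And>n. s n \<in> S" and sd: "\<And>n. dist x (s n) < d + 1 / real (Suc n)"
    by metis
  \<comment> \<open>Parallelogram law: the midpoint is at distance at least d from x, so two nearly
    optimal points are close and a minimising sequence is Cauchy.\<close>
  have par: "(dist u v)\<^sup>2 \<le> 2 * (dist x u)\<^sup>2 + 2 * (dist x v)\<^sup>2 - 4 * d\<^sup>2" if "u \<in> S" "v \<in> S" for u v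
  proof -
    have m: "(1/2) *\<^sub>R (u + v) \<in> S"
      using that assms(1) by (simp add: subspace_add subspace_scale)
    have "4 * d\<^sup>2 \<le> 4 * (dist x ((1/2) *\<^sub>R (u + v)))\<^sup>2"
      using dle[OF m] d0 by (intro mult_left_mono power_mono) auto
    also have "\<dots> = 2 * (dist x u)\<^sup>2 + 2 * (dist x v)\<^sup>2 - (dist u v)\<^sup>2"
      unfolding dist_norm power2_norm_eq_inner by (simp add: inner_simps inner_commute algebra_simps)
    finally show ?thesis by simp
  qed
  have lim: "(\<lambda>n. dist x (s n)) \<longlonglongrightarrow> d"
  proof (rule tendsto_sandwich[of "\<lambda>_. d"])
    show "(\<lambda>n. d + 1 / real (Suc n)) \<longlonglongrightarrow> d"
      using tendsto_add[OF tendsto_const LIMSEQ_inverse_real_of_nat, of d] by (simp add: inverse_eq_divide)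
    show "\<forall>\<^sub>F n in sequentially. d \<le> dist x (s n)" using dle sS by simp
    show "\<forall>\<^sub>F n in sequentially. dist x (s n) \<le> d + 1 / real (Suc n)"
      using sd by (auto intro!: always_eventually less_imp_le)
  qed simp
  have "Cauchy s"
  proof (rule metric_CauchyI)
    fix e :: real assume "e > 0"
    have "(\<lambda>n. (dist x (s n))\<^sup>2) \<longlonglongrightarrow> d\<^sup>2" by (intro tendsto_intros lim)
    moreover have "d\<^sup>2 < d\<^sup>2 + e\<^sup>2 / 4" using \<open>e > 0\<close> by simp
    ultimately have "\<forall>\<^sub>F n in sequentially. (dist x (s n))\<^sup>2 < d\<^sup>2 + e\<^sup>2 / 4"
      by (rule order_tendstoD)
    then obtain N where N: "\<And>n. n \<ge> N \<Longrightarrow> (dist x (s n))\<^sup>2 < d\<^sup>2 + e\<^sup>2 / 4"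
      by (auto simp: eventually_sequentially)
    have "dist (s m) (s n) < e" if "m \<ge> N" "n \<ge> N" for m n
    proof -
      have "(dist (s m) (s n))\<^sup>2 < e\<^sup>2"
        using par[OF sS sS, of m n] N[OF that(1)] N[OF that(2)] by simp
      then show ?thesis using \<open>e > 0\<close> by (meson less_imp_le power2_less_imp_less)
    qed
    then show "\<exists>N. \<forall>m\<ge>N. \<forall>n\<ge>N. dist (s m) (s n) < e" by blast
  qed
  then obtain p where p: "s \<longlonglongrightarrow> p" using Cauchy_convergent convergent_def by blast
  have pS: "p \<in> S" using closed_sequentially[OF assms(2) _ p] sS by blast
  have "(\<lambda>n. dist x (s n)) \<longlonglongrightarrow> dist x p" by (intro tendsto_intros p)
  then have dp: "dist x p = d" using lim LIMSEQ_unique by blast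
  have "inner (x - p) q = 0" if "q \<in> S" for q
  proof (cases "q = 0")
    case False
    \<comment> \<open>The minimiser of the quadratic t -> |x - p - t q|^2; any gain over t = 0 would
      contradict the optimality of p.\<close>
    define t where "t = inner (x - p) q / (norm q)\<^sup>2"
    have "p + t *\<^sub>R q \<in> S" using pS that assms(1) by (simp add: subspace_add subspace_scale)
    then have "(norm (x - p))\<^sup>2 \<le> (norm (x - (p + t *\<^sub>R q)))\<^sup>2"
      using dle dp d0 by (metis dist_norm norm_ge_zero power_mono)
    also have "\<dots> = (norm (x - p))\<^sup>2 - 2 * t * inner (x - p) q + t\<^sup>2 * (norm q)\<^sup>2"
      unfolding power2_norm_eq_inner by (simp add: inner_simps inner_commute algebra_simps power2_eq_square)
    also have "\<dots> = (norm (x - p))\<^sup>2 - (inner (x - p) q)\<^sup>2 / (norm q)\<^sup>2"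
      using False by (simp add: t_def power2_eq_square field_simps)
    finally have "(inner (x - p) q)\<^sup>2 / (norm q)\<^sup>2 \<le> 0" by simp
    then show ?thesis using False by (simp add: divide_le_0_iff)
  qed simp
  with pS that show ?thesis by blast
qed

section \<open>Evaluation, circle means and multipliers\<close>

lemma eventually_unit_interval: "\<forall>\<^sub>F r in at_left 1. r \<in> {0<..<1::real}"
  by (rule eventually_at_leftI[of 0]) auto

lemma one_minus_cnj_mult_nonzero:
  assumes "cmod a < 1" "cmod z < 1" shows "cmod (cnj a * z) < 1" "1 - cnj a * z \<noteq> 0"
proof -
  show "cmod (cnj a * z) < 1"
    using assms by (simp add: norm_mult) (metis mult_strict_mono' norm_ge_zero mult_1)
  then show "1 - cnj a * z \<noteq> 0" by auto
qed

text \<open>The value 0 off the disc matches the canonical representatives in \<open>Hinf\<close>,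
  so \<open>ev a \<in> M\<close> is literal membership of a total function.\<close>

definition ev :: "h2 \<Rightarrow> complex \<Rightarrow> complex" where
  "ev a z = (if cmod z < 1 then (\<Sum>k. coef a k * z ^ k) else 0)"

lemma ev_outside [simp]: "\<not> cmod z < 1 \<Longrightarrow> ev a z = 0"
  by (simp add: ev_def)

lemma summable_ev: "cmod z < 1 \<Longrightarrow> summable (\<lambda>k. cmod (coef a k * z ^ k))"
proof (rule summable_comparison_test)
  assume "cmod z < 1"
  then show "summable (\<lambda>k. norm a * cmod z ^ k)"
    by (intro summable_mult summable_geometric) simp
  show "\<exists>N. \<forall>n\<ge>N. norm (cmod (coef a n * z ^ n)) \<le> norm a * cmod z ^ n"
    by (auto simp: norm_mult norm_power intro!: mult_right_mono cmod_coef_le)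
qed

lemma ev_sums: "cmod z < 1 \<Longrightarrow> (\<lambda>k. coef a k * z ^ k) sums ev a z"
  unfolding ev_def using summable_norm_cancel[OF summable_ev] by (simp add: summable_sums)

lemma ev_holomorphic: "ev a holomorphic_on ball 0 1"
  using power_series_holomorphic[of 0 1 "coef a" "ev a"] ev_sums[of _ a] by simp

lemma ev_add [simp]: "ev (a + b) z = ev a z + ev b z"
proof (cases "cmod z < 1")
  case True
  show ?thesis
    using sums_unique2[OF ev_sums[OF True, of "a + b"]] sums_add[OF ev_sums[OF True, of a] ev_sums[OF True, of b]]
    by (simp add: distrib_right)
qed simp

lemma ev_scale [simp]: "ev (c *\<^sub>C a) z = c * ev a z"
proof (cases "cmod z < 1")
  case True
  show ?thesis
    using sums_unique2[OF ev_sums[OF True, of "c *\<^sub>C a"]] sums_mult[OF ev_sums[OF True, of a], of c]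
    by (simp add: mult.assoc)
qed simp

lemma ev_minus [simp]: "ev (- a) z = - ev a z"
  by (simp add: scaleC_minus_one)

lemma ev_diff [simp]: "ev (a - b) z = ev a z - ev b z"
  using ev_add[of a "- b" z] by simp

lemma ev_zero [simp]: "ev 0 z = 0"
  by (simp add: ev_def)

lemma ev_sum: "ev (sum f A) z = (\<Sum>i\<in>A. ev (f i) z)"
  by (induction A rule: infinite_finite_induct) simp_all

text \<open>The reproducing kernel at w: it makes point evaluation an inner product, hence
  continuous. \<open>szego 0\<close> is the constant function 1 on the disc.\<close>

definition szego :: "complex \<Rightarrow> h2" where
  "szego w = Abs_h2 (\<lambda>k. cnj w ^ k)"

lemma coef_szego: "cmod w < 1 \<Longrightarrow> coef (szego w) k = cnj w ^ k"
proof -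
  assume "cmod w < 1"
  then have "summable (\<lambda>k. ((cmod w)\<^sup>2) ^ k)"
    by (intro summable_geometric) (simp add: abs_square_less_1)
  then show ?thesis
    by (simp add: szego_def Abs_h2_inverse norm_power power_mult[symmetric] mult.commute)
qed

lemma norm_szego: "cmod w < 1 \<Longrightarrow> (norm (szego w))\<^sup>2 = 1 / (1 - (cmod w)\<^sup>2)"
  unfolding norm_h2_sq
  by (simp add: coef_szego norm_power power_mult[symmetric] mult.commute[of _ 2])
     (simp add: power_mult suminf_geometric abs_square_less_1)

lemma cip_szego: "cmod w < 1 \<Longrightarrow> cip a (szego w) = ev a w"
  by (simp add: cip_def coef_szego ev_def)

lemma ev_szego: "cmod w < 1 \<Longrightarrow> cmod z < 1 \<Longrightarrow> ev (szego w) z = 1 / (1 - cnj w * z)"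
  using one_minus_cnj_mult_nonzero(1)[of w z]
  by (simp add: ev_def coef_szego power_mult_distrib[symmetric] suminf_geometric)

lemma ev_bound: "cmod z < 1 \<Longrightarrow> cmod (ev a z) \<le> norm a * norm (szego z)"
  using cip_Cauchy_Schwarz[of a "szego z"] by (simp add: cip_szego)

lemma ev_bound_sq: "cmod z < 1 \<Longrightarrow> (cmod (ev a z))\<^sup>2 \<le> (norm a)\<^sup>2 / (1 - (cmod z)\<^sup>2)"
  using power_mono[OF ev_bound[of z a] norm_ge_zero, of 2] by (simp add: power_mult_distrib norm_szego)

section \<open>Circle means and Parseval's formula\<close>

lemma sums_set_lebesgue_integral:
  fixes \<phi> s :: "real \<Rightarrow> complex" and c :: "nat \<Rightarrow> complex"
  assumes \<phi>: "continuous_on {p..q} \<phi>"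
    and e: "\<And>k. continuous_on {p..q} (e k)" "\<And>k t. t \<in> {p..q} \<Longrightarrow> cmod (e k t) \<le> 1"
    and c: "summable (\<lambda>k. cmod (c k))"
    and s: "\<And>t. t \<in> {p..q} \<Longrightarrow> (\<lambda>k. c k * e k t) sums s t"
  shows "(\<lambda>k. c k * (LINT t:{p..q}|lborel. \<phi> t * e k t)) sums (LINT t:{p..q}|lborel. \<phi> t * s t)"
proof -
  define f where "f k t = indicator {p..q} t *\<^sub>R (c k * (\<phi> t * e k t))" for k t
  have int: "integrable lborel (f k)" for k
    unfolding f_def by (intro borel_integrable_compact continuous_intros \<phi> e compact_Icc)
  have int\<phi>: "integrable lborel (\<lambda>t. indicator {p..q} t *\<^sub>R cmod (\<phi> t))"
    by (intro borel_integrable_compact continuous_intros \<phi> compact_Icc)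
  define K where "K = (\<integral>t. indicator {p..q} t *\<^sub>R cmod (\<phi> t) \<partial>lborel)"
  have le: "norm (f k t) \<le> cmod (c k) * (indicator {p..q} t *\<^sub>R cmod (\<phi> t))" for k t
  proof (cases "t \<in> {p..q}")
    case True
    have "cmod (c k) * (cmod (\<phi> t) * cmod (e k t)) \<le> cmod (c k) * (cmod (\<phi> t) * 1)"
      using e(2)[OF True] by (intro mult_left_mono) auto
    then show ?thesis using True by (simp add: f_def norm_mult)
  qed (simp add: f_def)
  have "(\<integral>t. norm (f k t) \<partial>lborel) \<le> cmod (c k) * K" for k
  proof -
    have "(\<integral>t. norm (f k t) \<partial>lborel) \<le> (\<integral>t. cmod (c k) * (indicator {p..q} t *\<^sub>R cmod (\<phi> t)) \<partial>lborel)"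
      by (intro integral_mono integrable_norm int integrable_mult_right int\<phi> le)
    then show ?thesis by (simp add: K_def)
  qed
  then have sumint: "summable (\<lambda>k. \<integral>t. norm (f k t) \<partial>lborel)"
    by (intro summable_comparison_test[OF _ summable_mult2[OF c, of K]]) auto
  have "summable (\<lambda>k. norm (f k t))" for t
    by (intro summable_comparison_test[OF _ summable_mult2[OF c, of "indicator {p..q} t *\<^sub>R cmod (\<phi> t)"]])
       (use le in auto)
  then have "(\<lambda>k. integral\<^sup>L lborel (f k)) sums (\<integral>t. (\<Sum>k. f k t) \<partial>lborel)"
    by (intro sums_integral int sumint) simp
  moreover have "(\<Sum>k. f k t) = indicator {p..q} t *\<^sub>R (\<phi> t * s t)" for t
  proof (cases "t \<in> {p..q}")
    case True
    then have "(\<lambda>k. f k t) sums (\<phi> t * s t)"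
      using sums_mult[OF s[OF True], of "\<phi> t"] by (simp add: f_def mult_ac)
    then show ?thesis using True by (simp add: sums_iff)
  qed (simp add: f_def)
  moreover have "integral\<^sup>L lborel (f k) = c k * (LINT t:{p..q}|lborel. \<phi> t * e k t)" for k
    unfolding f_def set_lebesgue_integral_def
    by (subst integral_mult_right_zero[symmetric]) (simp add: scaleR_conv_of_real mult_ac)
  ultimately show ?thesis by (simp add: set_lebesgue_integral_def)
qed

lemma integral_cis_multiple:
  "(LINT t:{0..2*pi}|lborel. cis (of_int m * t)) = (if m = 0 then of_real (2 * pi) else 0)"
proof (cases "m = 0")
  case True
  then show ?thesis by (simp add: set_lebesgue_integral_def scaleR_conv_of_real)
next
  case False
  have "(\<integral>t. indicator {0..2*pi} t *\<^sub>R cis (of_int m * t) \<partial>lborel) =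
      cis (of_int m * (2 * pi)) / (\<i> * of_int m) - cis (of_int m * 0) / (\<i> * of_int m)"
  proof (rule integral_FTC_atLeastAtMost)
    fix t :: real
    have "((\<lambda>z. exp (\<i> * of_int m * z) / (\<i> * of_int m)) has_field_derivative exp (\<i> * of_int m * of_real t)) (at (of_real t))"
      using False by (auto intro!: derivative_eq_intros)
    from has_vector_derivative_real_field[OF this]
    show "((\<lambda>t. cis (of_int m * t) / (\<i> * of_int m)) has_vector_derivative cis (of_int m * t)) (at t within {0..2*pi})"
      by (simp add: cis_conv_exp mult.assoc)
  qed (auto intro!: continuous_intros)
  moreover have "cis (of_int m * (2 * pi)) = 1"
    by (metis cis_multiple_2pi Ints_of_int mult.commute)
  ultimately show ?thesis using False by (simp add: set_lebesgue_integral_def)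
qed

definition circle_mean :: "real \<Rightarrow> (complex \<Rightarrow> complex) \<Rightarrow> (complex \<Rightarrow> complex) \<Rightarrow> complex" where
  "circle_mean r f g = (LINT t:{0..2*pi}|lborel. f (of_real r * cis t) * cnj (g (of_real r * cis t))) / (2 * pi)"

lemma continuous_on_circle:
  assumes "f holomorphic_on ball 0 1" "0 \<le> r" "r < 1"
  shows "continuous_on S (\<lambda>t. f (of_real r * cis t))"
proof -
  have "continuous_on (ball 0 1) f" by (rule holomorphic_on_imp_continuous_on[OF assms(1)])
  then show ?thesis
    by (rule continuous_on_compose2) (use assms(2,3) in \<open>auto intro!: continuous_intros simp: norm_mult\<close>)
qed

text \<open>Parseval on the circle of radius r, by two termwise integrations: expanding f yields its
  Fourier coefficients, then expanding g pairs them with those of g.\<close>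

lemma circle_mean_sums:
  assumes f: "\<And>z. cmod z < 1 \<Longrightarrow> (\<lambda>k. u k * z ^ k) sums f z"
    and g: "\<And>z. cmod z < 1 \<Longrightarrow> (\<lambda>k. v k * z ^ k) sums g z"
    and r: "0 \<le> r" "r < 1"
  shows "(\<lambda>k. u k * cnj (v k) * of_real (r ^ (2 * k))) sums circle_mean r f g"
proof -
  have abs: "summable (\<lambda>k. cmod (w k * of_real r ^ k))"
    if w: "\<And>z. cmod z < 1 \<Longrightarrow> (\<lambda>k. w k * z ^ k) sums h z" for w h
  proof -
    \<comment> \<open>Convergence at a slightly larger radius gives absolute convergence at
      r.\<close>
    obtain R where R: "r < R" "R < 1" using dense r(2) by blast
    have "summable (\<lambda>k. w k * of_real R ^ k)" using w[of "of_real R"] R r by (auto simp: sums_iff)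
    then have "summable (\<lambda>k. norm (w k * of_real r ^ k))"
      by (rule powser_insidea) (use R r in simp)
    then show ?thesis by simp
  qed
  have holf: "f holomorphic_on ball 0 1"
    using power_series_holomorphic[of 0 1 u f] f by simp
  have p: "(of_real r * cis t) ^ k = of_real r ^ k * cis (real k * t)" for k t
    by (simp add: power_mult_distrib Complex.DeMoivre)
  have 1: "(LINT t:{0..2*pi}|lborel. f (of_real r * cis t) * cis (- (real k * t))) = 2 * pi * (u k * of_real r ^ k)" for k
  proof -
    have "(\<lambda>j. (u j * of_real r ^ j) * (LINT t:{0..2*pi}|lborel. cis (- (real k * t)) * cis (real j * t))) sums
        (LINT t:{0..2*pi}|lborel. cis (- (real k * t)) * f (of_real r * cis t))"
    proof (rule sums_set_lebesgue_integral)
      fix t :: real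
      show "(\<lambda>j. u j * of_real r ^ j * cis (real j * t)) sums f (of_real r * cis t)"
        using f[of "of_real r * cis t"] r by (simp add: norm_mult p mult.assoc)
    qed (auto intro!: continuous_intros abs f)
    moreover have "(LINT t:{0..2*pi}|lborel. cis (- (real k * t)) * cis (real j * t)) = (if j = k then of_real (2 * pi) else 0)" for j
      using integral_cis_multiple[of "int j - int k"]
      by (simp add: cis_mult algebra_simps del: of_real_mult)
    ultimately have "(\<lambda>j. (u j * of_real r ^ j) * (if j = k then of_real (2 * pi) else 0)) sums
        (LINT t:{0..2*pi}|lborel. cis (- (real k * t)) * f (of_real r * cis t))"
      by (simp only:)
    moreover have "(\<lambda>j. (u j * of_real r ^ j) * (if j = k then complex_of_real (2 * pi) else 0)) =
        (\<lambda>j. if j = k then (u j * of_real r ^ j) * of_real (2 * pi) else 0)" by auto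
    ultimately have "(\<lambda>j. if j = k then (u j * of_real r ^ j) * of_real (2 * pi) else 0) sums
        (LINT t:{0..2*pi}|lborel. f (of_real r * cis t) * cis (- (real k * t)))"
      by (simp only: mult.commute[of "cis _" "f _"])
    then show ?thesis
      using sums_unique2[OF sums_single[of k "\<lambda>j. (u j * of_real r ^ j) * of_real (2 * pi)"]] by (simp add: mult_ac)
  qed
  have "(\<lambda>k. cnj (v k * of_real r ^ k) * (LINT t:{0..2*pi}|lborel. f (of_real r * cis t) * cis (- (real k * t)))) sums
      (LINT t:{0..2*pi}|lborel. f (of_real r * cis t) * cnj (g (of_real r * cis t)))"
  proof (rule sums_set_lebesgue_integral)
    show "continuous_on {0..2*pi} (\<lambda>t. f (of_real r * cis t))"
      by (rule continuous_on_circle[OF holf r])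
    show "(\<lambda>k. cnj (v k * of_real r ^ k) * cis (- (real k * t))) sums cnj (g (of_real r * cis t))" for t
    proof -
      have "(\<lambda>k. cnj (v k * (of_real r * cis t) ^ k)) sums cnj (g (of_real r * cis t))"
        unfolding sums_cnj using r by (intro g) (simp add: norm_mult)
      then show ?thesis by (simp add: p cis_cnj mult.assoc)
    qed
    have "cmod (cnj w) = cmod w" for w by simp
    then show "summable (\<lambda>k. cmod (cnj (v k * of_real r ^ k)))" using abs[OF g] by (simp only:)
  qed (auto intro!: continuous_intros)
  then have "(\<lambda>k. cnj (v k * of_real r ^ k) * (2 * pi * (u k * of_real r ^ k)) / (2 * pi)) sums circle_mean r f g"
    unfolding circle_mean_def 1 by (rule sums_divide)
  moreover have "cnj (v k * of_real r ^ k) * (of_real (2 * pi) * (u k * of_real r ^ k)) / of_real (2 * pi) =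
      u k * cnj (v k) * of_real (r ^ (2 * k))" for k
  proof -
    have "complex_of_real (r ^ (2 * k)) = of_real r ^ k * of_real r ^ k"
      by (simp add: mult_2 power_add)
    then show ?thesis by (simp del: of_real_power)
  qed
  ultimately show ?thesis by (simp only:)
qed

text \<open>The mean over the circle of radius r is a power series \<open>S\<close> evaluated at
  r^2. Its coefficients are absolutely summable, so the M-test makes \<open>S\<close> continuous up
  to the point 1.\<close>

lemma circle_mean_ev_tendsto:
  "((\<lambda>r. circle_mean r (ev a) (ev b)) \<longlongrightarrow> cip a b) (at_left 1)"
proof -
  define S where "S x = (\<Sum>k. coef a k * cnj (coef b k) * of_real (x ^ k))" for x :: real
  have sm: "summable (\<lambda>k. cmod (coef a k * cnj (coef b k)))"
    using summable_sq_mult[OF summable_coef[of a], of "\<lambda>k. cnj (coef b k)"] summable_coef[of b] by simp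
  have "uniform_limit {0..1} (\<lambda>n x. \<Sum>k<n. coef a k * cnj (coef b k) * of_real (x ^ k)) S sequentially"
    unfolding S_def
  proof (rule Weierstrass_m_test[OF _ sm])
    fix k and x :: real assume "x \<in> {0..1}"
    then have "x ^ k \<le> 1" "0 \<le> x ^ k" by (auto intro: power_le_one)
    then show "norm (coef a k * cnj (coef b k) * of_real (x ^ k)) \<le> cmod (coef a k * cnj (coef b k))"
      unfolding norm_mult norm_of_real by (intro mult_left_le) auto
  qed
  then have "continuous_on {0..1} S"
    by (rule uniform_limit_theorem[rotated]) (auto intro!: always_eventually continuous_intros)
  then have S1: "(S \<longlongrightarrow> S 1) (at 1 within {0..1})"
    by (simp add: continuous_on_def)
  have "filterlim (\<lambda>r::real. r\<^sup>2) (at 1 within {0..1}) (at_left 1)"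
    unfolding filterlim_at
  proof
    show "\<forall>\<^sub>F r::real in at_left 1. r\<^sup>2 \<in> {0..1} \<and> r\<^sup>2 \<noteq> 1"
      using eventually_unit_interval by eventually_elim (auto simp: power_le_one power2_eq_1_iff)
    show "((\<lambda>r::real. r\<^sup>2) \<longlongrightarrow> 1) (at_left 1)"
      by (rule tendsto_eq_intros | simp)+
  qed
  from filterlim_compose[OF S1 this] have "((\<lambda>r. S (r\<^sup>2)) \<longlongrightarrow> S 1) (at_left 1)" .
  moreover have "S 1 = cip a b" by (simp add: S_def cip_def)
  moreover have "\<forall>\<^sub>F r in at_left 1. S (r\<^sup>2) = circle_mean r (ev a) (ev b)"
    using eventually_unit_interval
  proof eventually_elim
    case (elim r)
    then show ?case
      using sums_unique[OF circle_mean_sums[OF ev_sums[of _ a] ev_sums[of _ b], of r]]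
      by (simp add: S_def power_mult)
  qed
  ultimately show ?thesis using tendsto_cong by force
qed

lemma h2_inner_ev: "h2_inner (ev a) (ev b) = cip a b"
  unfolding h2_inner_def using circle_mean_ev_tendsto[of a b]
  by (intro tendsto_Lim) (auto simp: circle_mean_def)

text \<open>The norm can be read off from the function through \<open>h2_inner\<close>, so a
  difference with vanishing function has norm 0. Identities in \<open>h2\<close> are proved
  pointwise from here on.\<close>

lemma ev_inject: "ev a = ev b \<Longrightarrow> a = b"
proof -
  assume "ev a = ev b"
  then have 0: "ev (a - b) = ev 0" by (simp add: fun_eq_iff)
  have "cip (a - b) (a - b) = 0" using h2_inner_ev[of "a - b" "a - b"] h2_inner_ev[of 0 0] by (simp add: 0)
  then show ?thesis by (simp add: cip_self)
qed

text \<open>The diagonal of \<open>circle_mean\<close> as a real number, so that means can be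
  compared by order.\<close>

definition circle_msq :: "real \<Rightarrow> (complex \<Rightarrow> complex) \<Rightarrow> real" where
  "circle_msq r f = (LINT t:{0..2*pi}|lborel. (cmod (f (of_real r * cis t)))\<^sup>2) / (2 * pi)"

lemma circle_mean_self: "circle_mean r f f = of_real (circle_msq r f)"
proof -
  have "(LINT t:{0..2*pi}|lborel. complex_of_real ((cmod (f (of_real r * cis t)))\<^sup>2)) =
      of_real (LINT t:{0..2*pi}|lborel. (cmod (f (of_real r * cis t)))\<^sup>2)"
    by (rule set_integral_complex_of_real)
  then show ?thesis
    unfolding circle_mean_def circle_msq_def complex_norm_square[symmetric] by simp
qed

lemma circle_msq_tendsto: "((\<lambda>r. circle_msq r (ev a)) \<longlongrightarrow> (norm a)\<^sup>2) (at_left 1)"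
  using tendsto_Re[OF circle_mean_ev_tendsto[of a a]] by (simp add: circle_mean_self cip_self)

lemma circle_msq_sums:
  assumes "0 \<le> r" "r < 1"
    and f: "\<And>z. cmod z < 1 \<Longrightarrow> (\<lambda>k. u k * z ^ k) sums f z"
  shows "(\<lambda>k. (cmod (u k))\<^sup>2 * r ^ (2 * k)) sums circle_msq r f"
proof -
  have "(\<lambda>k. Re (u k * cnj (u k) * of_real (r ^ (2 * k)))) sums Re (circle_mean r f f)"
    using circle_mean_sums[OF f f assms(1,2)] by (simp only: sums_Re)
  then show ?thesis
    by (simp only: circle_mean_self complex_norm_square[symmetric] of_real_mult[symmetric] Re_complex_of_real)
qed

lemma circle_integral_sum:
  assumes h: "\<And>i. i \<in> I \<Longrightarrow> h i holomorphic_on ball 0 1" and r: "0 \<le> r" "r < 1"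
  shows "set_integrable lborel {0..2*pi} (\<lambda>t. \<Sum>i\<in>I. c i * (cmod (h i (of_real r * cis t)))\<^sup>2)"
    and "(LINT t:{0..2*pi}|lborel. \<Sum>i\<in>I. c i * (cmod (h i (of_real r * cis t)))\<^sup>2) / (2 * pi) =
      (\<Sum>i\<in>I. c i * circle_msq r (h i))"
proof -
  have int: "integrable lborel (\<lambda>t. indicator {0..2*pi} t *\<^sub>R (c i * (cmod (h i (of_real r * cis t)))\<^sup>2))"
    if "i \<in> I" for i
    by (intro borel_integrable_compact continuous_intros continuous_on_circle[OF h[OF that] r] compact_Icc)
  then show "set_integrable lborel {0..2*pi} (\<lambda>t. \<Sum>i\<in>I. c i * (cmod (h i (of_real r * cis t)))\<^sup>2)"
    unfolding set_integrable_def scaleR_sum_right by auto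
  have "(LINT t:{0..2*pi}|lborel. \<Sum>i\<in>I. c i * (cmod (h i (of_real r * cis t)))\<^sup>2) =
      (\<Sum>i\<in>I. c i * (LINT t:{0..2*pi}|lborel. (cmod (h i (of_real r * cis t)))\<^sup>2))"
    using int unfolding set_lebesgue_integral_def scaleR_sum_right
    by (auto simp: Bochner_Integration.integral_sum mult.left_commute)
  then show "(LINT t:{0..2*pi}|lborel. \<Sum>i\<in>I. c i * (cmod (h i (of_real r * cis t)))\<^sup>2) / (2 * pi) =
      (\<Sum>i\<in>I. c i * circle_msq r (h i))"
    by (simp add: circle_msq_def sum_divide_distrib)
qed

text \<open>Weighted sums on both sides let one lemma serve the multiplier bound, the isometry and
  the dimension count; a single function is a sum over \<open>{()}\<close>.\<close>

lemma circle_msq_mono: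
  assumes f: "\<And>i. i \<in> I \<Longrightarrow> f i holomorphic_on ball 0 1" and g: "\<And>j. j \<in> K \<Longrightarrow> g j holomorphic_on ball 0 1"
    and r: "0 \<le> r" "r < 1"
    and le: "\<And>z. cmod z = r \<Longrightarrow> (\<Sum>i\<in>I. c i * (cmod (f i z))\<^sup>2) \<le> (\<Sum>j\<in>K. d j * (cmod (g j z))\<^sup>2)"
  shows "(\<Sum>i\<in>I. c i * circle_msq r (f i)) \<le> (\<Sum>j\<in>K. d j * circle_msq r (g j))"
proof -
  have "(LINT t:{0..2*pi}|lborel. \<Sum>i\<in>I. c i * (cmod (f i (of_real r * cis t)))\<^sup>2) / (2 * pi)
      \<le> (LINT t:{0..2*pi}|lborel. \<Sum>j\<in>K. d j * (cmod (g j (of_real r * cis t)))\<^sup>2) / (2 * pi)"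
    using f g r by (intro divide_right_mono set_integral_mono circle_integral_sum(1) le) (auto simp: norm_mult)
  then show ?thesis
    using circle_integral_sum(2)[of I f r c] circle_integral_sum(2)[of K g r d] f g r by simp
qed

lemma circle_msq_ev_le: "0 \<le> r \<Longrightarrow> r < 1 \<Longrightarrow> circle_msq r (ev a) \<le> (norm a)\<^sup>2"
proof -
  assume r: "0 \<le> r" "r < 1"
  have s: "(\<lambda>k. (cmod (coef a k))\<^sup>2 * r ^ (2 * k)) sums circle_msq r (ev a)"
    by (rule circle_msq_sums[OF r ev_sums])
  show ?thesis
    unfolding norm_h2_sq sums_unique[OF s]
    by (rule suminf_le) (use r s summable_coef in \<open>auto simp: sums_iff intro!: mult_left_le power_le_one\<close>)
qed

text \<open>By Parseval the bound on the means controls each finite sum of |u k|^2 r^(2k). Letting r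
  tend to 1 first, with N fixed, bounds the partial sums themselves.\<close>

lemma h2_of_holomorphic:
  assumes f: "f holomorphic_on ball 0 1" and out: "\<And>z. \<not> cmod z < 1 \<Longrightarrow> f z = 0"
    and C: "\<And>r. 0 \<le> r \<Longrightarrow> r < 1 \<Longrightarrow> circle_msq r f \<le> C\<^sup>2" and "C \<ge> 0"
  obtains b where "ev b = f" "norm b \<le> C"
proof -
  define u where "u k = (deriv ^^ k) f 0 / fact k" for k
  have u: "(\<lambda>k. u k * z ^ k) sums f z" if "cmod z < 1" for z
    using holomorphic_power_series[OF f, of z] that by (simp add: u_def)
  have "(\<Sum>k<N. (cmod (u k))\<^sup>2) \<le> C\<^sup>2" for N
  proof (rule tendsto_upperbound)
    show "((\<lambda>r. \<Sum>k<N. (cmod (u k))\<^sup>2 * r ^ (2 * k)) \<longlongrightarrow> (\<Sum>k<N. (cmod (u k))\<^sup>2)) (at_left 1)"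
      by (rule tendsto_eq_intros | simp)+
    show "\<forall>\<^sub>F r in at_left 1. (\<Sum>k<N. (cmod (u k))\<^sup>2 * r ^ (2 * k)) \<le> C\<^sup>2"
      using eventually_unit_interval
    proof eventually_elim
      case (elim r)
      then have s: "(\<lambda>k. (cmod (u k))\<^sup>2 * r ^ (2 * k)) sums circle_msq r f"
        by (intro circle_msq_sums u) auto
      have "(\<Sum>k<N. (cmod (u k))\<^sup>2 * r ^ (2 * k)) \<le> circle_msq r f"
        unfolding sums_unique[OF s] by (rule sum_le_suminf) (use s elim in \<open>auto simp: sums_iff\<close>)
      also have "\<dots> \<le> C\<^sup>2" using C elim by simp
      finally show ?case .
    qed
  qed simp
  then obtain b where b: "coef b = u" "(norm b)\<^sup>2 \<le> C\<^sup>2" by (rule h2_of_bounded_partial_sums)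
  have "ev b z = f z" for z
    using sums_unique2[OF ev_sums[of z b] u[of z, folded b(1)]] out by (cases "cmod z < 1") auto
  then show ?thesis
    using that[of b] b(2) \<open>C \<ge> 0\<close> power2_le_imp_le by (simp add: fun_eq_iff)
qed

section \<open>Multiplication by bounded holomorphic functions\<close>

definition bdd_hol :: "(complex \<Rightarrow> complex) \<Rightarrow> real \<Rightarrow> bool" where
  "bdd_hol u C \<longleftrightarrow> u holomorphic_on ball 0 1 \<and> (\<forall>z. cmod z < 1 \<longrightarrow> cmod (u z) \<le> C)"

text \<open>For bounded holomorphic u a witness exists by \<open>mul_exists\<close> and is unique by
  \<open>ev_inject\<close>; only such u are used.\<close>

definition mul :: "(complex \<Rightarrow> complex) \<Rightarrow> h2 \<Rightarrow> h2" where
  "mul u a = (SOME b. ev b = (\<lambda>z. u z * ev a z))"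

lemma bdd_holD: "bdd_hol f D \<Longrightarrow> cmod z < 1 \<Longrightarrow> cmod (f z) \<le> D"
  by (simp add: bdd_hol_def)

lemma bdd_hol_mono: "bdd_hol f C \<Longrightarrow> C \<le> D \<Longrightarrow> bdd_hol f D"
  by (force simp: bdd_hol_def)

lemma bdd_hol_nonneg: "bdd_hol u C \<Longrightarrow> C \<ge> 0"
  unfolding bdd_hol_def using norm_ge_zero[of "u 0"] order_trans norm_zero zero_less_one by metis

lemma mul_exists:
  assumes "bdd_hol u C"
  obtains b where "ev b = (\<lambda>z. u z * ev a z)" "norm b \<le> C * norm a"
proof (rule h2_of_holomorphic[of "\<lambda>z. u z * ev a z" "C * norm a"])
  have C: "C \<ge> 0" by (rule bdd_hol_nonneg[OF assms])
  then show "0 \<le> C * norm a" by simp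
  show hol: "(\<lambda>z. u z * ev a z) holomorphic_on ball 0 1"
    using assms ev_holomorphic by (auto simp: bdd_hol_def intro!: holomorphic_intros)
  fix r :: real assume r: "0 \<le> r" "r < 1"
  have "(\<Sum>i\<in>{()}. 1 * circle_msq r (\<lambda>z. u z * ev a z)) \<le> (\<Sum>i\<in>{()}. C\<^sup>2 * circle_msq r (ev a))"
  proof (rule circle_msq_mono[OF hol ev_holomorphic r])
    fix z assume "cmod z = r"
    then have "cmod (u z * ev a z) \<le> C * cmod (ev a z)"
      using assms r by (auto simp: bdd_hol_def norm_mult intro!: mult_right_mono)
    then have "(cmod (u z * ev a z))\<^sup>2 \<le> (C * cmod (ev a z))\<^sup>2" by (rule power_mono) simp
    then show "(\<Sum>i\<in>{()}. 1 * (cmod (u z * ev a z))\<^sup>2) \<le> (\<Sum>i\<in>{()}. C\<^sup>2 * (cmod (ev a z))\<^sup>2)"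
      by (simp add: power_mult_distrib)
  qed
  also have "\<dots> \<le> (C * norm a)\<^sup>2"
    using mult_left_mono[OF circle_msq_ev_le[OF r, of a], of "C\<^sup>2"] by (simp add: power_mult_distrib)
  finally show "circle_msq r (\<lambda>z. u z * ev a z) \<le> (C * norm a)\<^sup>2" by simp
qed (use that in auto)

lemma ev_mul_fun: "bdd_hol u C \<Longrightarrow> ev (mul u a) = (\<lambda>z. u z * ev a z)"
  unfolding mul_def using mul_exists[of u C a] by (metis (mono_tags, lifting) someI)

lemma ev_mul: "bdd_hol u C \<Longrightarrow> ev (mul u a) z = u z * ev a z"
  by (simp add: ev_mul_fun)

lemma norm_mul_le: "bdd_hol u C \<Longrightarrow> norm (mul u a) \<le> C * norm a"
  using mul_exists[of u C a] ev_inject ev_mul_fun by metis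

lemma mul_add: "bdd_hol u C \<Longrightarrow> mul u (a + b) = mul u a + mul u b"
  by (intro ev_inject ext) (simp add: ev_mul distrib_left)

lemma mul_scale: "bdd_hol u C \<Longrightarrow> mul u (c *\<^sub>C a) = c *\<^sub>C mul u a"
  by (intro ev_inject ext) (simp add: ev_mul)

lemma mul_diff: "bdd_hol u C \<Longrightarrow> mul u (a - b) = mul u a - mul u b"
  by (intro ev_inject ext) (simp add: ev_mul right_diff_distrib)

text \<open>The upper bound is |u| <= 1. For the lower one, |u|^2 on the circle of radius r is at
  least 1 - C (1 - r^2), a factor that tends to 1 as the circle means tend to the norms.\<close>

lemma norm_mul_isometry:
  assumes u: "bdd_hol u 1" and low: "\<And>z. cmod z < 1 \<Longrightarrow> 1 - C * (1 - (cmod z)\<^sup>2) \<le> (cmod (u z))\<^sup>2"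
  shows "norm (mul u a) = norm a"
proof (rule antisym)
  show "norm (mul u a) \<le> norm a" using norm_mul_le[OF u, of a] by simp
  have "(norm a)\<^sup>2 \<le> (norm (mul u a))\<^sup>2"
  proof (rule tendsto_le)
    show "((\<lambda>r. circle_msq r (ev (mul u a))) \<longlongrightarrow> (norm (mul u a))\<^sup>2) (at_left 1)"
      by (rule circle_msq_tendsto)
    have "((\<lambda>r. (1 - C * (1 - r\<^sup>2)) * circle_msq r (ev a)) \<longlongrightarrow> (1 - C * (1 - 1\<^sup>2)) * (norm a)\<^sup>2) (at_left 1)"
      by (intro tendsto_intros circle_msq_tendsto)
    then show "((\<lambda>r. (1 - C * (1 - r\<^sup>2)) * circle_msq r (ev a)) \<longlongrightarrow> (norm a)\<^sup>2) (at_left 1)" by simp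
    show "\<forall>\<^sub>F r in at_left 1. (1 - C * (1 - r\<^sup>2)) * circle_msq r (ev a) \<le> circle_msq r (ev (mul u a))"
      using eventually_unit_interval
    proof eventually_elim
      case (elim r)
      then have r: "0 \<le> r" "r < 1" by auto
      have "(\<Sum>i\<in>{()}. (1 - C * (1 - r\<^sup>2)) * circle_msq r (ev a)) \<le> (\<Sum>i\<in>{()}. 1 * circle_msq r (ev (mul u a)))"
      proof (rule circle_msq_mono[OF ev_holomorphic ev_holomorphic r])
        fix z assume "cmod z = r"
        then show "(\<Sum>i\<in>{()}. (1 - C * (1 - r\<^sup>2)) * (cmod (ev a z))\<^sup>2) \<le> (\<Sum>i\<in>{()}. 1 * (cmod (ev (mul u a) z))\<^sup>2)"
          using low[of z] r by (auto simp: ev_mul[OF u] norm_mult power_mult_distrib intro!: mult_right_mono)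
      qed
      then show ?case by simp
    qed
  qed simp
  then show "norm a \<le> norm (mul u a)" by (rule power2_le_imp_le) simp
qed

section \<open>Bounded pointwise limits are weak-star limits\<close>

text \<open>The integral inside \<open>wpair\<close> at a fixed radius, without the division by 2
  pi.\<close>

definition radial :: "real \<Rightarrow> (complex \<Rightarrow> complex) \<Rightarrow> (real \<Rightarrow> complex) \<Rightarrow> complex" where
  "radial r f g = (LINT t:{0..2*pi}|lborel. f (of_real r * cis t) * g t)"

lemma bdd_hol_circle: "bdd_hol f C \<Longrightarrow> 0 \<le> r \<Longrightarrow> r < 1 \<Longrightarrow> cmod (f (of_real r * cis t)) \<le> C"
  by (simp add: bdd_hol_def norm_mult)

lemma radial_integrable:
  assumes f: "bdd_hol f C" and r: "0 \<le> r" "r < 1" and g: "set_integrable lborel {0..2*pi} g"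
  shows "set_integrable lborel {0..2*pi} (\<lambda>t. f (of_real r * cis t) * g t)"
  unfolding set_integrable_def
proof (rule Bochner_Integration.integrable_bound)
  have "(\<lambda>t. f (of_real r * cis t)) \<in> borel_measurable lborel"
    using continuous_on_circle[OF _ r, of f UNIV] f
    by (simp add: bdd_hol_def borel_measurable_continuous_onI)
  moreover have "(\<lambda>t. indicator {0..2*pi} t *\<^sub>R g t) \<in> borel_measurable lborel"
    using g unfolding set_integrable_def by (rule borel_measurable_integrable)
  ultimately have "(\<lambda>t. f (of_real r * cis t) * (indicator {0..2*pi} t *\<^sub>R g t)) \<in> borel_measurable lborel"
    by (rule borel_measurable_times)
  then show "(\<lambda>t. indicator {0..2*pi} t *\<^sub>R (f (of_real r * cis t) * g t)) \<in> borel_measurable lborel"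
    by (simp add: mult_scaleR_right)
  show "integrable lborel (\<lambda>t. C *\<^sub>R (indicator {0..2*pi} t *\<^sub>R g t))"
    using g unfolding set_integrable_def by (rule integrable_scaleR_right)
  have "cmod (f (of_real r * cis t)) * cmod (g t) \<le> C * cmod (g t)" for t
    by (intro mult_right_mono bdd_hol_circle[OF f r]) simp
  then show "AE t in lborel. norm (indicator {0..2*pi} t *\<^sub>R (f (of_real r * cis t) * g t))
      \<le> norm (C *\<^sub>R (indicator {0..2*pi} t *\<^sub>R g t))"
    using bdd_hol_nonneg[OF f] by (auto simp: norm_mult indicator_def)
qed

lemma radial_le:
  assumes f: "bdd_hol f C" and r: "0 \<le> r" "r < 1" and g: "set_integrable lborel {0..2*pi} g"
  shows "cmod (radial r f g) \<le> C * (LINT t:{0..2*pi}|lborel. cmod (g t))"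
proof -
  have "cmod (radial r f g) \<le> (LINT t:{0..2*pi}|lborel. cmod (f (of_real r * cis t) * g t))"
    unfolding radial_def by (rule set_integral_norm_bound[OF radial_integrable[OF assms]])
  also have "\<dots> \<le> (LINT t:{0..2*pi}|lborel. C * cmod (g t))"
    by (intro set_integral_mono set_integrable_norm radial_integrable[OF assms] set_integrable_mult_right)
       (use g bdd_hol_circle[OF f r] in \<open>auto simp: norm_mult intro!: set_integrable_norm mult_right_mono\<close>)
  finally show ?thesis by simp
qed

text \<open>\<open>(f z - f 0) / z\<close> is bounded by the Schwarz lemma, so its primitive \<open>Q\<close> is Lipschitz on the disc,
  and the integral over the arc is \<open>f 0 * b\<close> plus a difference of values of \<open>Q\<close>.\<close>

lemma interval_circle_integral_Lipschitz:
  assumes f: "bdd_hol f 1" and r: "0 \<le> r" "r < 1" and s: "0 \<le> s" "s < 1" and b: "0 \<le> b"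
  shows "cmod ((LINT t:{0..b}|lborel. f (of_real r * cis t)) - (LINT t:{0..b}|lborel. f (of_real s * cis t))) \<le> 6 * \<bar>r - s\<bar>"
proof -
  have hol: "f holomorphic_on ball 0 1" and le: "\<And>z. cmod z < 1 \<Longrightarrow> cmod (f z) \<le> 1"
    using f by (auto simp: bdd_hol_def)
  define q where "q z = (if z = 0 then deriv f 0 else (f z - f 0) / (z - 0))" for z
  have qhol: "q holomorphic_on ball 0 1"
    unfolding q_def by (rule pole_lemma_open[OF hol open_ball])
  have qw: "q w * w = f w - f 0" for w by (simp add: q_def)
  have q3: "cmod (q z) \<le> 3" if "cmod z < 1" for z
  proof -
    \<comment> \<open>The numerator is at most 2 in modulus; dividing by 3 gives the strict bound 1
      that the Schwarz lemma demands.\<close>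
    define h where "h z = (f z - f 0) / 3" for z
    have hh: "h holomorphic_on ball 0 1" unfolding h_def by (intro holomorphic_intros hol) simp
    have h1: "cmod (h w) < 1" if "cmod w < 1" for w
      using norm_triangle_ineq4[of "f w" "f 0"] le[OF that] le[of 0] by (simp add: h_def norm_divide)
    have h0: "h 0 = 0" by (simp add: h_def)
    have d: "deriv h 0 = deriv f 0 / 3"
    proof (rule DERIV_imp_deriv)
      have "(f has_field_derivative deriv f 0) (at 0)"
        by (rule holomorphic_derivI[OF hol open_ball]) simp
      then show "(h has_field_derivative deriv f 0 / 3) (at 0)"
        unfolding h_def by (auto intro!: derivative_eq_intros)
    qed
    show ?thesis
      using Schwarz_Lemma(1)[OF hh h0 h1 that] Schwarz_Lemma(2)[OF hh h0 h1 that]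
      unfolding d by (auto simp: q_def h_def norm_divide field_simps)
  qed
  obtain Q where Q: "\<And>z. z \<in> ball 0 1 \<Longrightarrow> (Q has_field_derivative q z) (at z within ball 0 1)"
    using holomorphic_convex_primitive'[OF convex_ball open_ball qhol] by blast
  have Q': "(Q has_field_derivative q z) (at z)" if "cmod z < 1" for z
    using Q[of z] that at_within_open[of z "ball 0 1"] by simp
  \<comment> \<open>Along w = r e^(it) the derivative of Q / i is q(w) w = f(w) - f(0), so f itself
    has the primitive f(0) t + Q / i. The two endpoints, with Lipschitz constant 3 each, account for
    the final 6.\<close>
  have FTC: "(LINT t:{0..b}|lborel. f (of_real r * cis t)) =
      (f 0 * of_real b + Q (of_real r * cis b) / \<i>) - (f 0 * of_real 0 + Q (of_real r * cis 0) / \<i>)"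
    if r: "0 \<le> r" "r < 1" for r
    unfolding set_lebesgue_integral_def
  proof (rule integral_FTC_atLeastAtMost[OF b])
    show "continuous_on {0..b} (\<lambda>t. f (of_real r * cis t))" by (rule continuous_on_circle[OF hol r])
    fix t :: real
    have rt: "cmod (of_real r * exp (\<i> * of_real t)) < 1" using r by (simp add: norm_mult)
    have 1: "((\<lambda>z. of_real r * exp (\<i> * z)) has_field_derivative of_real r * exp (\<i> * of_real t) * \<i>) (at (of_real t))"
      by (auto intro!: derivative_eq_intros)
    have 2: "((\<lambda>z. Q (of_real r * exp (\<i> * z))) has_field_derivative
        q (of_real r * exp (\<i> * of_real t)) * (of_real r * exp (\<i> * of_real t) * \<i>)) (at (of_real t))"
      by (rule DERIV_chain2[where f = Q and g = "\<lambda>z. of_real r * exp (\<i> * z)", OF Q'[OF rt] 1])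
    have "((\<lambda>z. f 0 * z + Q (of_real r * exp (\<i> * z)) / \<i>) has_field_derivative
        f 0 + q (of_real r * exp (\<i> * of_real t)) * (of_real r * exp (\<i> * of_real t) * \<i>) / \<i>) (at (of_real t))"
      by (intro DERIV_add DERIV_cmult_Id DERIV_cdivide 2)
    moreover have "f 0 + q w * (w * \<i>) / \<i> = f w" for w
    proof -
      have "q w * (w * \<i>) / \<i> = q w * w" by (simp only: times_divide_eq_right[symmetric]) simp
      then show ?thesis using qw[of w] by simp
    qed
    ultimately have "((\<lambda>z. f 0 * z + Q (of_real r * exp (\<i> * z)) / \<i>) has_field_derivative
        f (of_real r * exp (\<i> * of_real t))) (at (of_real t))"
      by (simp only:)
    from has_vector_derivative_real_field[OF this]
    show "((\<lambda>t. f 0 * of_real t + Q (of_real r * cis t) / \<i>) has_vector_derivative f (of_real r * cis t)) (at t within {0..b})"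
      by (simp add: cis_conv_exp)
  qed
  have lip: "cmod (Q (of_real r * cis t) - Q (of_real s * cis t)) \<le> 3 * \<bar>r - s\<bar>" for t
  proof -
    have "cmod (Q (of_real r * cis t) - Q (of_real s * cis t)) \<le> 3 * cmod (of_real r * cis t - of_real s * cis t)"
      by (rule field_differentiable_bound[OF convex_ball Q]) (use q3 r s in \<open>auto simp: norm_mult\<close>)
    also have "cmod (of_real r * cis t - of_real s * cis t) = \<bar>r - s\<bar>"
      by (simp only: left_diff_distrib[symmetric] norm_mult of_real_diff[symmetric] norm_of_real norm_cis) simp
    finally show ?thesis .
  qed
  have "(LINT t:{0..b}|lborel. f (of_real r * cis t)) - (LINT t:{0..b}|lborel. f (of_real s * cis t)) =
      (Q (of_real r * cis b) - Q (of_real s * cis b)) / \<i> - (Q (of_real r * cis 0) - Q (of_real s * cis 0)) / \<i>"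
    unfolding FTC[OF r] FTC[OF s] by (simp add: right_diff_distrib)
  also have "cmod \<dots> \<le> 3 * \<bar>r - s\<bar> + 3 * \<bar>r - s\<bar>"
    by (rule norm_triangle_le_diff) (use lip[of b] lip[of 0] in \<open>simp add: norm_divide norm_mult\<close>)
  finally show ?thesis by simp
qed

text \<open>Uniformity over the unit ball of \<open>H\<^sup>\<infinity>\<close> lets the limit \<open>r \<rightarrow> 1\<close> be exchanged with bounded
  pointwise limits of \<open>f\<close>.\<close>

definition radially_Cauchy :: "(real \<Rightarrow> complex) \<Rightarrow> bool" where
  "radially_Cauchy g \<longleftrightarrow> (\<forall>e>0. \<exists>p. 0 \<le> p \<and> p < 1 \<and> (\<forall>f r s. bdd_hol f 1 \<longrightarrow> r \<in> {p..<1} \<longrightarrow> s \<in> {p..<1} \<longrightarrow>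
     cmod (radial r f g - radial s f g) \<le> e))"

lemma radially_CauchyI:
  assumes "\<And>e. e > 0 \<Longrightarrow> \<exists>p. 0 \<le> p \<and> p < 1 \<and> (\<forall>f r s. bdd_hol f 1 \<longrightarrow> r \<in> {p..<1} \<longrightarrow> s \<in> {p..<1} \<longrightarrow>
     cmod (radial r f g - radial s f g) \<le> e)"
  shows "radially_Cauchy g"
  unfolding radially_Cauchy_def by (intro allI impI assms)

lemma radially_CauchyD:
  "radially_Cauchy g \<Longrightarrow> e > 0 \<Longrightarrow> \<exists>p. 0 \<le> p \<and> p < 1 \<and> (\<forall>f r s. bdd_hol f 1 \<longrightarrow> r \<in> {p..<1} \<longrightarrow> s \<in> {p..<1} \<longrightarrow>
     cmod (radial r f g - radial s f g) \<le> e)"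
  unfolding radially_Cauchy_def by (drule spec[of _ e]) simp

lemma radially_Cauchy_indicator_atMost: "radially_Cauchy (indicator {..x})"
proof (rule radially_CauchyI)
  fix e :: real assume "e > 0"
  \<comment> \<open>The Lipschitz constant 6 turns radii within e / 6 of each other into an error of
    at most e.\<close>
  define p where "p = max 0 (1 - e / 6)"
  have p: "0 \<le> p" "p < 1" using \<open>e > 0\<close> by (auto simp: p_def)
  have "cmod (radial r f (indicator {..x}) - radial s f (indicator {..x})) \<le> e"
    if f: "bdd_hol f 1" and r: "r \<in> {p..<1}" and s: "s \<in> {p..<1}" for f r s
  proof (cases "x \<ge> 0")
    case True
    have eq: "radial r f (indicator {..x}) = (LINT t:{0..min x (2*pi)}|lborel. f (of_real r * cis t))" for r
      unfolding radial_def set_lebesgue_integral_def by (intro Bochner_Integration.integral_cong) (auto simp: indicator_def)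
    have "cmod (radial r f (indicator {..x}) - radial s f (indicator {..x})) \<le> 6 * \<bar>r - s\<bar>"
      unfolding eq using True p r s by (intro interval_circle_integral_Lipschitz[OF f]) auto
    also have "\<dots> \<le> e" using r s by (auto simp: p_def abs_if split: if_splits)
    finally show ?thesis .
  next
    case False
    then have "radial r f (indicator {..x}) = 0" for r
      unfolding radial_def set_lebesgue_integral_def
      by (intro integral_eq_zero_AE) (auto simp: indicator_def)
    then show ?thesis using \<open>e > 0\<close> by simp
  qed
  with p show "\<exists>p. 0 \<le> p \<and> p < 1 \<and> (\<forall>f r s. bdd_hol f 1 \<longrightarrow> r \<in> {p..<1} \<longrightarrow> s \<in> {p..<1} \<longrightarrow>
     cmod (radial r f (indicator {..x}) - radial s f (indicator {..x})) \<le> e)" by blast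
qed

section \<open>From half-lines to all integrable functions\<close>

lemma radial_add:
  assumes "bdd_hol f C" "0 \<le> r" "r < 1"
    "set_integrable lborel {0..2*pi} g" "set_integrable lborel {0..2*pi} h"
  shows "radial r f (\<lambda>t. g t + h t) = radial r f g + radial r f h"
  unfolding radial_def distrib_left
  by (intro set_integral_add radial_integrable[OF assms(1-3)] assms)

lemma radial_scale: "radial r f (\<lambda>t. c * g t) = c * radial r f g"
  unfolding radial_def by (simp add: mult.left_commute)

lemma radial_diff:
  assumes "bdd_hol f C" "0 \<le> r" "r < 1"
    "set_integrable lborel {0..2*pi} g" "set_integrable lborel {0..2*pi} h"
  shows "radial r f (\<lambda>t. g t - h t) = radial r f g - radial r f h"
  unfolding radial_def right_diff_distrib
  by (intro set_integral_diff radial_integrable[OF assms(1-3)] assms)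

lemma radially_Cauchy_scale:
  assumes "radially_Cauchy g" shows "radially_Cauchy (\<lambda>t. c * g t)"
proof (rule radially_CauchyI)
  fix e :: real assume "e > 0"
  then have "e / (cmod c + 1) > 0" by (intro divide_pos_pos) (auto simp: add_nonneg_pos)
  then obtain p where p: "0 \<le> p" "p < 1" and
    le: "\<And>f r s. bdd_hol f 1 \<Longrightarrow> r \<in> {p..<1} \<Longrightarrow> s \<in> {p..<1} \<Longrightarrow> cmod (radial r f g - radial s f g) \<le> e / (cmod c + 1)"
    using radially_CauchyD[OF assms] by meson
  have "cmod (radial r f (\<lambda>t. c * g t) - radial s f (\<lambda>t. c * g t)) \<le> e"
    if "bdd_hol f 1" "r \<in> {p..<1}" "s \<in> {p..<1}" for f r s
  proof -
    have "cmod (radial r f (\<lambda>t. c * g t) - radial s f (\<lambda>t. c * g t)) = cmod c * cmod (radial r f g - radial s f g)"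
      unfolding radial_scale right_diff_distrib[symmetric] norm_mult ..
    also have "\<dots> \<le> (cmod c + 1) * (e / (cmod c + 1))"
      by (rule mult_mono) (use le[OF that] in auto)
    also have "\<dots> = e" by (simp add: add_nonneg_eq_0_iff)
    finally show ?thesis .
  qed
  with p show "\<exists>p. 0 \<le> p \<and> p < 1 \<and> (\<forall>f r s. bdd_hol f 1 \<longrightarrow> r \<in> {p..<1} \<longrightarrow> s \<in> {p..<1} \<longrightarrow>
     cmod (radial r f (\<lambda>t. c * g t) - radial s f (\<lambda>t. c * g t)) \<le> e)" by blast
qed

lemma radially_Cauchy_add:
  assumes "radially_Cauchy g" "radially_Cauchy h"
    "set_integrable lborel {0..2*pi} g" "set_integrable lborel {0..2*pi} h"
  shows "radially_Cauchy (\<lambda>t. g t + h t)"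
proof (rule radially_CauchyI)
  fix e :: real assume "e > 0"
  then have "e / 2 > 0" by simp
  obtain p where p: "0 \<le> p" "p < 1" and
    le: "\<And>f r s. bdd_hol f 1 \<Longrightarrow> r \<in> {p..<1} \<Longrightarrow> s \<in> {p..<1} \<Longrightarrow> cmod (radial r f g - radial s f g) \<le> e / 2"
    using radially_CauchyD[OF assms(1) \<open>e / 2 > 0\<close>] by meson
  obtain p' where p': "0 \<le> p'" "p' < 1" and
    le': "\<And>f r s. bdd_hol f 1 \<Longrightarrow> r \<in> {p'..<1} \<Longrightarrow> s \<in> {p'..<1} \<Longrightarrow> cmod (radial r f h - radial s f h) \<le> e / 2"
    using radially_CauchyD[OF assms(2) \<open>e / 2 > 0\<close>] by meson
  have "cmod (radial r f (\<lambda>t. g t + h t) - radial s f (\<lambda>t. g t + h t)) \<le> e"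
    if f: "bdd_hol f 1" and rs: "r \<in> {max p p'..<1}" "s \<in> {max p p'..<1}" for f r s
  proof -
    have "radial r f (\<lambda>t. g t + h t) - radial s f (\<lambda>t. g t + h t) =
        (radial r f g - radial s f g) + (radial r f h - radial s f h)"
      using rs p by (simp add: radial_add[OF f _ _ assms(3,4)])
    also have "cmod \<dots> \<le> e / 2 + e / 2"
      by (intro norm_triangle_mono le le' f) (use rs in auto)
    finally show ?thesis by simp
  qed
  with p p' show "\<exists>p. 0 \<le> p \<and> p < 1 \<and> (\<forall>f r s. bdd_hol f 1 \<longrightarrow> r \<in> {p..<1} \<longrightarrow> s \<in> {p..<1} \<longrightarrow>
     cmod (radial r f (\<lambda>t. g t + h t) - radial s f (\<lambda>t. g t + h t)) \<le> e)"
    by (intro exI[of _ "max p p'"]) auto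
qed

text \<open>Dominated convergence makes some \<open>s n\<close> close to g in L^1. Since |f| <= 1,
  replacing g by \<open>s n\<close> then costs at most e / 3 at every radius, uniformly in
  f.\<close>

lemma radially_Cauchy_dominated_limit:
  assumes s: "\<And>n. radially_Cauchy (s n)" "\<And>n. set_integrable lborel {0..2*pi} (s n)"
    and g: "set_integrable lborel {0..2*pi} g"
    and w: "set_integrable lborel {0..2*pi} (w :: real \<Rightarrow> real)"
    and lim: "\<And>t. (\<lambda>n. s n t) \<longlonglongrightarrow> g t" and le: "\<And>n t. cmod (s n t) \<le> w t"
  shows "radially_Cauchy g"
proof (rule radially_CauchyI)
  fix e :: real assume "e > 0"
  have int: "set_integrable lborel {0..2*pi} (\<lambda>t. s n t - g t)" for n
    by (intro set_integral_diff s g)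
  have "(\<lambda>n. LINT t:{0..2*pi}|lborel. cmod (s n t - g t)) \<longlonglongrightarrow> (LINT t:{0..2*pi}|lborel. (0::real))"
    unfolding set_lebesgue_integral_def
  proof (rule integral_dominated_convergence)
    show "integrable lborel (\<lambda>t. indicator {0..2*pi} t *\<^sub>R (w t + cmod (g t)))"
      using set_integral_add(1)[OF w set_integrable_norm[OF g]] by (simp add: set_integrable_def)
    show "(\<lambda>t. indicator {0..2*pi} t *\<^sub>R cmod (s n t - g t)) \<in> borel_measurable lborel" for n
      using set_integrable_norm[OF int[of n]] unfolding set_integrable_def by (rule borel_measurable_integrable)
    show "AE t in lborel. norm (indicator {0..2*pi} t *\<^sub>R cmod (s n t - g t)) \<le> indicator {0..2*pi} t *\<^sub>R (w t + cmod (g t))" for n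
    proof (rule AE_I2)
      fix t
      have "cmod (s n t - g t) \<le> w t + cmod (g t)"
        using norm_triangle_ineq4[of "s n t" "g t"] le[of n t] by linarith
      then show "norm (indicator {0..2*pi} t *\<^sub>R cmod (s n t - g t)) \<le> indicator {0..2*pi} t *\<^sub>R (w t + cmod (g t))"
        by (auto simp: indicator_def)
    qed
    show "AE t in lborel. (\<lambda>n. indicator {0..2*pi} t *\<^sub>R cmod (s n t - g t)) \<longlonglongrightarrow> indicator {0..2*pi} t *\<^sub>R 0"
    proof (rule AE_I2)
      fix t
      have "(\<lambda>n. indicator {0..2*pi} t *\<^sub>R cmod (s n t - g t)) \<longlonglongrightarrow> indicator {0..2*pi} t *\<^sub>R cmod (g t - g t)"
        by (intro tendsto_intros lim)
      then show "(\<lambda>n. indicator {0..2*pi} t *\<^sub>R cmod (s n t - g t)) \<longlonglongrightarrow> indicator {0..2*pi} t *\<^sub>R 0" by simp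
    qed
  qed simp
  then have "\<forall>\<^sub>F n in sequentially. (LINT t:{0..2*pi}|lborel. cmod (s n t - g t)) < e / 3"
    by (rule order_tendstoD) (use \<open>e > 0\<close> in simp)
  then obtain n where n: "(LINT t:{0..2*pi}|lborel. cmod (s n t - g t)) < e / 3"
    by (auto simp: eventually_sequentially)
  have "e / 3 > 0" using \<open>e > 0\<close> by simp
  then obtain p where p: "0 \<le> p" "p < 1" and
    c: "\<And>f r q. bdd_hol f 1 \<Longrightarrow> r \<in> {p..<1} \<Longrightarrow> q \<in> {p..<1} \<Longrightarrow> cmod (radial r f (s n) - radial q f (s n)) \<le> e / 3"
    using radially_CauchyD[OF s(1)[of n]] by meson
  have "cmod (radial r f g - radial q f g) \<le> e"
    if f: "bdd_hol f 1" and rq: "r \<in> {p..<1}" "q \<in> {p..<1}" for f r q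
  proof -
    have *: "cmod (radial r f (s n) - radial r f g) \<le> e / 3" if "r \<in> {p..<1}" for r
    proof -
      have r: "0 \<le> r" "r < 1" using that p by auto
      show ?thesis
        using radial_le[OF f r int[of n]] n radial_diff[OF f r s(2)[of n] g] by simp
    qed
    show ?thesis
      using c[OF f rq] *[OF rq(1)] *[OF rq(2)]
        norm_triangle_ineq[of "radial r f (s n) - radial q f (s n)" "radial q f (s n) - radial q f g"]
        norm_triangle_ineq4[of "radial r f (s n) - radial q f g" "radial r f (s n) - radial r f g"]
      by simp
  qed
  with p show "\<exists>p. 0 \<le> p \<and> p < 1 \<and> (\<forall>f r s. bdd_hol f 1 \<longrightarrow> r \<in> {p..<1} \<longrightarrow> s \<in> {p..<1} \<longrightarrow>
     cmod (radial r f g - radial s f g) \<le> e)" by blast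
qed

lemma set_integrable_indicator_circle:
  "A \<in> sets borel \<Longrightarrow> set_integrable lborel {0..2*pi} (indicator A :: real \<Rightarrow> complex)"
  unfolding set_integrable_def
  by (rule Bochner_Integration.integrable_bound[of _ "indicator {0..2*pi} :: real \<Rightarrow> real"])
     (auto simp: indicator_def intro!: integrable_real_indicator)

text \<open>Dynkin's argument: half-lines are intersection-stable and generate the Borel sets, and
  the property survives complements and disjoint countable unions.\<close>

lemma radially_Cauchy_indicator:
  assumes "A \<in> sets borel" shows "radially_Cauchy (indicator A)"
proof -
  have A: "A \<in> sigma_sets UNIV (range (\<lambda>a::real. {..a}))"
    using assms unfolding borel_eq_atMost by simp
  have borel: "A \<in> sets borel" if "A \<in> sigma_sets UNIV (range (\<lambda>a::real. {..a}))" for A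
    using that unfolding borel_eq_atMost by simp
  have stable: "Int_stable (range (\<lambda>a::real. {..a}))"
    by (auto simp: Int_stable_def)
  \<comment> \<open>On the integration interval the constant 1 coincides with a half-line
    indicator.\<close>
  have one: "radially_Cauchy (\<lambda>_. 1)"
  proof -
    have "radial r f (\<lambda>_. 1) = radial r f (indicator {..2*pi})" for r f
      unfolding radial_def set_lebesgue_integral_def by (intro Bochner_Integration.integral_cong) (auto simp: indicator_def)
    then show ?thesis using radially_Cauchy_indicator_atMost[of "2*pi"] by (simp add: radially_Cauchy_def)
  qed
  have int1: "set_integrable lborel {0..2*pi} (\<lambda>_. 1 :: complex)"
    using set_integrable_indicator_circle[of UNIV] by (simp add: indicator_def)
  have "range (\<lambda>a::real. {..a}) \<subseteq> Pow UNIV" by simp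
  from stable this A show ?thesis
  proof (induction rule: sigma_sets_induct_disjoint)
    case (basic A)
    then show ?case using radially_Cauchy_indicator_atMost by auto
  next
    case empty
    have "radially_Cauchy (\<lambda>t. 0 * 1)" by (rule radially_Cauchy_scale[OF one])
    then show ?case by (simp add: indicator_def)
  next
    case (compl A)
    have "radially_Cauchy (\<lambda>t. 1 + (-1) * indicator A t)"
      using compl borel by (intro radially_Cauchy_add radially_Cauchy_scale one int1 set_integrable_mult_right
          set_integrable_indicator_circle) auto
    moreover have "(indicator (UNIV - A) :: real \<Rightarrow> complex) = (\<lambda>t. 1 + (-1) * indicator A t)"
      by (auto simp: indicator_def)
    ultimately show ?case by simp
  next
    case (union A)
    have Ab: "A i \<in> sets borel" for i using union(2) borel by auto
    have fin: "radially_Cauchy (indicator (\<Union>i<n. A i))" for n :: nat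
    proof (induction n)
      case 0
      have "radially_Cauchy (\<lambda>t. 0 * 1)" by (rule radially_Cauchy_scale[OF one])
      then show ?case by (simp add: indicator_def)
    next
      case (Suc n)
      have "A n \<inter> A i = {}" if "i < n" for i
        using disjoint_family_onD[OF union(1), of n i] that by simp
      then have "A n \<inter> (\<Union>i<n. A i) = {}" by blast
      then have "(indicator (\<Union>i<Suc n. A i) :: real \<Rightarrow> complex) = (\<lambda>t. indicator (A n) t + indicator (\<Union>i<n. A i) t)"
        by (auto simp: indicator_def lessThan_Suc fun_eq_iff)
      then show ?case
        using Suc union(3)[of n] Ab by (auto intro!: radially_Cauchy_add set_integrable_indicator_circle sets.finite_UN)
    qed
    show ?case
    proof (rule radially_Cauchy_dominated_limit[OF fin, where w = "\<lambda>_. 1"])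
      show "(\<lambda>n. indicator (\<Union>i<n. A i) t :: complex) \<longlonglongrightarrow> indicator (\<Union>i. A i) t" for t
        by (rule LIMSEQ_indicator_UN)
      show "set_integrable lborel {0..2*pi} (\<lambda>_. 1 :: real)"
        unfolding set_integrable_def by simp
      show "cmod (indicator (\<Union>i<n. A i) t) \<le> 1" for n t by (simp add: indicator_def)
      show "set_integrable lborel {0..2*pi} (indicator (\<Union>i<n. A i) :: real \<Rightarrow> complex)" for n
        using Ab by (intro set_integrable_indicator_circle sets.finite_UN) auto
      show "set_integrable lborel {0..2*pi} (indicator (\<Union>i. A i) :: real \<Rightarrow> complex)"
        using Ab by (intro set_integrable_indicator_circle sets.countable_UN) auto
    qed
  qed
qed

lemma integrable_imp_set_integrable:
  assumes "integrable lborel (g :: real \<Rightarrow> 'b :: {banach, second_countable_topology})"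
  shows "set_integrable lborel {0..2*pi} g"
  unfolding set_integrable_def by (rule integrable_mult_indicator[OF _ assms]) simp

lemma radially_Cauchy_L1:
  assumes "g \<in> L1_circle" shows "radially_Cauchy g"
proof -
  have *: "radially_Cauchy g" if "integrable lborel g" for g
    using that
  proof (induction rule: integrable_induct)
    case (base A c)
    have "radially_Cauchy (\<lambda>t. c * indicator A t)"
      using base by (intro radially_Cauchy_scale radially_Cauchy_indicator) simp
    moreover have "(\<lambda>t. indicator A t *\<^sub>R c) = (\<lambda>t. c * indicator A t)"
      by (auto simp: indicator_def)
    ultimately show ?case by simp
  next
    case (add f g)
    then show ?case by (intro radially_Cauchy_add integrable_imp_set_integrable)
  next
    case (lim f s)
    show ?case
    proof (rule radially_Cauchy_dominated_limit[where s = s and w = "\<lambda>t. 2 * norm (f t)"])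
      show "set_integrable lborel {0..2*pi} (\<lambda>t. 2 * norm (f t))"
        using lim by (intro integrable_imp_set_integrable) simp
    qed (use lim in \<open>auto intro!: integrable_imp_set_integrable\<close>)
  qed
  \<comment> \<open>The induction is over functions integrable on the whole line, so g is cut off
    first; \<open>radial\<close> does not see the difference.\<close>
  have "integrable lborel (\<lambda>t. indicator {0..2*pi} t *\<^sub>R g t)"
    using assms by (simp add: L1_circle_def set_integrable_def)
  from *[OF this] have "radially_Cauchy (\<lambda>t. indicator {0..2*pi} t *\<^sub>R g t)" .
  moreover have "radial r f (\<lambda>t. indicator {0..2*pi} t *\<^sub>R g t) = radial r f g" for r f
    unfolding radial_def set_lebesgue_integral_def by (intro Bochner_Integration.integral_cong) (auto simp: indicator_def)
  ultimately show ?thesis by (simp add: radially_Cauchy_def)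
qed

text \<open>Two gains: the limit that defines \<open>wpair\<close> exists, which \<open>Lim\<close>
  by itself does not provide, and p does not depend on f. The bound C is scaled to 1; a sequence of
  radii produces the limit by completeness, and s -> 1 in the Cauchy estimate keeps the error
  e.\<close>

lemma wpair_uniform_limit:
  assumes g: "g \<in> L1_circle" and "e > 0" "C > 0"
  obtains p where "0 \<le> p" "p < 1"
    "\<And>f r. bdd_hol f C \<Longrightarrow> r \<in> {p..<1} \<Longrightarrow> cmod (radial r f g / (2 * pi) - wpair f g) \<le> e"
proof -
  have cau: "\<exists>p. 0 \<le> p \<and> p < 1 \<and> (\<forall>f r s. bdd_hol f C \<longrightarrow> r \<in> {p..<1} \<longrightarrow> s \<in> {p..<1} \<longrightarrow>
      cmod (radial r f g / (2 * pi) - radial s f g / (2 * pi)) \<le> e)" if "e > 0" for e :: real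
  proof -
    have "e * (2 * pi) / C > 0" using that \<open>C > 0\<close> by simp
    then obtain p where p: "0 \<le> p" "p < 1" and
      le: "\<And>f r s. bdd_hol f 1 \<Longrightarrow> r \<in> {p..<1} \<Longrightarrow> s \<in> {p..<1} \<Longrightarrow> cmod (radial r f g - radial s f g) \<le> e * (2 * pi) / C"
      using radially_CauchyD[OF radially_Cauchy_L1[OF g]] by meson
    have "cmod (radial r f g / (2 * pi) - radial s f g / (2 * pi)) \<le> e"
      if f: "bdd_hol f C" and rs: "r \<in> {p..<1}" "s \<in> {p..<1}" for f r s
    proof -
      have f': "bdd_hol (\<lambda>z. f z / C) 1"
        using f \<open>C > 0\<close> by (auto simp: bdd_hol_def norm_divide intro!: holomorphic_intros)
      have sc: "radial r (\<lambda>z. f z / C) g = radial r f g / C" for r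
        unfolding radial_def by simp
      have "cmod (radial r f g - radial s f g) / C \<le> e * (2 * pi) / C"
        using le[OF f' rs] \<open>C > 0\<close> unfolding sc diff_divide_distrib[symmetric] by (simp add: norm_divide)
      then have "cmod (radial r f g - radial s f g) \<le> e * (2 * pi)"
        using \<open>C > 0\<close> by (simp add: divide_le_cancel)
      then show ?thesis
        unfolding diff_divide_distrib[symmetric] by (simp add: norm_divide norm_mult field_simps)
    qed
    with p show ?thesis by blast
  qed
  have conv: "((\<lambda>r. radial r f g / (2 * pi)) \<longlongrightarrow> wpair f g) (at_left 1)" if f: "bdd_hol f C" for f
  proof -
    define \<phi> where "\<phi> r = radial r f g / (2 * pi)" for r
    define \<rho> where "\<rho> n = 1 - 1 / real (Suc n)" for n
    have \<rho>1: "\<rho> n < 1" for n by (simp add: \<rho>_def)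
    have \<rho>lim: "\<rho> \<longlonglongrightarrow> 1"
      using tendsto_diff[OF tendsto_const LIMSEQ_inverse_real_of_nat, of 1] by (simp add: \<rho>_def[abs_def] inverse_eq_divide)
    have near: "\<exists>N. \<forall>n\<ge>N. \<rho> n \<in> {p..<1}" if "p < 1" for p
    proof -
      have "\<forall>\<^sub>F n in sequentially. p < \<rho> n" by (rule order_tendstoD(1)[OF \<rho>lim that])
      then show ?thesis using \<rho>1 by (auto simp: eventually_sequentially intro: less_imp_le)
    qed
    have "Cauchy (\<lambda>n. \<phi> (\<rho> n))"
    proof (rule metric_CauchyI)
      fix e :: real assume "e > 0"
      then obtain p where p: "p < 1" and le: "\<And>r s. r \<in> {p..<1} \<Longrightarrow> s \<in> {p..<1} \<Longrightarrow> cmod (\<phi> r - \<phi> s) \<le> e / 2"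
        using cau[of "e / 2"] f unfolding \<phi>_def by auto
      obtain N where "\<forall>n\<ge>N. \<rho> n \<in> {p..<1}" using near[OF p] by blast
      then show "\<exists>N. \<forall>m\<ge>N. \<forall>n\<ge>N. dist (\<phi> (\<rho> m)) (\<phi> (\<rho> n)) < e"
        using le \<open>e > 0\<close> by (intro exI[of _ N]) (fastforce simp: dist_norm)
    qed
    then obtain L where L: "(\<lambda>n. \<phi> (\<rho> n)) \<longlonglongrightarrow> L" using Cauchy_convergent convergent_def by blast
    have "(\<phi> \<longlongrightarrow> L) (at_left 1)"
    proof (rule tendstoI)
      fix e :: real assume "e > 0"
      then obtain p where p: "0 \<le> p" "p < 1" and le: "\<And>r s. r \<in> {p..<1} \<Longrightarrow> s \<in> {p..<1} \<Longrightarrow> cmod (\<phi> r - \<phi> s) \<le> e / 2"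
        using cau[of "e / 2"] f unfolding \<phi>_def by auto
      obtain N where N: "\<forall>n\<ge>N. \<rho> n \<in> {p..<1}" using near[OF p(2)] by blast
      have "\<forall>\<^sub>F r in at_left 1. r \<in> {p<..<1}"
        using p(2) by (intro eventually_at_leftI[of p]) auto
      then show "\<forall>\<^sub>F r in at_left 1. dist (\<phi> r) L < e"
      proof eventually_elim
        case (elim r)
        have "cmod (\<phi> r - L) \<le> e / 2"
        proof (rule tendsto_upperbound)
          show "(\<lambda>n. cmod (\<phi> r - \<phi> (\<rho> n))) \<longlonglongrightarrow> cmod (\<phi> r - L)" by (intro tendsto_intros L)
          show "\<forall>\<^sub>F n in sequentially. cmod (\<phi> r - \<phi> (\<rho> n)) \<le> e / 2"
            using N le elim by (auto simp: eventually_sequentially intro!: exI[of _ N])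
        qed simp
        then show ?case using \<open>e > 0\<close> by (simp add: dist_norm)
      qed
    qed
    moreover from this have "wpair f g = L"
      unfolding wpair_def \<phi>_def radial_def by (intro tendsto_Lim) auto
    ultimately show ?thesis by (simp add: \<phi>_def[abs_def])
  qed
  obtain p where p: "0 \<le> p" "p < 1" and le: "\<And>f r s. bdd_hol f C \<Longrightarrow> r \<in> {p..<1} \<Longrightarrow> s \<in> {p..<1} \<Longrightarrow>
      cmod (radial r f g / (2 * pi) - radial s f g / (2 * pi)) \<le> e"
    using cau[OF \<open>e > 0\<close>] by blast
  have "cmod (radial r f g / (2 * pi) - wpair f g) \<le> e" if f: "bdd_hol f C" and r: "r \<in> {p..<1}" for f r
  proof (rule tendsto_upperbound)
    show "((\<lambda>s. cmod (radial r f g / (2 * pi) - radial s f g / (2 * pi))) \<longlongrightarrow>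
        cmod (radial r f g / (2 * pi) - wpair f g)) (at_left 1)"
      by (intro tendsto_intros conv f)
    have "\<forall>\<^sub>F s in at_left 1. s \<in> {p<..<1}"
      using p(2) by (intro eventually_at_leftI[of p]) auto
    then show "\<forall>\<^sub>F s in at_left 1. cmod (radial r f g / (2 * pi) - radial s f g / (2 * pi)) \<le> e"
      by eventually_elim (use le[OF f r] in auto)
  qed simp
  with p that show ?thesis by blast
qed

text \<open>At one fixed radius p dominated convergence applies; by uniformity this p approximates
  the pairings of all \<open>fn n\<close> and of f at once.\<close>

lemma wpair_bounded_pointwise_limit:
  assumes g: "g \<in> L1_circle" and fn: "\<And>n. bdd_hol (fn n) C" and f: "bdd_hol f C"
    and lim: "\<And>z. cmod z < 1 \<Longrightarrow> (\<lambda>n. fn n z) \<longlonglongrightarrow> f z"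
  shows "(\<lambda>n. wpair (fn n) g) \<longlonglongrightarrow> wpair f g"
proof (rule tendstoI)
  fix e :: real assume "e > 0"
  \<comment> \<open>C may be 0, whereas the uniform estimate needs a positive bound.\<close>
  define D where "D = C + 1"
  have D: "D > 0" using bdd_hol_nonneg[OF f] by (simp add: D_def)
  have bD: "bdd_hol h D" if "bdd_hol h C" for h by (rule bdd_hol_mono[OF that]) (simp add: D_def)
  have "e / 4 > 0" using \<open>e > 0\<close> by simp
  then obtain p where p: "0 \<le> p" "p < 1" and
    le: "\<And>f r. bdd_hol f D \<Longrightarrow> r \<in> {p..<1} \<Longrightarrow> cmod (radial r f g / (2 * pi) - wpair f g) \<le> e / 4"
    using wpair_uniform_limit[OF g _ D] by metis
  have gi: "set_integrable lborel {0..2*pi} g" using g by (simp add: L1_circle_def)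
  have "(\<lambda>n. radial p (fn n) g) \<longlonglongrightarrow> radial p f g"
    unfolding radial_def set_lebesgue_integral_def
  proof (rule integral_dominated_convergence)
    show "integrable lborel (\<lambda>t. C * (indicator {0..2*pi} t *\<^sub>R cmod (g t)))"
      using set_integrable_norm[OF gi] by (simp add: set_integrable_def)
    show "(\<lambda>t. indicator {0..2*pi} t *\<^sub>R (f (of_real p * cis t) * g t)) \<in> borel_measurable lborel"
      using radial_integrable[OF f p gi] unfolding set_integrable_def by (rule borel_measurable_integrable)
    show "(\<lambda>t. indicator {0..2*pi} t *\<^sub>R (fn n (of_real p * cis t) * g t)) \<in> borel_measurable lborel" for n
      using radial_integrable[OF fn p gi] unfolding set_integrable_def by (rule borel_measurable_integrable)
    show "AE t in lborel. norm (indicator {0..2*pi} t *\<^sub>R (fn n (of_real p * cis t) * g t))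
        \<le> C * (indicator {0..2*pi} t *\<^sub>R cmod (g t))" for n
      using bdd_hol_circle[OF fn p] by (auto simp: indicator_def norm_mult intro!: mult_right_mono)
    show "AE t in lborel. (\<lambda>n. indicator {0..2*pi} t *\<^sub>R (fn n (of_real p * cis t) * g t)) \<longlonglongrightarrow>
        indicator {0..2*pi} t *\<^sub>R (f (of_real p * cis t) * g t)"
      using p by (intro AE_I2 tendsto_intros lim) (simp add: norm_mult)
  qed
  then have "(\<lambda>n. radial p (fn n) g / (2 * pi)) \<longlonglongrightarrow> radial p f g / (2 * pi)"
    by (intro tendsto_intros) auto
  then have "\<forall>\<^sub>F n in sequentially. dist (radial p (fn n) g / (2 * pi)) (radial p f g / (2 * pi)) < e / 4"
    using \<open>e / 4 > 0\<close> by (rule tendstoD)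
  then show "\<forall>\<^sub>F n in sequentially. dist (wpair (fn n) g) (wpair f g) < e"
  proof eventually_elim
    case (elim n)
    have "p \<in> {p..<1}" using p by simp
    then show ?case
      using elim le[OF bD[OF fn[of n]], of p] le[OF bD[OF f], of p] unfolding dist_norm
      using norm_triangle_ineq[of "radial p (fn n) g / (2 * pi) - radial p f g / (2 * pi)" "radial p f g / (2 * pi) - wpair f g"]
        norm_triangle_ineq4[of "radial p (fn n) g / (2 * pi) - wpair f g" "radial p (fn n) g / (2 * pi) - wpair (fn n) g"]
        \<open>e > 0\<close>
      by simp
  qed
qed

lemma HinfI: "bdd_hol f C \<Longrightarrow> (\<And>z. \<not> cmod z < 1 \<Longrightarrow> f z = 0) \<Longrightarrow> f \<in> Hinf"
  by (auto simp: Hinf_def bdd_hol_def intro!: boundedI[of _ C])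

lemma HinfE:
  assumes "f \<in> Hinf" obtains C where "bdd_hol f C" "\<And>z. \<not> cmod z < 1 \<Longrightarrow> f z = 0"
proof -
  from assms have "bounded (f ` ball 0 1)" by (simp add: Hinf_def)
  then obtain C where "\<forall>x\<in>f ` ball 0 1. cmod x \<le> C" by (auto simp: bounded_iff)
  then have "bdd_hol f C" using assms by (auto simp: Hinf_def bdd_hol_def)
  with assms that[of C] show ?thesis by (auto simp: Hinf_def)
qed

text \<open>The form in which weak-star closedness is used from here on: a late term of the sequence
  meets any finite set of test functions within e.\<close>

lemma weakstar_closed_limit:
  assumes M: "weakstar_closed M" and fn: "\<And>n. fn n \<in> M" "\<And>n. bdd_hol (fn n) C" and f: "f \<in> Hinf"
    and lim: "\<And>z. cmod z < 1 \<Longrightarrow> (\<lambda>n. fn n z) \<longlonglongrightarrow> f z"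
  shows "f \<in> M"
proof -
  have fC: "bdd_hol f C"
    unfolding bdd_hol_def
  proof safe
    show "f holomorphic_on ball 0 1" using f by (simp add: Hinf_def)
    fix z assume z: "cmod z < 1"
    show "cmod (f z) \<le> C"
    proof (rule tendsto_upperbound)
      show "(\<lambda>n. cmod (fn n z)) \<longlonglongrightarrow> cmod (f z)" by (intro tendsto_intros lim z)
    qed (use fn(2) z in \<open>auto simp: bdd_hol_def\<close>)
  qed
  have "\<exists>h\<in>M. \<forall>g\<in>G. cmod (wpair f g - wpair h g) < e" if "finite G" "G \<subseteq> L1_circle" "e > 0" for G e
  proof -
    have "\<forall>\<^sub>F n in sequentially. \<forall>g\<in>G. dist (wpair (fn n) g) (wpair f g) < e"
      using that by (intro eventually_ball_finite ballI tendstoD wpair_bounded_pointwise_limit[OF _ fn(2) fC lim]) auto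
    then obtain n where "\<forall>g\<in>G. dist (wpair (fn n) g) (wpair f g) < e"
      by (auto simp: eventually_sequentially)
    then show ?thesis using fn(1) by (auto simp: dist_norm norm_minus_commute intro!: bexI[of _ "fn n"])
  qed
  with M f show ?thesis unfolding weakstar_closed_def by blast
qed

section \<open>The shift by an inner symbol and its invariant subspaces\<close>

lemma norm_eq_1I: "cip a a = 1 \<Longrightarrow> norm a = 1"
proof (rule power2_eq_imp_eq)
  assume "cip a a = 1"
  then have "complex_of_real ((norm a)\<^sup>2) = of_real (1\<^sup>2)" by (simp only: cip_self) simp
  then show "(norm a)\<^sup>2 = 1\<^sup>2" by (simp only: of_real_eq_iff)
qed auto

lemma scaleC_diff_right: "c *\<^sub>C (a - b) = c *\<^sub>C a - c *\<^sub>C b"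
  by (rule h2_eqI) (simp add: right_diff_distrib)

lemma tendsto_scaleC [tendsto_intros]:
  assumes "(g \<longlongrightarrow> b) F" shows "((\<lambda>x. c *\<^sub>C g x) \<longlongrightarrow> c *\<^sub>C b) F"
proof -
  have "((\<lambda>x. cmod c * norm (g x - b)) \<longlongrightarrow> 0) F"
    by (intro tendsto_mult_right_zero tendsto_norm_zero LIM_zero assms)
  then have "((\<lambda>x. norm (c *\<^sub>C g x - c *\<^sub>C b)) \<longlongrightarrow> 0) F"
    by (simp only: scaleC_diff_right[symmetric] norm_scaleC)
  then show ?thesis by (rule LIM_zero_cancel[OF tendsto_norm_zero_cancel])
qed

lemma tendsto_cip [tendsto_intros]:
  assumes "(f \<longlongrightarrow> a) F" "(g \<longlongrightarrow> b) F"
  shows "((\<lambda>x. cip (f x) (g x)) \<longlongrightarrow> cip a b) F"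
  unfolding cip_eq_inner Complex_eq by (intro tendsto_intros assms)

lemma cip_eq_0I:
  assumes "\<And>s. s \<in> S \<Longrightarrow> inner x s = 0" "\<And>s. s \<in> S \<Longrightarrow> \<i> *\<^sub>C s \<in> S" "s \<in> S"
  shows "cip x s = 0"
  using assms by (simp add: cip_eq_inner complex_eq_iff)

definition csubspace :: "h2 set \<Rightarrow> bool" where
  "csubspace S \<longleftrightarrow> 0 \<in> S \<and> (\<forall>x\<in>S. \<forall>y\<in>S. x + y \<in> S) \<and> (\<forall>c. \<forall>x\<in>S. c *\<^sub>C x \<in> S)"

lemma scaleR_scaleC: "r *\<^sub>R a = of_real r *\<^sub>C a"
  by (rule h2_eqI) simp

lemma csubspace_imp_subspace: "csubspace S \<Longrightarrow> subspace S"
  by (auto simp: csubspace_def subspace_def scaleR_scaleC)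

lemma csubspace_diff: "csubspace S \<Longrightarrow> x \<in> S \<Longrightarrow> y \<in> S \<Longrightarrow> x - y \<in> S"
  using subspace_diff csubspace_imp_subspace by blast

lemma csubspace_sum: "csubspace S \<Longrightarrow> (\<And>i. i \<in> A \<Longrightarrow> f i \<in> S) \<Longrightarrow> sum f A \<in> S"
  using subspace_sum csubspace_imp_subspace by blast

lemma complex_orthogonal_projection:
  assumes "csubspace S" "closed S"
  obtains p where "p \<in> S" "\<And>s. s \<in> S \<Longrightarrow> cip (x - p) s = 0"
proof -
  obtain p where p: "p \<in> S" "\<And>s. s \<in> S \<Longrightarrow> inner (x - p) s = 0"
    using orthogonal_projection_exists[OF csubspace_imp_subspace[OF assms(1)] assms(2)] by blast
  have "cip (x - p) s = 0" if "s \<in> S" for s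
    by (rule cip_eq_0I[OF p(2) _ that]) (use assms(1) in \<open>auto simp: csubspace_def\<close>)
  with p(1) that show ?thesis by blast
qed

text \<open>What is retained of a finite Blaschke product. \<open>B_defect\<close> stands in for
  unimodular boundary values. \<open>B_0\<close> makes the constant 1 orthogonal to the range of
  multiplication by B. \<open>C_ge_1\<close> lets C absorb the additive constant in 1 +
  |h|^2.\<close>

locale inner_symbol =
  fixes B :: "complex \<Rightarrow> complex" and C :: real
  assumes B_hol: "B holomorphic_on ball 0 1"
    and B_lt_1: "\<And>z. cmod z < 1 \<Longrightarrow> cmod (B z) < 1"
    and B_defect: "\<And>z. cmod z < 1 \<Longrightarrow> 1 - (cmod (B z))\<^sup>2 \<le> C * (1 - (cmod z)\<^sup>2)"
    and B_0: "B 0 = 0"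
    and C_ge_1: "1 \<le> C"
begin

definition T :: "h2 \<Rightarrow> h2" where "T = mul B"

text \<open>The inverse of 1 - cnj w T, given by an explicit bounded multiplier, so that its point
  values are known.\<close>

definition R :: "complex \<Rightarrow> h2 \<Rightarrow> h2" where "R w = mul (\<lambda>z. 1 / (1 - cnj w * B z))"

lemma B_bdd: "bdd_hol B 1"
  using B_hol B_lt_1 by (auto simp: bdd_hol_def intro: less_imp_le)

lemma ev_T [simp]: "ev (T a) z = B z * ev a z"
  by (simp add: T_def ev_mul[OF B_bdd])

lemma T_add: "T (a + b) = T a + T b" and T_diff: "T (a - b) = T a - T b" and T_scale: "T (c *\<^sub>C a) = c *\<^sub>C T a"
  by (simp_all add: T_def mul_add[OF B_bdd] mul_diff[OF B_bdd] mul_scale[OF B_bdd])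

lemma T_zero [simp]: "T 0 = 0"
  by (rule ev_inject) (simp add: fun_eq_iff)

lemma norm_T [simp]: "norm (T a) = norm a"
  unfolding T_def by (rule norm_mul_isometry[OF B_bdd, of C]) (use B_defect in \<open>simp add: algebra_simps\<close>)

lemma cip_T: "cip (T a) (T b) = cip a b"
proof -
  have "inner (T x) (T y) = inner x y" for x y
    using dot_norm[of "T x" "T y"] dot_norm[of x y] by (simp flip: T_add)
  then show ?thesis by (simp add: cip_eq_inner flip: T_scale)
qed

lemma norm_T_pow [simp]: "norm ((T ^^ m) a) = norm a"
  by (induction m) auto

lemma cip_T_pow: "cip ((T ^^ m) a) ((T ^^ m) b) = cip a b"
  by (induction m) (auto simp: cip_T)

lemma ev_T_pow: "ev ((T ^^ m) a) z = B z ^ m * ev a z"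
  by (induction m) auto

lemma kernel_bdd:
  assumes "cmod w < 1" shows "bdd_hol (\<lambda>z. 1 / (1 - cnj w * B z)) (1 / (1 - cmod w))"
  unfolding bdd_hol_def
proof (intro conjI allI impI)
  have le: "1 - cmod w \<le> cmod (1 - cnj w * B z)" if "cmod z < 1" for z
  proof -
    have "cmod (cnj w * B z) \<le> cmod w * 1"
      unfolding norm_mult using B_lt_1[OF that] by (intro mult_mono) auto
    then show ?thesis using norm_triangle_ineq2[of 1 "cnj w * B z"] by simp
  qed
  have "1 - cnj w * B z \<noteq> 0" if "cmod z < 1" for z
    using le[OF that] assms by auto
  then show "(\<lambda>z. 1 / (1 - cnj w * B z)) holomorphic_on ball 0 1"
    by (intro holomorphic_intros B_hol) auto
  show "cmod (1 / (1 - cnj w * B z)) \<le> 1 / (1 - cmod w)" if "cmod z < 1" for z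
    using le[OF that] assms by (simp add: norm_divide frac_le)
qed

lemma ev_R: "cmod w < 1 \<Longrightarrow> ev (R w a) z = ev a z / (1 - cnj w * B z)"
  by (simp add: R_def ev_mul[OF kernel_bdd])

lemma norm_R_le: "cmod w < 1 \<Longrightarrow> norm (R w a) \<le> norm a / (1 - cmod w)"
  using norm_mul_le[OF kernel_bdd, of w a] by (simp add: R_def)

lemma kernel_nonzero: "cmod w < 1 \<Longrightarrow> cmod z < 1 \<Longrightarrow> 1 - cnj w * B z \<noteq> 0"
  by (rule one_minus_cnj_mult_nonzero(2)[OF _ B_lt_1])

lemma R_eq:
  assumes w: "cmod w < 1" shows "R w a = a + cnj w *\<^sub>C T (R w a)"
proof (rule ev_inject, rule ext)
  fix z
  show "ev (R w a) z = ev (a + cnj w *\<^sub>C T (R w a)) z"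
  proof (cases "cmod z < 1")
    case True
    then show ?thesis using kernel_nonzero[OF w True] by (simp add: ev_R[OF w] field_simps)
  qed simp
qed

text \<open>By \<open>R_eq\<close> both R w f - f and R w g - g are cnj w times an image under T. As
  T is isometric, their product is |w|^2 <R w f, R w g>; expanding it gives the identity.\<close>

lemma R_identity:
  assumes w: "cmod w < 1"
  shows "(1 - (cmod w)\<^sup>2) * cip (R w f) (R w g) = cip f (R w g) + cip (R w f) g - cip f g"
proof -
  have "R w f - f = cnj w *\<^sub>C T (R w f)" "R w g - g = cnj w *\<^sub>C T (R w g)"
    using R_eq[OF w, of f] R_eq[OF w, of g] by (metis add_diff_cancel_left')+
  then have "cip (R w f - f) (R w g - g) = (cnj w * w) * cip (R w f) (R w g)"
    by (simp add: cip_simps cip_T)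
  also have "cnj w * w = of_real ((cmod w)\<^sup>2)" by (simp only: complex_norm_square mult.commute)
  finally show ?thesis by (simp add: cip_simps algebra_simps)
qed

text \<open>Geometric series with the exact remainder cnj w^N T^N (R w a), whose norm is |w|^N times
  that of R w a.\<close>

lemma R_partial_sums:
  assumes w: "cmod w < 1"
  shows "(\<lambda>N. \<Sum>m<N. (cnj w ^ m) *\<^sub>C (T ^^ m) a) \<longlonglongrightarrow> R w a"
proof -
  have eq: "R w a - (\<Sum>m<N. (cnj w ^ m) *\<^sub>C (T ^^ m) a) = (cnj w ^ N) *\<^sub>C (T ^^ N) (R w a)" for N
  proof (rule ev_inject, rule ext)
    fix z
    show "ev (R w a - (\<Sum>m<N. (cnj w ^ m) *\<^sub>C (T ^^ m) a)) z = ev ((cnj w ^ N) *\<^sub>C (T ^^ N) (R w a)) z"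
    proof (cases "cmod z < 1")
      case True
      define x where "x = cnj w * B z"
      have x: "1 - x \<noteq> 0" using kernel_nonzero[OF w True] by (simp add: x_def)
      have "ev (\<Sum>m<N. (cnj w ^ m) *\<^sub>C (T ^^ m) a) z = (\<Sum>m<N. x ^ m) * ev a z"
        by (simp add: ev_sum ev_T_pow x_def power_mult_distrib mult.assoc sum_distrib_right)
      also have "(\<Sum>m<N. x ^ m) = (1 - x ^ N) / (1 - x)"
        using x by (simp add: sum_gp_strict)
      finally have "ev (R w a - (\<Sum>m<N. (cnj w ^ m) *\<^sub>C (T ^^ m) a)) z = ev a z / (1 - x) - (1 - x ^ N) / (1 - x) * ev a z"
        by (simp only: ev_diff ev_R[OF w] x_def)
      also have "\<dots> = x ^ N * (ev a z / (1 - x))" by (simp add: diff_divide_distrib left_diff_distrib)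
      also have "\<dots> = ev ((cnj w ^ N) *\<^sub>C (T ^^ N) (R w a)) z"
        by (simp add: ev_R[OF w] ev_T_pow x_def power_mult_distrib)
      finally show ?thesis .
    qed simp
  qed
  have "(\<lambda>N. cmod w ^ N * norm (R w a)) \<longlonglongrightarrow> 0"
    using w by (intro tendsto_mult_left_zero LIMSEQ_realpow_zero) auto
  moreover have "norm ((\<Sum>m<N. (cnj w ^ m) *\<^sub>C (T ^^ m) a) - R w a) = cmod w ^ N * norm (R w a)" for N
    using arg_cong[OF eq[of N], of norm] by (simp add: norm_scaleC norm_power norm_minus_commute)
  ultimately have "(\<lambda>N. norm ((\<Sum>m<N. (cnj w ^ m) *\<^sub>C (T ^^ m) a) - R w a)) \<longlonglongrightarrow> 0"
    by (simp only:)
  then show ?thesis by (rule LIM_zero_cancel[OF tendsto_norm_zero_cancel])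
qed

text \<open>The dependence of R w on cnj w is undone by the conjugate-linear second slot, so the
  product is a power series in w itself.\<close>

lemma cip_R_sums:
  assumes w: "cmod w < 1"
  shows "(\<lambda>m. cip f ((T ^^ m) g) * w ^ m) sums cip f (R w g)"
proof -
  have "(\<lambda>N. cip f (\<Sum>m<N. (cnj w ^ m) *\<^sub>C (T ^^ m) g)) \<longlonglongrightarrow> cip f (R w g)"
    by (intro tendsto_intros R_partial_sums w)
  moreover have "cip f (\<Sum>m<N. (cnj w ^ m) *\<^sub>C (T ^^ m) g) = (\<Sum>m<N. cip f ((T ^^ m) g) * w ^ m)" for N
    by (induction N) (simp_all add: cip_add_right cip_scale_right mult.commute)
  ultimately show ?thesis by (simp add: sums_def)
qed

lemma cip_R_holomorphic: "(\<lambda>w. cip f (R w g)) holomorphic_on ball 0 1"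
  using power_series_holomorphic[of 0 1 "\<lambda>m. cip f ((T ^^ m) g)" "\<lambda>w. cip f (R w g)"] cip_R_sums
  by simp

text \<open>For w = B z the multiplier of R w takes the value 1 / (1 - |w|^2) at z. So a(z) is 1 -
  |w|^2 times the value of R w a, to which the Szego bound applies.\<close>

lemma ev_le_R:
  assumes z: "cmod z < 1"
  shows "(cmod (ev a z))\<^sup>2 \<le> (1 - (cmod (B z))\<^sup>2)\<^sup>2 * (norm (R (B z) a))\<^sup>2 / (1 - (cmod z)\<^sup>2)"
proof -
  define w where "w = B z"
  have w: "cmod w < 1" using B_lt_1[OF z] by (simp add: w_def)
  have d: "1 - (cmod w)\<^sup>2 > 0" using w by (simp add: abs_square_less_1)
  have "cnj w * w = of_real ((cmod w)\<^sup>2)" by (simp only: complex_norm_square mult.commute)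
  then have "ev (R w a) z = ev a z / of_real (1 - (cmod w)\<^sup>2)"
    by (simp add: ev_R[OF w] w_def[symmetric])
  then have "ev a z = of_real (1 - (cmod w)\<^sup>2) * ev (R w a) z"
    using d by (simp del: of_real_diff of_real_power)
  then have "(cmod (ev a z))\<^sup>2 = (1 - (cmod w)\<^sup>2)\<^sup>2 * (cmod (ev (R w a) z))\<^sup>2"
    by (simp add: norm_mult power_mult_distrib del: of_real_diff of_real_power)
  also have "\<dots> \<le> (1 - (cmod w)\<^sup>2)\<^sup>2 * ((norm (R w a))\<^sup>2 / (1 - (cmod z)\<^sup>2))"
    by (intro mult_left_mono ev_bound_sq z) simp
  finally show ?thesis by (simp add: w_def)
qed

text \<open>Since B 0 = 0, the function R w 1 has value 1 at the origin, and all three terms on the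
  right of \<open>R_identity\<close> equal 1.\<close>

lemma norm_R_one:
  assumes w: "cmod w < 1" shows "(1 - (cmod w)\<^sup>2) * (norm (R w (szego 0)))\<^sup>2 = 1"
proof -
  have "cip (R w (szego 0)) (szego 0) = 1"
    by (simp add: cip_szego ev_R[OF w] B_0 ev_szego)
  moreover from this have "cip (szego 0) (R w (szego 0)) = 1"
    by (metis cip_commute complex_cnj_one)
  moreover have "cip (szego 0) (szego 0) = 1" by (simp add: cip_szego ev_szego)
  ultimately have "complex_of_real ((1 - (cmod w)\<^sup>2) * (norm (R w (szego 0)))\<^sup>2) = of_real 1"
    using R_identity[OF w, of "szego 0" "szego 0"] by (simp add: cip_self)
  then show ?thesis by (simp only: of_real_eq_iff)
qed

text \<open>R w f is f times R w 1, so the multiplier bound reduces the claim to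
  \<open>norm_R_one\<close>.\<close>

lemma norm_R_bounded:
  assumes w: "cmod w < 1" and D: "bdd_hol (ev f) D"
  shows "(1 - (cmod w)\<^sup>2) * (norm (R w f))\<^sup>2 \<le> D\<^sup>2"
proof -
  have "R w f = mul (ev f) (R w (szego 0))"
  proof (rule ev_inject, rule ext)
    fix z show "ev (R w f) z = ev (mul (ev f) (R w (szego 0))) z"
      by (cases "cmod z < 1") (simp_all add: ev_R[OF w] ev_mul[OF D] ev_szego)
  qed
  then have "norm (R w f) \<le> D * norm (R w (szego 0))" using norm_mul_le[OF D] by simp
  from power_mono[OF this norm_ge_zero, of 2]
  have "(norm (R w f))\<^sup>2 \<le> D\<^sup>2 * (norm (R w (szego 0)))\<^sup>2"
    by (simp add: power_mult_distrib)
  moreover have "1 - (cmod w)\<^sup>2 \<ge> 0" using w by (simp add: abs_square_le_1)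
  ultimately have "(1 - (cmod w)\<^sup>2) * (norm (R w f))\<^sup>2 \<le> (1 - (cmod w)\<^sup>2) * (D\<^sup>2 * (norm (R w (szego 0)))\<^sup>2)"
    by (rule mult_left_mono)
  also have "\<dots> = D\<^sup>2 * ((1 - (cmod w)\<^sup>2) * (norm (R w (szego 0)))\<^sup>2)" by simp
  finally show ?thesis unfolding norm_R_one[OF w] by simp
qed

end

section \<open>The wandering subspace of an invariant subspace\<close>

locale invariant_subspace = inner_symbol +
  fixes K :: "h2 set"
  assumes K_sub: "csubspace K" and K_closed: "closed K" and K_inv: "\<And>x. x \<in> K \<Longrightarrow> T x \<in> K"
begin

definition W :: "h2 set" where "W = {x \<in> K. \<forall>y\<in>K. cip (T y) x = 0}"

lemma W_sub: "csubspace W"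
  using K_sub by (auto simp: W_def csubspace_def cip_simps)

lemma W_K: "x \<in> W \<Longrightarrow> x \<in> K" and W_orth: "x \<in> W \<Longrightarrow> y \<in> K \<Longrightarrow> cip (T y) x = 0"
  by (auto simp: W_def)

lemma T_pow_K: "x \<in> K \<Longrightarrow> (T ^^ m) x \<in> K"
  by (induction m) (auto intro: K_inv)

lemma R_K:
  assumes "cmod w < 1" "x \<in> K" shows "R w x \<in> K"
proof (rule closed_sequentially[OF K_closed _ R_partial_sums[OF assms(1)]])
  show "(\<Sum>m<N. (cnj w ^ m) *\<^sub>C (T ^^ m) x) \<in> K" for N
    using K_sub T_pow_K[OF assms(2)] by (intro csubspace_sum) (auto simp: csubspace_def)
qed

text \<open>R w f - f lies in T K, to which J is orthogonal.\<close>

lemma cip_R_W: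
  assumes "cmod w < 1" "f \<in> K" "J \<in> W" shows "cip (R w f) J = cip f J"
proof -
  have "cip (R w f) J = cip (f + cnj w *\<^sub>C T (R w f)) J" using R_eq[OF assms(1), of f] by simp
  also have "\<dots> = cip f J" using W_orth[OF assms(3) R_K[OF assms(1,2)]] by (simp add: cip_simps)
  finally show ?thesis .
qed

text \<open>In \<open>R_identity\<close> the last two terms cancel by
  \<open>cip_R_W\<close>.\<close>

lemma cip_R_R_W:
  assumes "cmod w < 1" "f \<in> K" "J \<in> W"
  shows "(1 - (cmod w)\<^sup>2) * cip (R w f) (R w J) = cip f (R w J)"
  using R_identity[OF assms(1), of f J] cip_R_W[OF assms] by simp

lemma cip_W_R_W:
  assumes "cmod w < 1" "I \<in> W" "J \<in> W" shows "cip I (R w J) = cip I J"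
  using cip_R_W[OF assms(1) W_K[OF assms(3)] assms(2)] by (metis cip_commute)

text \<open>On coefficient functions w -> <q, R w J> the operator T acts as multiplication by
  w.\<close>

lemma cip_T_R_W:
  assumes "cmod w < 1" "q \<in> K" "J \<in> W" shows "cip (T q) (R w J) = w * cip q (R w J)"
proof -
  have "cip (T q) (R w J) = cip (T q) (J + cnj w *\<^sub>C T (R w J))" using R_eq[OF assms(1), of J] by simp
  also have "\<dots> = w * cip q (R w J)" using W_orth[OF assms(3,2)] by (simp add: cip_simps cip_T)
  finally show ?thesis .
qed

lemma cip_T_pow_R_W:
  assumes "cmod w < 1" "I \<in> W" "J \<in> W" shows "cip ((T ^^ m) I) (R w J) = w ^ m * cip I J"
  by (induction m) (auto simp: cip_W_R_W[OF assms] cip_T_R_W[OF assms(1) T_pow_K[OF W_K[OF assms(2)]] assms(3)])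

text \<open>Removing the common power of T leaves J against a vector of T K. This orthonormality is
  the B-inner property of J.\<close>

lemma cip_T_pow_W:
  assumes "J \<in> W" "norm J = 1" shows "cip ((T ^^ m) J) ((T ^^ k) J) = (if m = k then 1 else 0)"
proof -
  have 0: "cip ((T ^^ (k + Suc d)) J) ((T ^^ k) J) = 0" for k d
    unfolding funpow_add comp_apply
    using cip_T_pow[of k "(T ^^ Suc d) J" J] W_orth[OF assms(1) T_pow_K[OF W_K[OF assms(1)]], of d]
    by simp
  consider "m = k" | d where "m = k + Suc d" | d where "k = m + Suc d"
    by (metis less_iff_Suc_add linorder_neqE_nat add_Suc_right)
  then show ?thesis
  proof cases
    case 1
    then show ?thesis using assms(2) by (simp add: cip_self)
  next
    case 2
    then show ?thesis using 0[of k d] by simp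
  next
    case 3
    then show ?thesis using 0[of m d] cip_commute[of "(T ^^ k) J" "(T ^^ m) J"] by simp
  qed
qed

lemma norm_R_W:
  assumes w: "cmod w < 1" and J: "J \<in> W"
  shows "(1 - (cmod w)\<^sup>2) * (norm (R w J))\<^sup>2 = (norm J)\<^sup>2"
proof -
  have "complex_of_real ((1 - (cmod w)\<^sup>2) * (norm (R w J))\<^sup>2) = of_real ((norm J)\<^sup>2)"
    using cip_R_R_W[OF w W_K[OF J] J] cip_W_R_W[OF w J J] by (simp add: cip_self)
  then show ?thesis by (simp only: of_real_eq_iff)
qed

text \<open>In \<open>ev_le_R\<close> one of the two factors 1 - |B z|^2 is used up by
  \<open>norm_R_W\<close>.\<close>

lemma ev_W_le:
  assumes z: "cmod z < 1" and J: "J \<in> W"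
  shows "(cmod (ev J z))\<^sup>2 \<le> (norm J)\<^sup>2 * ((1 - (cmod (B z))\<^sup>2) / (1 - (cmod z)\<^sup>2))"
proof -
  have "(1 - (cmod (B z))\<^sup>2)\<^sup>2 * (norm (R (B z) J))\<^sup>2 = (1 - (cmod (B z))\<^sup>2) * (norm J)\<^sup>2"
    using norm_R_W[OF B_lt_1[OF z] J] by (simp add: power2_eq_square mult.assoc)
  then show ?thesis using ev_le_R[OF z, of J] by (simp add: mult.commute)
qed

lemma ev_W_bdd:
  assumes J: "J \<in> W" shows "bdd_hol (ev J) (norm J * sqrt C)"
  unfolding bdd_hol_def
proof (intro conjI allI impI ev_holomorphic)
  fix z assume z: "cmod z < 1"
  have d: "1 - (cmod z)\<^sup>2 > 0" using z by (simp add: abs_square_less_1)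
  have "(cmod (ev J z))\<^sup>2 \<le> (norm J)\<^sup>2 * ((1 - (cmod (B z))\<^sup>2) / (1 - (cmod z)\<^sup>2))"
    by (rule ev_W_le[OF z J])
  also have "\<dots> \<le> (norm J)\<^sup>2 * C"
    using B_defect[OF z] d by (intro mult_left_mono) (auto simp: divide_le_eq)
  also have "\<dots> = (norm J * sqrt C)\<^sup>2" using C_ge_1 by (simp add: power_mult_distrib)
  finally show "cmod (ev J z) \<le> norm J * sqrt C"
    by (rule power2_le_imp_le) (use C_ge_1 in simp)
qed

definition orthonormal_W :: "nat \<Rightarrow> (nat \<Rightarrow> h2) \<Rightarrow> bool" where
  "orthonormal_W r J \<longleftrightarrow> (\<forall>i<r. J i \<in> W) \<and> (\<forall>i<r. \<forall>j<r. cip (J i) (J j) = (if i = j then 1 else 0))"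

text \<open>\<open>ev_W_le\<close> is applied to I, the reproducing kernel at z of the span of the J
  i. Both I(z) and |I|^2 equal the sum s, so the estimate reads s^2 <= s Q.\<close>

lemma orthonormal_W_pointwise:
  assumes J: "orthonormal_W r J" and z: "cmod z < 1"
  shows "(\<Sum>i<r. (cmod (ev (J i) z))\<^sup>2) \<le> (1 - (cmod (B z))\<^sup>2) / (1 - (cmod z)\<^sup>2)"
proof -
  define s where "s = (\<Sum>i<r. (cmod (ev (J i) z))\<^sup>2)"
  define Q where "Q = (1 - (cmod (B z))\<^sup>2) / (1 - (cmod z)\<^sup>2)"
  define I where "I = (\<Sum>i<r. cnj (ev (J i) z) *\<^sub>C J i)"
  have JW: "J i \<in> W" and JJ: "cip (J i) (J j) = (if i = j then 1 else 0)" if "i < r" "j < r" for i j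
    using J that by (auto simp: orthonormal_W_def)
  have IW: "I \<in> W"
    unfolding I_def using W_sub JW by (intro csubspace_sum) (auto simp: csubspace_def)
  have sc: "of_real s = (\<Sum>i<r. ev (J i) z * cnj (ev (J i) z))"
    unfolding s_def of_real_sum complex_norm_square ..
  have evI: "ev I z = of_real s"
    by (simp add: I_def ev_sum sc mult.commute)
  have "cip (J j) I = ev (J j) z" if "j < r" for j
  proof -
    have "cip I (J j) = (\<Sum>i<r. cnj (ev (J i) z) * (if i = j then 1 else 0))"
      unfolding I_def cip_sum_left using JJ that by (intro sum.cong) (auto simp: cip_simps)
    also have "\<dots> = cnj (ev (J j) z)" using that by (simp add: if_distrib cong: if_cong)
    finally show ?thesis by (metis cip_commute complex_cnj_cnj)
  qed
  then have "cip I I = (\<Sum>i<r. cnj (ev (J i) z) * ev (J i) z)"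
    by (subst (1) I_def) (simp add: cip_sum_left cip_simps)
  then have "complex_of_real ((norm I)\<^sup>2) = of_real s"
    unfolding cip_self[symmetric] sc by (simp add: mult.commute)
  then have nI: "(norm I)\<^sup>2 = s" by (simp only: of_real_eq_iff)
  have s0: "s \<ge> 0" unfolding s_def by (intro sum_nonneg) simp
  have "s\<^sup>2 \<le> s * Q"
    using ev_W_le[OF z IW] unfolding evI nI Q_def by simp
  moreover have "Q \<ge> 0"
    using B_lt_1[OF z] z unfolding Q_def by (intro divide_nonneg_nonneg) (auto simp: abs_square_le_1)
  ultimately have "s \<le> Q" using s0 by (cases "s = 0") (auto simp: power2_eq_square)
  then show ?thesis by (simp add: s_def Q_def)
qed

section \<open>Wold decomposition and coefficient functions\<close>

lemma T_image_closed: "closed (T ` K)"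
  unfolding closed_sequential_limits
proof (intro allI impI, elim conjE)
  fix x l assume x: "\<forall>n. x n \<in> T ` K" and lim: "x \<longlonglongrightarrow> l"
  from x have "\<forall>n. \<exists>k. k \<in> K \<and> x n = T k" by blast
  from choice[OF this] obtain y where y: "\<And>n. y n \<in> K" "\<And>n. x n = T (y n)" by blast
  have d: "dist (T a) (T b) = dist a b" for a b by (simp add: dist_norm flip: T_diff)
  have "Cauchy x" using lim by (rule LIMSEQ_imp_Cauchy)
  then have "Cauchy y" unfolding Cauchy_def y(2) d .
  then obtain k where k: "y \<longlonglongrightarrow> k" using Cauchy_convergent convergent_def by blast
  then have "k \<in> K" using closed_sequentially[OF K_closed] y(1) by blast
  moreover have "(\<lambda>n. T (y n)) \<longlonglongrightarrow> T k"
    using k unfolding lim_sequentially d .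
  then have "x \<longlonglongrightarrow> T k" by (simp only: y(2)[symmetric])
  then have "l = T k" using lim LIMSEQ_unique by blast
  ultimately show "l \<in> T ` K" by blast
qed

lemma K_decomposition:
  assumes "g \<in> K" obtains h v where "h \<in> K" "v \<in> W" "g = T h + v"
proof -
  have "csubspace (T ` K)"
    using K_sub unfolding csubspace_def
    by (auto simp flip: T_add T_scale intro!: image_eqI[of 0 T 0])
  from complex_orthogonal_projection[OF this T_image_closed, of g]
  obtain p where p: "p \<in> T ` K" "\<And>s. s \<in> T ` K \<Longrightarrow> cip (g - p) s = 0" by blast
  then obtain h where h: "h \<in> K" "p = T h" by blast
  have "g - p \<in> K" using csubspace_diff[OF K_sub assms] K_inv[OF h(1)] h(2) by blast
  moreover have "cip (T y) (g - p) = 0" if "y \<in> K" for y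
    using p(2)[of "T y"] that cip_commute[of "T y" "g - p"] by simp
  ultimately have "g - p \<in> W" by (simp add: W_def)
  then show ?thesis using that[of h "g - p"] h by simp
qed

definition W_basis :: "nat \<Rightarrow> (nat \<Rightarrow> h2) \<Rightarrow> bool" where
  "W_basis r J \<longleftrightarrow> orthonormal_W r J \<and> (\<forall>v\<in>W. (\<forall>i<r. cip v (J i) = 0) \<longrightarrow> v = 0)"

text \<open>The bound provides a longest orthonormal family; a nonzero vector of W orthogonal to it
  could be normalised and appended.\<close>

lemma W_basis_exists:
  assumes bound: "\<forall>r J. orthonormal_W r J \<longrightarrow> r \<le> n"
  obtains r J where "r \<le> n" "W_basis r J"
proof -
  define r where "r = (GREATEST r. \<exists>J. orthonormal_W r J)"
  have "orthonormal_W 0 (\<lambda>_. 0)" by (simp add: orthonormal_W_def)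
  then have "\<exists>J. orthonormal_W 0 J" by blast
  then have ex: "\<exists>J. orthonormal_W r J"
    unfolding r_def by (rule GreatestI_nat[where b = n]) (use bound in blast)
  have max: "r' \<le> r" if "\<exists>J. orthonormal_W r' J" for r'
    unfolding r_def using that by (rule Greatest_le_nat[where b = n]) (use bound in blast)
  obtain J where J: "orthonormal_W r J" using ex by blast
  have "v = 0" if v: "v \<in> W" "\<forall>i<r. cip v (J i) = 0" for v
  proof (rule ccontr)
    assume "v \<noteq> 0"
    define u where "u = of_real (1 / norm v) *\<^sub>C v"
    have u: "u \<in> W" using W_sub v(1) by (simp add: u_def csubspace_def)
    have "norm u = 1" using \<open>v \<noteq> 0\<close> by (simp add: u_def norm_scaleC norm_divide)
    then have uu: "cip u u = 1" by (simp add: cip_self)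
    have uJ: "cip u (J i) = 0" if "i < r" for i using v(2) that by (simp add: u_def cip_simps)
    then have Ju: "cip (J i) u = 0" if "i < r" for i using that by (metis cip_commute complex_cnj_zero)
    have "orthonormal_W (Suc r) (J(r := u))"
      using J u uu uJ Ju by (auto simp: orthonormal_W_def less_Suc_eq)
    then have "Suc r \<le> r" using max by blast
    then show False by simp
  qed
  then have "W_basis r J" using J by (simp add: W_basis_def)
  then show ?thesis using that bound J by blast
qed

text \<open>Peeling off W-components, all of which vanish, writes g as T^m h with h in K for every
  m. Then |h| = |g| and |g(z)| is at most |B z|^m times a constant, which tends to 0.\<close>

lemma K_orthogonal_zero:
  assumes J: "W_basis r J" and g: "g \<in> K" "\<And>m i. i < r \<Longrightarrow> cip g ((T ^^ m) (J i)) = 0"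
  shows "g = 0"
proof -
  have JW: "J i \<in> W" if "i < r" for i using J that by (simp add: W_basis_def orthonormal_W_def)
  have step: "\<exists>h'\<in>K. h = T h' \<and> (\<forall>m. \<forall>i<r. cip h' ((T ^^ m) (J i)) = 0)"
    if h: "h \<in> K" "\<forall>m. \<forall>i<r. cip h ((T ^^ m) (J i)) = 0" for h
  proof -
    obtain h' v where hv: "h' \<in> K" "v \<in> W" "h = T h' + v" using K_decomposition[OF h(1)] .
    have "cip v (J i) = 0" if "i < r" for i
    proof -
      have "cip h (J i) = 0" using h(2)[rule_format, of i 0] that by simp
      then show ?thesis using W_orth[OF JW[OF that] hv(1)] by (simp add: hv(3) cip_simps)
    qed
    then have "v = 0" using J hv(2) by (simp add: W_basis_def)
    then have hT: "h = T h'" using hv(3) by simp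
    have "cip h' ((T ^^ m) (J i)) = 0" if "i < r" for m i
      using h(2)[rule_format, of i "Suc m"] that by (simp add: hT cip_T)
    with hv(1) hT show ?thesis by blast
  qed
  have pow: "\<exists>h\<in>K. g = (T ^^ m) h \<and> (\<forall>m. \<forall>i<r. cip h ((T ^^ m) (J i)) = 0)" for m
  proof (induction m)
    case 0
    then show ?case using g by auto
  next
    case (Suc m)
    then obtain h where h: "h \<in> K" "g = (T ^^ m) h" "\<forall>m. \<forall>i<r. cip h ((T ^^ m) (J i)) = 0" by blast
    from step[OF h(1,3)] obtain h' where "h' \<in> K" "h = T h'" "\<forall>m. \<forall>i<r. cip h' ((T ^^ m) (J i)) = 0" by blast
    then show ?case using h(2) by (intro bexI[of _ h']) (simp_all add: funpow_swap1)
  qed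
  have "ev g z = ev 0 z" for z
  proof (cases "cmod z < 1")
    case True
    have le: "cmod (ev g z) \<le> cmod (B z) ^ m * (norm g * norm (szego z))" for m
    proof -
      obtain h where h: "g = (T ^^ m) h" using pow by blast
      have "cmod (ev g z) = cmod (B z) ^ m * cmod (ev h z)"
        by (simp add: h ev_T_pow norm_mult norm_power)
      also have "\<dots> \<le> cmod (B z) ^ m * (norm h * norm (szego z))"
        by (intro mult_left_mono ev_bound True) simp
      finally show ?thesis by (simp add: h)
    qed
    have "(\<lambda>m. cmod (B z) ^ m * (norm g * norm (szego z))) \<longlonglongrightarrow> 0"
      using B_lt_1[OF True] by (intro tendsto_mult_left_zero LIMSEQ_realpow_zero) auto
    then have "cmod (ev g z) \<le> 0"
      by (rule tendsto_lowerbound) (auto intro!: always_eventually le)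
    then show ?thesis by simp
  qed simp
  then show ?thesis by (intro ev_inject ext)
qed

lemma K_representation:
  assumes J: "W_basis r J" and f: "f \<in> K" and z: "cmod z < 1"
  shows "ev f z = (\<Sum>i<r. ev (J i) z * cip f (R (B z) (J i)))"
proof -
  have JW: "J i \<in> W" and JJ: "cip (J i) (J j) = (if i = j then 1 else 0)" if "i < r" "j < r" for i j
    using J that by (auto simp: W_basis_def orthonormal_W_def)
  \<comment> \<open>Writing f(z) as a product with the kernel makes both sides linear and continuous
    in f, so Z is a closed subspace. It contains all T^m (J i), so f minus its projection to Z is
    orthogonal to these and vanishes.\<close>
  define Z where "Z = {f \<in> K. \<forall>z. cmod z < 1 \<longrightarrow> cip f (szego z) = (\<Sum>i<r. ev (J i) z * cip f (R (B z) (J i)))}"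
  have "csubspace Z"
    using K_sub unfolding csubspace_def Z_def
    by (auto simp: cip_simps distrib_left sum.distrib sum_distrib_left mult.left_commute)
  moreover have "closed Z"
    unfolding closed_sequential_limits
  proof (intro allI impI, elim conjE)
    fix x l assume x: "\<forall>n. x n \<in> Z" and lim: "x \<longlonglongrightarrow> l"
    have "l \<in> K" using closed_sequentially[OF K_closed _ lim] x by (simp add: Z_def)
    moreover have "cip l (szego z) = (\<Sum>i<r. ev (J i) z * cip l (R (B z) (J i)))" if "cmod z < 1" for z
    proof (rule LIMSEQ_unique)
      show "(\<lambda>n. cip (x n) (szego z)) \<longlonglongrightarrow> cip l (szego z)" by (intro tendsto_intros lim)
      have "(\<lambda>n. \<Sum>i<r. ev (J i) z * cip (x n) (R (B z) (J i))) \<longlonglongrightarrow> (\<Sum>i<r. ev (J i) z * cip l (R (B z) (J i)))"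
        by (intro tendsto_intros lim)
      then show "(\<lambda>n. cip (x n) (szego z)) \<longlonglongrightarrow> (\<Sum>i<r. ev (J i) z * cip l (R (B z) (J i)))"
        using x that by (simp add: Z_def)
    qed
    ultimately show "l \<in> Z" by (simp add: Z_def)
  qed
  ultimately obtain p where p: "p \<in> Z" "\<And>s. s \<in> Z \<Longrightarrow> cip (f - p) s = 0"
    using complex_orthogonal_projection by blast
  have "(T ^^ m) (J i) \<in> Z" if i: "i < r" for m i
  proof -
    have "(T ^^ m) (J i) \<in> K" using JW W_K T_pow_K i by blast
    moreover have "cip ((T ^^ m) (J i)) (szego z) = (\<Sum>j<r. ev (J j) z * cip ((T ^^ m) (J i)) (R (B z) (J j)))"
      if z: "cmod z < 1" for z
    proof -
      have "(\<Sum>j<r. ev (J j) z * cip ((T ^^ m) (J i)) (R (B z) (J j))) =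
          (\<Sum>j<r. if j = i then B z ^ m * ev (J j) z else 0)"
        using JW JJ i by (intro sum.cong) (auto simp: cip_T_pow_R_W[OF B_lt_1[OF z]])
      then show ?thesis using i z by (simp add: cip_szego ev_T_pow)
    qed
    ultimately show ?thesis by (simp add: Z_def)
  qed
  then have "f - p = 0"
    using p f by (intro K_orthogonal_zero[OF J]) (auto simp: Z_def intro!: csubspace_diff[OF K_sub])
  then have "f \<in> Z" using p(1) by simp
  then show ?thesis using z by (simp add: Z_def cip_szego)
qed

text \<open>Cauchy-Schwarz in \<open>cip_R_R_W\<close>, with the factor 1 - |w|^2 shared out: it
  bounds |R w f|^2 by D^2 through \<open>norm_R_bounded\<close> and makes |R w J|^2 equal to 1. The
  bound of f is kept exactly.\<close>

lemma cip_R_W_bdd: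
  assumes f: "f \<in> K" "bdd_hol (ev f) D" and J: "J \<in> W" "norm J = 1"
  shows "bdd_hol (\<lambda>w. cip f (R w J)) D"
  unfolding bdd_hol_def
proof (intro conjI allI impI cip_R_holomorphic)
  fix w assume w: "cmod w < 1"
  define d where "d = 1 - (cmod w)\<^sup>2"
  have d: "d > 0" using w by (simp add: d_def abs_square_less_1)
  have D: "D \<ge> 0" by (rule bdd_hol_nonneg[OF f(2)])
  have "of_real d * cip (R w f) (R w J) = cip f (R w J)"
    using cip_R_R_W[OF w f(1) J(1)] by (simp add: d_def)
  then have "cmod (cip f (R w J)) = d * cmod (cip (R w f) (R w J))"
    using d by (metis abs_of_pos norm_mult norm_of_real)
  also have "\<dots> \<le> d * (norm (R w f) * norm (R w J))"
    using d by (intro mult_left_mono cip_Cauchy_Schwarz) auto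
  finally have "cmod (cip f (R w J)) \<le> d * (norm (R w f) * norm (R w J))" .
  from power_mono[OF this norm_ge_zero, of 2]
  have "(cmod (cip f (R w J)))\<^sup>2 \<le> (d * (norm (R w f))\<^sup>2) * (d * (norm (R w J))\<^sup>2)"
    by (simp add: power_mult_distrib power2_eq_square mult_ac)
  also have "\<dots> = d * (norm (R w f))\<^sup>2"
    using norm_R_W[OF w J(1)] J(2) by (simp add: d_def)
  also have "\<dots> \<le> D\<^sup>2" unfolding d_def by (rule norm_R_bounded[OF w f(2)])
  finally show "cmod (cip f (R w J)) \<le> D" using D by (rule power2_le_imp_le)
qed

end

section \<open>Weak-star closed invariant subspaces\<close>

text \<open>\<open>bdd_hol\<close> says nothing about values off the disc, whereas
  \<open>Hinf\<close> demands zeros there.\<close>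

lemma bdd_hol_cut: "bdd_hol f D \<Longrightarrow> (\<lambda>z. if cmod z < 1 then f z else 0) \<in> Hinf"
  using holomorphic_transform[of f "ball 0 1" "\<lambda>z. if cmod z < 1 then f z else 0"]
  by (intro HinfI[of _ D]) (auto simp: bdd_hol_def)

lemma Hinf_eq_ev:
  assumes "f \<in> Hinf" obtains a where "ev a = f"
proof -
  obtain D where D: "bdd_hol f D" "\<And>z. \<not> cmod z < 1 \<Longrightarrow> f z = 0" using HinfE[OF assms] by blast
  have "ev (mul f (szego 0)) z = f z" for z
    using D(2)[of z] by (cases "cmod z < 1") (simp_all add: ev_mul[OF D(1)] ev_szego)
  with that show ?thesis by blast
qed

lemma ev_tendsto:
  assumes "s \<longlonglongrightarrow> x" shows "(\<lambda>n. ev (s n) z) \<longlonglongrightarrow> ev x z"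
proof (cases "cmod z < 1")
  case True
  have "(\<lambda>n. cip (s n) (szego z)) \<longlonglongrightarrow> cip x (szego z)" by (intro tendsto_intros assms)
  then show ?thesis by (simp add: cip_szego True)
qed simp

text \<open>Serves to split F(B) as F(w) plus B - w times a bounded function of B. G is bounded near
  w by compactness and elsewhere because |u - w| stays away from 0.\<close>

lemma difference_quotient_bdd:
  assumes F: "bdd_hol F D" and w: "cmod w < 1"
  obtains G E where "bdd_hol G E" "\<And>u. F u = F w + (u - w) * G u"
proof -
  define G where "G u = (if u = w then deriv F w else (F u - F w) / (u - w))" for u
  have hol: "G holomorphic_on ball 0 1"
    unfolding G_def using F by (intro pole_lemma_open) (auto simp: bdd_hol_def)
  \<comment> \<open>Half the distance to the unit circle, so the closed disc around w stays
    inside.\<close>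
  define d where "d = (1 - cmod w) / 2"
  have d: "d > 0" "cmod w + d < 1" using w by (auto simp: d_def field_simps)
  have sub: "cball w d \<subseteq> ball 0 1"
  proof
    fix u assume "u \<in> cball w d"
    then have "cmod (u - w) \<le> d" by (simp add: dist_norm norm_minus_commute)
    then show "u \<in> ball 0 1" using norm_triangle_ineq[of w "u - w"] d(2) by simp
  qed
  have "continuous_on (cball w d) G"
    using continuous_on_subset[OF holomorphic_on_imp_continuous_on[OF hol] sub] .
  then have "bounded (G ` cball w d)"
    by (intro compact_imp_bounded compact_continuous_image compact_cball)
  then obtain E where E: "\<And>u. u \<in> cball w d \<Longrightarrow> cmod (G u) \<le> E" unfolding bounded_iff by blast
  have "cmod (G u) \<le> max E (2 * D / d)" if u: "cmod u < 1" for u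
  proof (cases "u \<in> cball w d")
    case True
    then show ?thesis using E[OF True] by simp
  next
    case False
    then have ud: "cmod (u - w) > d" by (simp add: dist_norm norm_minus_commute)
    have "cmod (F u - F w) \<le> 2 * D"
      using norm_triangle_ineq4[of "F u" "F w"] bdd_holD[OF F u] bdd_holD[OF F w] by linarith
    then have "cmod (F u - F w) / cmod (u - w) \<le> 2 * D / d"
      using ud d(1) bdd_hol_nonneg[OF F] by (intro frac_le) auto
    then show ?thesis using ud d(1) by (auto simp: G_def norm_divide)
  qed
  then have "bdd_hol G (max E (2 * D / d))" using hol by (simp add: bdd_hol_def)
  moreover have "F u = F w + (u - w) * G u" for u by (simp add: G_def)
  ultimately show ?thesis using that by blast
qed

lemma (in inner_symbol) bdd_hol_compose: "bdd_hol F D \<Longrightarrow> bdd_hol (\<lambda>z. F (B z)) D"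
  unfolding bdd_hol_def using B_lt_1
  by (auto intro!: holomorphic_on_compose_gen[OF B_hol, of F "ball 0 1", unfolded o_def])

text \<open>Averaging \<open>orthonormal_W_pointwise\<close> over circles turns the left side into
  the sum of the r unit norms in the limit, while each of the n terms on the right has mean at most
  1. For a Blaschke product the k i are Szego kernels at the zeros.\<close>

lemma (in invariant_subspace) orthonormal_W_card_le:
  assumes J: "orthonormal_W r J"
    and le: "\<And>z. cmod z < 1 \<Longrightarrow> 1 - (cmod (B z))\<^sup>2 \<le> (1 - (cmod z)\<^sup>2) * (\<Sum>i<n. d i * (cmod (ev (k i) z))\<^sup>2)"
    and k: "\<And>i. i < n \<Longrightarrow> 0 \<le> d i" "\<And>i. i < n \<Longrightarrow> d i * (norm (k i))\<^sup>2 \<le> 1"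
  shows "r \<le> n"
proof -
  have norm1: "norm (J i) = 1" if "i < r" for i
    using J that by (intro norm_eq_1I) (simp add: orthonormal_W_def)
  have "(\<Sum>i<r. 1 * (norm (J i))\<^sup>2) \<le> real n"
  proof (rule tendsto_upperbound)
    show "((\<lambda>\<rho>. \<Sum>i<r. 1 * circle_msq \<rho> (ev (J i))) \<longlongrightarrow> (\<Sum>i<r. 1 * (norm (J i))\<^sup>2)) (at_left 1)"
      by (intro tendsto_intros circle_msq_tendsto)
    show "\<forall>\<^sub>F \<rho> in at_left 1. (\<Sum>i<r. 1 * circle_msq \<rho> (ev (J i))) \<le> real n"
      using eventually_unit_interval
    proof eventually_elim
      case (elim \<rho>)
      then have \<rho>: "0 \<le> \<rho>" "\<rho> < 1" by auto
      have "(\<Sum>i<r. 1 * circle_msq \<rho> (ev (J i))) \<le> (\<Sum>i<n. d i * circle_msq \<rho> (ev (k i)))"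
      proof (rule circle_msq_mono[OF ev_holomorphic ev_holomorphic \<rho>])
        fix z assume "cmod z = \<rho>"
        then have z: "cmod z < 1" using \<rho> by simp
        then have "1 - (cmod z)\<^sup>2 > 0" by (simp add: abs_square_less_1)
        then have "(1 - (cmod (B z))\<^sup>2) / (1 - (cmod z)\<^sup>2) \<le> (\<Sum>i<n. d i * (cmod (ev (k i) z))\<^sup>2)"
          using le[OF z] by (simp add: divide_le_eq mult.commute)
        then show "(\<Sum>i<r. 1 * (cmod (ev (J i) z))\<^sup>2) \<le> (\<Sum>i<n. d i * (cmod (ev (k i) z))\<^sup>2)"
          using orthonormal_W_pointwise[OF J z] by simp
      qed
      also have "\<dots> \<le> (\<Sum>i<n. 1)"
      proof (rule sum_mono)
        fix i assume "i \<in> {..<n}"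
        then show "d i * circle_msq \<rho> (ev (k i)) \<le> 1"
          using mult_left_mono[OF circle_msq_ev_le[OF \<rho>, of "k i"] k(1)[of i]] k(2)[of i] by simp
      qed
      finally show ?case by simp
    qed
  qed simp
  moreover have "(\<Sum>i<r. 1 * (norm (J i))\<^sup>2) = real r" using norm1 by simp
  ultimately show ?thesis by simp
qed

section \<open>The weak-star closed subspace M and its closure in H^2\<close>

locale weakstar_invariant = inner_symbol +
  fixes M :: "(complex \<Rightarrow> complex) set"
  assumes M_sub: "Hinf_subspace M" and M_closed: "weakstar_closed M"
    and M_inv: "\<And>f. f \<in> M \<Longrightarrow> (\<lambda>z. B z * f z) \<in> M"
begin

definition K :: "h2 set" where "K = closure {a. ev a \<in> M}"

lemma M_Hinf: "f \<in> M \<Longrightarrow> f \<in> Hinf"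
  using M_sub by (auto simp: Hinf_subspace_def)

lemma M_zero: "(\<lambda>z. 0) \<in> M" and M_add: "f \<in> M \<Longrightarrow> g \<in> M \<Longrightarrow> (\<lambda>z. f z + g z) \<in> M"
  and M_scale: "f \<in> M \<Longrightarrow> (\<lambda>z. c * f z) \<in> M"
  using M_sub by (auto simp: Hinf_subspace_def)

lemma K_seq: "x \<in> K \<longleftrightarrow> (\<exists>s. (\<forall>n. ev (s n) \<in> M) \<and> s \<longlonglongrightarrow> x)"
  by (simp add: K_def closure_sequential)

lemma K_seqI: "(\<And>n. ev (s n) \<in> M) \<Longrightarrow> s \<longlonglongrightarrow> x \<Longrightarrow> x \<in> K"
  using K_seq by blast

lemma M_K: "ev a \<in> M \<Longrightarrow> a \<in> K"
  using closure_subset[of "{a. ev a \<in> M}"] by (auto simp: K_def)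

lemma M_sum: "(\<And>i. i \<in> A \<Longrightarrow> f i \<in> M) \<Longrightarrow> (\<lambda>z. \<Sum>i\<in>A. f i z) \<in> M"
  by (induction A rule: infinite_finite_induct) (auto intro: M_zero M_add)

text \<open>Invariance gives polynomials in B. Taylor polynomials of F need not be uniformly
  bounded, so two limits are taken: polynomials approximate the dilation w -> F (\<rho> w), and then
  \<rho> -> 1 with the bound of F preserved.\<close>

lemma M_mult:
  assumes F: "F \<in> Hinf" and f: "f \<in> M" shows "(\<lambda>z. F (B z) * f z) \<in> M"
proof -
  obtain D where D: "bdd_hol F D" using HinfE[OF F] by blast
  obtain E where E: "bdd_hol f E" "\<And>z. \<not> cmod z < 1 \<Longrightarrow> f z = 0" using HinfE[OF M_Hinf[OF f]] by blast
  have E0: "E \<ge> 0" by (rule bdd_hol_nonneg[OF E(1)])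
  have prod: "bdd_hol (\<lambda>z. g (B z) * f z) (A * E)" if "bdd_hol g A" for g A
    using bdd_hol_compose[OF that] E(1) bdd_hol_nonneg[OF that]
    by (auto simp: bdd_hol_def norm_mult intro!: holomorphic_intros mult_mono)
  have pow: "(\<lambda>z. B z ^ k * f z) \<in> M" for k
  proof (induction k)
    case (Suc k)
    from M_inv[OF Suc] show ?case by (simp add: mult.assoc)
  qed (use f in simp)
  define u where "u k = (deriv ^^ k) F 0 / fact k" for k
  have u: "(\<lambda>k. u k * w ^ k) sums F w" if "cmod w < 1" for w
    using holomorphic_power_series[of F 0 1 w] D that by (simp add: u_def bdd_hol_def)
  have \<rho>w: "cmod (of_real \<rho> * w) < 1" if \<rho>: "0 \<le> \<rho>" "\<rho> < 1" and w: "cmod w < 1" for \<rho> w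
  proof -
    have "\<rho> * cmod w \<le> 1 * cmod w" using \<rho> by (intro mult_right_mono) auto
    then show ?thesis using w \<rho> by (simp add: norm_mult)
  qed
  have F\<rho>: "bdd_hol (\<lambda>w. F (of_real \<rho> * w)) D" if \<rho>: "0 \<le> \<rho>" "\<rho> < 1" for \<rho>
    using D \<rho>w[OF \<rho>] unfolding bdd_hol_def
    by (auto intro!: holomorphic_intros
        holomorphic_on_compose_gen[of "\<lambda>w. of_real \<rho> * w" "ball 0 1" F "ball 0 1", unfolded o_def])
  have shrink: "(\<lambda>z. F (of_real \<rho> * B z) * f z) \<in> M" if \<rho>: "0 \<le> \<rho>" "\<rho> < 1" for \<rho>
  proof -
    \<comment> \<open>Convergence at \<sigma> makes the series absolutely convergent at \<rho>,
      which bounds all partial sums at once.\<close>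
    obtain \<sigma> where \<sigma>: "\<rho> < \<sigma>" "\<sigma> < 1" using dense \<rho>(2) by blast
    have "summable (\<lambda>k. u k * of_real \<sigma> ^ k)" using u[of "of_real \<sigma>"] \<sigma> \<rho> by (auto simp: sums_iff)
    then have "summable (\<lambda>k. norm (u k * of_real \<rho> ^ k))"
      by (rule powser_insidea) (use \<sigma> \<rho> in simp)
    then have sm: "summable (\<lambda>k. cmod (u k) * \<rho> ^ k)"
      using \<rho> by (simp add: norm_mult norm_power)
    define A where "A = (\<Sum>k. cmod (u k) * \<rho> ^ k)"
    define p where "p N w = (\<Sum>k<N. u k * (of_real \<rho> * w) ^ k)" for N w
    have p_bdd: "bdd_hol (p N) A" for N
      unfolding bdd_hol_def
    proof (intro conjI allI impI)
      show "p N holomorphic_on ball 0 1" unfolding p_def by (intro holomorphic_intros)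
      fix w :: complex assume w: "cmod w < 1"
      have "cmod (p N w) \<le> (\<Sum>k<N. cmod (u k * (of_real \<rho> * w) ^ k))"
        unfolding p_def by (rule norm_sum)
      also have "\<dots> \<le> (\<Sum>k<N. cmod (u k) * \<rho> ^ k)"
      proof (rule sum_mono)
        fix k
        have "\<rho> ^ k * cmod w ^ k \<le> \<rho> ^ k * 1"
          using w \<rho> by (intro mult_left_mono power_le_one) auto
        then show "cmod (u k * (of_real \<rho> * w) ^ k) \<le> cmod (u k) * \<rho> ^ k"
          using \<rho> by (auto simp: norm_mult norm_power power_mult_distrib intro!: mult_left_mono)
      qed
      also have "\<dots> \<le> A" unfolding A_def using \<rho> by (intro sum_le_suminf sm) auto
      finally show "cmod (p N w) \<le> A" .
    qed
    show ?thesis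
    proof (rule weakstar_closed_limit[OF M_closed])
      show "(\<lambda>z. p N (B z) * f z) \<in> M" for N
      proof -
        have "(\<lambda>z. \<Sum>k<N. (u k * of_real \<rho> ^ k) * (B z ^ k * f z)) \<in> M"
          by (intro M_sum M_scale pow)
        then show ?thesis by (simp add: p_def sum_distrib_right power_mult_distrib mult.assoc)
      qed
      show "bdd_hol (\<lambda>z. p N (B z) * f z) (A * E)" for N by (rule prod[OF p_bdd])
      show "(\<lambda>z. F (of_real \<rho> * B z) * f z) \<in> Hinf"
        using prod[OF F\<rho>[OF \<rho>]] E(2) by (intro HinfI) auto
      show "(\<lambda>N. p N (B z) * f z) \<longlonglongrightarrow> F (of_real \<rho> * B z) * f z" if "cmod z < 1" for z
        using u[OF \<rho>w[OF \<rho> B_lt_1[OF that]]] unfolding sums_def p_def by (intro tendsto_intros)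
    qed
  qed
  define \<rho> where "\<rho> n = 1 - 1 / real (Suc n)" for n
  have \<rho>: "0 \<le> \<rho> n" "\<rho> n < 1" for n by (auto simp: \<rho>_def)
  have \<rho>lim: "\<rho> \<longlonglongrightarrow> 1"
    using tendsto_diff[OF tendsto_const LIMSEQ_inverse_real_of_nat, of 1] by (simp add: \<rho>_def[abs_def] inverse_eq_divide)
  show ?thesis
  proof (rule weakstar_closed_limit[OF M_closed])
    show "(\<lambda>z. F (of_real (\<rho> n) * B z) * f z) \<in> M" for n by (rule shrink[OF \<rho>])
    show "(\<lambda>z. F (B z) * f z) \<in> Hinf" using prod[OF D] E(2) by (intro HinfI) auto
    show "bdd_hol (\<lambda>z. F (of_real (\<rho> n) * B z) * f z) (D * E)" for n by (rule prod[OF F\<rho>[OF \<rho>]])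
    show "(\<lambda>n. F (of_real (\<rho> n) * B z) * f z) \<longlonglongrightarrow> F (B z) * f z" if z: "cmod z < 1" for z
    proof -
      have "isCont F (B z)"
        using D B_lt_1[OF z] holomorphic_on_imp_continuous_on[of F "ball 0 1"]
        by (auto simp: bdd_hol_def continuous_on_eq_continuous_at)
      moreover have "(\<lambda>n. of_real (\<rho> n) * B z) \<longlonglongrightarrow> of_real 1 * B z"
        by (intro tendsto_intros \<rho>lim)
      ultimately have "(\<lambda>n. F (of_real (\<rho> n) * B z)) \<longlonglongrightarrow> F (B z)"
        by (intro isCont_tendsto_compose[of "B z" F]) simp_all
      then show ?thesis by (intro tendsto_intros)
    qed
  qed
qed

sublocale invariant_subspace B C K
proof
  show "closed K" by (simp add: K_def)
  show "csubspace K"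
    unfolding csubspace_def
  proof (intro conjI ballI allI)
    show "0 \<in> K"
    proof (rule M_K)
      have "ev 0 = (\<lambda>z. 0)" by (rule ext) simp
      then show "ev 0 \<in> M" using M_zero by simp
    qed
    fix x assume "x \<in> K"
    then obtain s where s: "\<forall>n. ev (s n) \<in> M" "s \<longlonglongrightarrow> x" by (auto simp: K_seq)
    show "c *\<^sub>C x \<in> K" for c
    proof -
      have "ev (c *\<^sub>C s n) \<in> M" for n
        using M_scale[OF s(1)[rule_format, of n], of c] by (simp flip: ev_scale)
      moreover have "(\<lambda>n. c *\<^sub>C s n) \<longlonglongrightarrow> c *\<^sub>C x" by (intro tendsto_intros s(2))
      ultimately show ?thesis by (rule K_seqI)
    qed
    fix y assume "y \<in> K"
    then obtain t where t: "\<forall>n. ev (t n) \<in> M" "t \<longlonglongrightarrow> y" by (auto simp: K_seq)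
    have "ev (s n + t n) \<in> M" for n
      using M_add[OF s(1)[rule_format, of n] t(1)[rule_format, of n]] by (simp flip: ev_add)
    moreover have "(\<lambda>n. s n + t n) \<longlonglongrightarrow> x + y" by (intro tendsto_intros s(2) t(2))
    ultimately show "x + y \<in> K" by (rule K_seqI)
  qed
  show "T x \<in> K" if "x \<in> K" for x
  proof -
    obtain s where s: "\<forall>n. ev (s n) \<in> M" "s \<longlonglongrightarrow> x" using \<open>x \<in> K\<close> by (auto simp: K_seq)
    have "ev (T (s n)) \<in> M" for n
      using M_inv[OF s(1)[rule_format, of n]] by (simp flip: ev_T)
    moreover have "dist (T a) (T b) = dist a b" for a b by (simp add: dist_norm flip: T_diff)
    then have "(\<lambda>n. T (s n)) \<longlonglongrightarrow> T x" using s(2) by (simp add: lim_sequentially)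
    ultimately show ?thesis by (rule K_seqI)
  qed
qed

lemma bounded_K_in_M:
  assumes j: "j \<in> K" and D: "bdd_hol (ev j) D"
  shows "ev j \<in> M"
proof -
  obtain s where s: "\<And>n. ev (s n) \<in> M" "s \<longlonglongrightarrow> j" using j by (auto simp: K_seq)
  define h where "h n = s n - j" for n
  \<comment> \<open>Doubling the product and subtracting the norm gives, by
    \<open>R_identity\<close>, a real part that is a square norm times 1 - |w|^2: the Poisson
    integral behind the Herglotz integral.\<close>
  define H where "H n w = 2 * cip (h n) (R w (h n)) - of_real ((norm (h n))\<^sup>2)" for n w
  have ReH: "Re (H n w) = (1 - (cmod w)\<^sup>2) * (norm (R w (h n)))\<^sup>2" if w: "cmod w < 1" for n w
  proof -
    have "complex_of_real ((1 - (cmod w)\<^sup>2) * (norm (R w (h n)))\<^sup>2) =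
        cip (h n) (R w (h n)) + cnj (cip (h n) (R w (h n))) - of_real ((norm (h n))\<^sup>2)"
      using R_identity[OF w, of "h n" "h n"] cip_commute[of "R w (h n)" "h n"] by (simp add: cip_self)
    from arg_cong[OF this, of Re]
    have "(1 - (cmod w)\<^sup>2) * (norm (R w (h n)))\<^sup>2 = 2 * Re (cip (h n) (R w (h n))) - (norm (h n))\<^sup>2"
      by (simp only: Re_complex_of_real minus_complex.sel plus_complex.sel cnj.sel)
    then show ?thesis by (simp add: H_def del: of_real_power)
  qed
  have ReH0: "Re (H n w) \<ge> 0" if "cmod w < 1" for n w
    unfolding ReH[OF that] using that by (simp add: abs_square_le_1)
  have norm1H: "1 + Re (H n w) \<le> cmod (1 + H n w)" for n w
    using complex_Re_le_cmod[of "1 + H n w"] by simp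
  have holH: "H n holomorphic_on ball 0 1" for n
    unfolding H_def by (intro holomorphic_intros cip_R_holomorphic)
  define U where "U n w = 1 / (1 + H n w)" for n w
  have U_bdd: "bdd_hol (U n) 1" for n
    unfolding bdd_hol_def
  proof (intro conjI allI impI)
    have "1 + H n w \<noteq> 0" if "cmod w < 1" for w
      using norm1H[of n w] ReH0[OF that, of n] by auto
    then show "U n holomorphic_on ball 0 1"
      unfolding U_def by (intro holomorphic_intros holH) auto
    show "cmod (U n w) \<le> 1" if "cmod w < 1" for w
    proof -
      have "1 \<le> cmod (1 + H n w)" using norm1H[of n w] ReH0[OF that, of n] by linarith
      then show ?thesis by (auto simp: U_def norm_divide divide_le_eq_1)
    qed
  qed
  have h_le: "(cmod (ev (h n) z))\<^sup>2 \<le> C * Re (H n (B z))" if z: "cmod z < 1" for n z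
  proof -
    have d: "1 - (cmod z)\<^sup>2 > 0" using z by (simp add: abs_square_less_1)
    have "(cmod (ev (h n) z))\<^sup>2 \<le> ((1 - (cmod (B z))\<^sup>2) / (1 - (cmod z)\<^sup>2)) * Re (H n (B z))"
      using ev_le_R[OF z, of "h n"] by (simp add: ReH[OF B_lt_1[OF z]] power2_eq_square mult.assoc)
    also have "\<dots> \<le> C * Re (H n (B z))"
      using B_defect[OF z] d by (intro mult_right_mono ReH0 B_lt_1 z) (simp add: divide_le_eq)
    finally show ?thesis .
  qed
  have Uh: "cmod (U n (B z)) * cmod (ev (h n) z) \<le> C" if z: "cmod z < 1" for n z
  proof -
    define x where "x = cmod (ev (h n) z)"
    \<comment> \<open>\<open>h_le\<close> controls only the square of x; the 1 in the denominator 1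
      + H pays for the passage to the first power.\<close>
    have "2 * x \<le> 1 + x\<^sup>2" using zero_le_power2[of "x - 1"] by (simp add: power2_diff)
    then have "x \<le> 1 + x\<^sup>2" using zero_le_power2[of x] by linarith
    also have "\<dots> \<le> C * (1 + Re (H n (B z)))"
      using h_le[OF z, of n] C_ge_1 by (simp add: x_def distrib_left)
    also have "\<dots> \<le> C * cmod (1 + H n (B z))"
      using norm1H C_ge_1 by (intro mult_left_mono) auto
    finally have "x \<le> C * cmod (1 + H n (B z))" .
    moreover have "cmod (1 + H n (B z)) > 0"
      using norm1H[of n "B z"] ReH0[OF B_lt_1[OF z], of n] by linarith
    ultimately show ?thesis by (simp add: x_def U_def norm_divide divide_le_eq)
  qed
  have s_eq: "ev (s n) z = ev j z + ev (h n) z" for n z by (simp add: h_def)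
  show ?thesis
  proof (rule weakstar_closed_limit[OF M_closed])
    fix n
    have "(\<lambda>z. (if cmod (B z) < 1 then U n (B z) else 0) * ev (s n) z) \<in> M"
      by (rule M_mult[OF bdd_hol_cut[OF U_bdd] s(1)])
    \<comment> \<open>Off the disc B z is unrestricted, but \<open>ev\<close> vanishes there, so the
      cut-off changes nothing.\<close>
    moreover have "(\<lambda>z. (if cmod (B z) < 1 then U n (B z) else 0) * ev (s n) z) = (\<lambda>z. U n (B z) * ev (s n) z)"
    proof
      fix z show "(if cmod (B z) < 1 then U n (B z) else 0) * ev (s n) z = U n (B z) * ev (s n) z"
        using B_lt_1[of z] by (cases "cmod z < 1") auto
    qed
    ultimately show "(\<lambda>z. U n (B z) * ev (s n) z) \<in> M" by simp
    show "bdd_hol (\<lambda>z. U n (B z) * ev (s n) z) (D + C)"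
      unfolding bdd_hol_def
    proof (intro conjI allI impI)
      show "(\<lambda>z. U n (B z) * ev (s n) z) holomorphic_on ball 0 1"
        using bdd_hol_compose[OF U_bdd[of n]] by (auto simp: bdd_hol_def intro!: holomorphic_intros ev_holomorphic)
      fix z assume z: "cmod z < 1"
      have "cmod (U n (B z) * ev (s n) z) \<le> cmod (U n (B z)) * cmod (ev j z) + cmod (U n (B z)) * cmod (ev (h n) z)"
        unfolding s_eq distrib_left using norm_triangle_ineq[of "U n (B z) * ev j z" "U n (B z) * ev (h n) z"]
        by (simp add: norm_mult)
      also have "cmod (U n (B z)) * cmod (ev j z) \<le> 1 * D"
        using U_bdd[of n] D z B_lt_1[OF z] by (intro mult_mono) (auto simp: bdd_hol_def)
      finally show "cmod (U n (B z) * ev (s n) z) \<le> D + C" using Uh[OF z, of n] by simp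
    qed
  next
    show "ev j \<in> Hinf" by (rule HinfI[OF D]) simp
    fix z assume z: "cmod z < 1"
    define w where "w = B z"
    have w: "cmod w < 1" using B_lt_1[OF z] by (simp add: w_def)
    have h0: "h \<longlonglongrightarrow> 0" unfolding h_def[abs_def] using s(2) by (rule LIM_zero)
    have "(\<lambda>n. cip (h n) (R w (h n))) \<longlonglongrightarrow> 0"
    proof (rule tendsto_norm_zero_cancel, rule tendsto_sandwich[of "\<lambda>_. 0"])
      show "\<forall>\<^sub>F n in sequentially. cmod (cip (h n) (R w (h n))) \<le> norm (h n) * (norm (h n) / (1 - cmod w))"
        by (intro always_eventually allI order_trans[OF cip_Cauchy_Schwarz] mult_left_mono norm_R_le w norm_ge_zero)
      show "(\<lambda>n. norm (h n) * (norm (h n) / (1 - cmod w))) \<longlonglongrightarrow> 0"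
      proof -
        have "(\<lambda>n. norm (h n) * (norm (h n) / (1 - cmod w))) \<longlonglongrightarrow> norm (0::h2) * (norm (0::h2) / (1 - cmod w))"
          using w by (intro tendsto_intros h0) auto
        then show ?thesis by simp
      qed
    qed auto
    then have "(\<lambda>n. H n w) \<longlonglongrightarrow> 2 * 0 - of_real ((norm (0::h2))\<^sup>2)"
      unfolding H_def by (intro tendsto_intros h0)
    then have "(\<lambda>n. U n w) \<longlonglongrightarrow> 1 / (1 + (2 * 0 - of_real ((norm (0::h2))\<^sup>2)))"
      unfolding U_def by (intro tendsto_intros) auto
    then have "(\<lambda>n. U n (B z) * ev (s n) z) \<longlonglongrightarrow> 1 / (1 + (2 * 0 - of_real ((norm (0::h2))\<^sup>2))) * ev j z"
      unfolding w_def by (intro tendsto_intros ev_tendsto s(2))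
    then show "(\<lambda>n. U n (B z) * ev (s n) z) \<longlonglongrightarrow> ev j z" by simp
  qed
qed

lemma W_in_M: "J \<in> W \<Longrightarrow> ev J \<in> M"
  by (rule bounded_K_in_M[OF W_K ev_W_bdd])

text \<open>Recovers F from the product F(B) I. The latter is F(w) I + (T - w) q with q in K, and
  \<open>cip_T_R_W\<close> says that (T - w) q is orthogonal to R w J. This gives uniqueness of the
  coefficients.\<close>

lemma cip_mul_R_W:
  assumes F: "F \<in> Hinf" and I: "I \<in> W" and J: "J \<in> W" and w: "cmod w < 1"
  shows "cip (mul (\<lambda>z. F (B z)) I) (R w J) = F w * cip I J"
proof -
  obtain D where D: "bdd_hol F D" using HinfE[OF F] by blast
  obtain G E where G: "bdd_hol G E" and FG: "\<And>u. F u = F w + (u - w) * G u"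
    using difference_quotient_bdd[OF D w] by blast
  define q where "q = mul (\<lambda>z. G (B z)) I"
  have q: "ev q z = G (B z) * ev I z" for z
    unfolding q_def by (rule ev_mul[OF bdd_hol_compose[OF G]])
  have "(\<lambda>z. (if cmod (B z) < 1 then G (B z) else 0) * ev I z) \<in> M"
    by (rule M_mult[OF bdd_hol_cut[OF G] W_in_M[OF I]])
  moreover have "(\<lambda>z. (if cmod (B z) < 1 then G (B z) else 0) * ev I z) = ev q"
  proof
    fix z show "(if cmod (B z) < 1 then G (B z) else 0) * ev I z = ev q z"
      using B_lt_1[of z] by (cases "cmod z < 1") (auto simp: q)
  qed
  ultimately have "q \<in> K" by (intro M_K) simp
  have "mul (\<lambda>z. F (B z)) I = F w *\<^sub>C I + (T q - w *\<^sub>C q)"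
  proof (rule ev_inject, rule ext)
    fix z
    have "F (B z) * ev I z = (F w + (B z - w) * G (B z)) * ev I z" using FG by metis
    then show "ev (mul (\<lambda>z. F (B z)) I) z = ev (F w *\<^sub>C I + (T q - w *\<^sub>C q)) z"
      by (simp add: ev_mul[OF bdd_hol_compose[OF D]] q algebra_simps)
  qed
  then show ?thesis
    by (simp add: cip_simps cip_W_R_W[OF w I J] cip_T_R_W[OF w \<open>q \<in> K\<close> J])
qed

theorem M_decomposition:
  assumes bound: "\<And>r J. orthonormal_W r J \<Longrightarrow> r \<le> n"
  shows "\<exists>r J. r \<le> n \<and> (\<forall>i<r. B_inner B (J i)) \<and>
           M = {(\<lambda>z. \<Sum>i<r. J i z * F i z) | F. \<forall>i<r. F i \<in> HinfB B} \<and>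
           (\<forall>F. (\<forall>i<r. F i \<in> HinfB B) \<and> (\<forall>z. (\<Sum>i<r. J i z * F i z) = 0)
                 \<longrightarrow> (\<forall>i<r. \<forall>z. J i z * F i z = 0))"
proof -
  obtain r J where r: "r \<le> n" and J: "W_basis r J" using W_basis_exists[of n] bound by blast
  have JW: "J i \<in> W" and JJ: "cip (J i) (J j) = (if i = j then 1 else 0)" if "i < r" "j < r" for i j
    using J that by (auto simp: W_basis_def orthonormal_W_def)
  have norm1: "norm (J i) = 1" if "i < r" for i
    by (rule norm_eq_1I) (simp add: JJ[OF that that])
  have inner: "B_inner B (ev (J i))" if "i < r" for i
    unfolding B_inner_def
  proof (intro conjI allI)
    show "ev (J i) \<in> Hinf" by (rule M_Hinf[OF W_in_M[OF JW[OF that that]]])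
    have "(\<lambda>z. B z ^ m * ev (J i) z) = ev ((T ^^ m) (J i))" for m by (rule ext) (simp add: ev_T_pow)
    then show "h2_inner (\<lambda>z. B z ^ m * ev (J i) z) (\<lambda>z. B z ^ k * ev (J i) z) = (if m = k then 1 else 0)" for m k
      using cip_T_pow_W[OF JW[OF that that] norm1[OF that]] by (simp add: h2_inner_ev)
  qed
  have HB: "\<exists>f. f \<in> Hinf \<and> F = (\<lambda>z. if cmod z < 1 then f (B z) else 0)" if "F \<in> HinfB B" for F
    using that by (auto simp: HinfB_def)
  have "f \<in> {(\<lambda>z. \<Sum>i<r. ev (J i) z * F i z) | F. \<forall>i<r. F i \<in> HinfB B}" if f: "f \<in> M" for f
  proof -
    obtain a where a: "ev a = f" using Hinf_eq_ev[OF M_Hinf[OF f]] .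
    have aK: "a \<in> K" using M_K f a by simp
    obtain D where D: "bdd_hol (ev a) D" using HinfE[OF M_Hinf[OF f]] a by blast
    \<comment> \<open>The Wold coefficient functions, cut off so that they are literal members of
      \<open>Hinf\<close>.\<close>
    define \<phi> where "\<phi> i w = (if cmod w < 1 then cip a (R w (J i)) else 0)" for i w
    define F where "F i z = (if z \<in> ball 0 1 then \<phi> i (B z) else 0)" for i z
    have "\<phi> i \<in> Hinf" if "i < r" for i
      using bdd_hol_cut[OF cip_R_W_bdd[OF aK D JW[OF that that] norm1[OF that]]] by (simp add: \<phi>_def[abs_def])
    then have "F i \<in> HinfB B" if "i < r" for i
      using that unfolding HinfB_def F_def[abs_def] by blast
    moreover have "f z = (\<Sum>i<r. ev (J i) z * F i z)" for z
    proof (cases "cmod z < 1")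
      case True
      then show ?thesis
        using K_representation[OF J aK True] B_lt_1[OF True] by (simp add: a F_def \<phi>_def)
    next
      case False
      then have "ev a z = 0" by simp
      then show ?thesis using False by (simp add: a)
    qed
    ultimately show ?thesis by blast
  qed
  moreover have "(\<lambda>z. \<Sum>i<r. ev (J i) z * F i z) \<in> M" if F: "\<forall>i<r. F i \<in> HinfB B" for F
  proof (rule M_sum)
    fix i assume "i \<in> {..<r}"
    then have i: "i < r" by simp
    then obtain g where g: "g \<in> Hinf" "F i = (\<lambda>z. if cmod z < 1 then g (B z) else 0)" using HB F by blast
    have "(\<lambda>z. ev (J i) z * F i z) = (\<lambda>z. g (B z) * ev (J i) z)"
    proof
      fix z show "ev (J i) z * F i z = g (B z) * ev (J i) z"
        by (cases "cmod z < 1") (auto simp: g(2))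
    qed
    then show "(\<lambda>z. ev (J i) z * F i z) \<in> M" using M_mult[OF g(1) W_in_M[OF JW[OF i i]]] by simp
  qed
  ultimately have M_eq: "M = {(\<lambda>z. \<Sum>i<r. ev (J i) z * F i z) | F. \<forall>i<r. F i \<in> HinfB B}" by blast
  have direct: "ev (J i) z * F i z = 0"
    if F: "\<forall>i<r. F i \<in> HinfB B" and zero: "\<forall>z. (\<Sum>i<r. ev (J i) z * F i z) = 0" and i: "i < r" for F i z
  proof (cases "cmod z < 1")
    case True
    have "\<forall>i. \<exists>f. i < r \<longrightarrow> f \<in> Hinf \<and> F i = (\<lambda>z. if cmod z < 1 then f (B z) else 0)" using F HB by blast
    from choice[OF this] obtain g where g: "\<And>i. i < r \<Longrightarrow> g i \<in> Hinf"
      "\<And>i. i < r \<Longrightarrow> F i = (\<lambda>z. if cmod z < 1 then g i (B z) else 0)" by blast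
    define a where "a = (\<Sum>i<r. mul (\<lambda>z. g i (B z)) (J i))"
    have mulg: "ev (mul (\<lambda>z. g i (B z)) (J i)) z = ev (J i) z * F i z" if "i < r" for i z
    proof -
      obtain D where D: "bdd_hol (g i) D" using HinfE[OF g(1)[OF \<open>i < r\<close>]] by blast
      show ?thesis
        by (cases "cmod z < 1") (simp_all add: ev_mul[OF bdd_hol_compose[OF D]] g(2)[OF that])
    qed
    have "ev a z = ev 0 z" for z
    proof -
      have "ev a z = (\<Sum>i<r. ev (J i) z * F i z)" unfolding a_def ev_sum by (intro sum.cong) (auto simp: mulg)
      then show ?thesis using zero by simp
    qed
    then have "a = 0" by (intro ev_inject ext)
    have w: "cmod (B z) < 1" by (rule B_lt_1[OF True])
    \<comment> \<open>Pairing the vanishing sum with the resolvent at w = B z isolates the i-th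
      coefficient at z.\<close>
    have "0 = cip a (R (B z) (J i))" using \<open>a = 0\<close> by simp
    also have "\<dots> = (\<Sum>k<r. if k = i then g k (B z) else 0)"
      unfolding a_def cip_sum_left using i JJ JW
      by (intro sum.cong) (auto simp: cip_mul_R_W[OF g(1) _ _ w])
    also have "\<dots> = g i (B z)" using i by simp
    finally show ?thesis using g(2)[OF i] by simp
  qed simp
  show ?thesis
    by (intro exI[of _ r] exI[of _ "\<lambda>i. ev (J i)"] conjI r M_eq) (use inner direct in blast)+
qed

end

section \<open>Finite Blaschke products\<close>

text \<open>Induction on (1 - x)(1 - P) >= 0. It makes the defect of a product at most the sum of
  the defects, hence one term per zero of B.\<close>

lemma one_minus_prod_le:
  fixes x :: "'a \<Rightarrow> real"
  assumes "\<And>i. i \<in> A \<Longrightarrow> 0 \<le> x i \<and> x i \<le> 1"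
  shows "1 - prod x A \<le> (\<Sum>i\<in>A. 1 - x i)"
  using assms
proof (induction A rule: infinite_finite_induct)
  case (insert i A)
  have "prod x A \<le> 1" using insert by (intro prod_le_1) auto
  then have "x i + prod x A - 1 \<le> x i * prod x A"
    using insert(4)[of i] mult_nonneg_nonneg[of "1 - x i" "1 - prod x A"] by (simp add: algebra_simps)
  then show ?case using insert by simp
qed auto

text \<open>From |1 - cnj a z|^2 - |z - a|^2 = (1 - |z|^2)(1 - |a|^2), divided by |1 - cnj a z|^2.
  The second factor on the right is the squared modulus of the normalised Szego kernel at a.\<close>

lemma moebius_defect:
  assumes a: "cmod a < 1" and z: "cmod z < 1"
  shows "1 - (cmod ((z - a) / (1 - cnj a * z)))\<^sup>2 = (1 - (cmod z)\<^sup>2) * ((1 - (cmod a)\<^sup>2) * (cmod (ev (szego a) z))\<^sup>2)"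
proof -
  have nz: "1 - cnj a * z \<noteq> 0" by (rule one_minus_cnj_mult_nonzero(2)[OF a z])
  have "(cmod (1 - cnj a * z))\<^sup>2 - (cmod (z - a))\<^sup>2 = (1 - (cmod z)\<^sup>2) * (1 - (cmod a)\<^sup>2)"
    unfolding cmod_power2 by (simp add: power2_eq_square algebra_simps)
  then show ?thesis
    using nz by (simp add: ev_szego[OF a z] norm_divide power_divide field_simps)
qed

lemma blaschke_defect:
  assumes a: "\<forall>i<length a. a ! i \<in> ball 0 1" and z: "cmod z < 1"
  shows "1 - (cmod (blaschke a z))\<^sup>2 \<le>
    (1 - (cmod z)\<^sup>2) * (\<Sum>i<length a. (1 - (cmod (a ! i))\<^sup>2) * (cmod (ev (szego (a ! i)) z))\<^sup>2)"
proof -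
  define x where "x i = (cmod ((z - a ! i) / (1 - cnj (a ! i) * z)))\<^sup>2" for i
  have x: "1 - x i = (1 - (cmod z)\<^sup>2) * ((1 - (cmod (a ! i))\<^sup>2) * (cmod (ev (szego (a ! i)) z))\<^sup>2)" if "i < length a" for i
    unfolding x_def using a that z by (intro moebius_defect) auto
  have "0 \<le> 1 - x i" if "i < length a" for i
    unfolding x[OF that] using a that z by (auto intro!: mult_nonneg_nonneg simp: abs_square_le_1)
  then have "1 - (\<Prod>i<length a. x i) \<le> (\<Sum>i<length a. 1 - x i)"
    by (intro one_minus_prod_le) (auto simp: x_def)
  also have "\<dots> = (\<Sum>i<length a. (1 - (cmod z)\<^sup>2) * ((1 - (cmod (a ! i))\<^sup>2) * (cmod (ev (szego (a ! i)) z))\<^sup>2))"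
    by (intro sum.cong) (auto simp: x)
  finally show ?thesis
    unfolding blaschke_def x_def by (simp add: prod_norm[symmetric] prod_power_distrib sum_distrib_left)
qed

lemma blaschke_lt_1:
  assumes a: "\<forall>i<length a. a ! i \<in> ball 0 1" and ne: "a \<noteq> []" and z: "cmod z < 1"
  shows "cmod (blaschke a z) < 1"
proof -
  have lt: "cmod ((z - a ! i) / (1 - cnj (a ! i) * z)) < 1" if "i < length a" for i
  proof -
    have ai: "cmod (a ! i) < 1" using a that by simp
    have "cmod (ev (szego (a ! i)) z) > 0"
    proof -
      have "1 - cnj (a ! i) * z \<noteq> 0" by (rule one_minus_cnj_mult_nonzero(2)[OF ai z])
      then show ?thesis by (simp add: ev_szego[OF ai z] norm_divide)
    qed
    then have "(1 - (cmod z)\<^sup>2) * ((1 - (cmod (a ! i))\<^sup>2) * (cmod (ev (szego (a ! i)) z))\<^sup>2) > 0"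
      using ai z by (intro mult_pos_pos) (auto simp: abs_square_less_1)
    then have "(cmod ((z - a ! i) / (1 - cnj (a ! i) * z)))\<^sup>2 < 1"
      unfolding moebius_defect[OF ai z, symmetric] by simp
    then show ?thesis by (simp only: abs_square_less_1 abs_norm_cancel)
  qed
  have "cmod (blaschke a z) = (\<Prod>i<length a. cmod ((z - a ! i) / (1 - cnj (a ! i) * z)))"
    by (simp add: blaschke_def prod_norm)
  \<comment> \<open>One factor is split off to keep strictness; the others are only bounded by 1. An
    empty product would equal 1.\<close>
  also have "\<dots> = cmod ((z - a ! 0) / (1 - cnj (a ! 0) * z)) *
      (\<Prod>i\<in>{..<length a} - {0}. cmod ((z - a ! i) / (1 - cnj (a ! i) * z)))"
    using ne by (intro prod.remove) auto
  also have "\<dots> \<le> cmod ((z - a ! 0) / (1 - cnj (a ! 0) * z)) * 1"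
    using lt by (intro mult_left_mono prod_le_1) (auto intro: less_imp_le)
  also have "\<dots> < 1" using lt[of 0] ne by simp
  finally show ?thesis .
qed

lemma blaschke_holomorphic:
  assumes "\<forall>i<length a. a ! i \<in> ball 0 1" shows "blaschke a holomorphic_on ball 0 1"
proof -
  have "1 - cnj (a ! i) * z \<noteq> 0" if "i < length a" "cmod z < 1" for i z
    using one_minus_cnj_mult_nonzero(2)[of "a ! i" z] assms that by simp
  then show ?thesis
    unfolding blaschke_def[abs_def] by (intro holomorphic_intros) auto
qed

theorem theorem3p4:
  fixes a :: "complex list" and M :: "(complex \<Rightarrow> complex) set"
  assumes zeros: "\<forall>i<length a. a ! i \<in> ball 0 1"
    and first0: "a \<noteq> []" "a ! 0 = 0"
    and subsp: "Hinf_subspace M"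
    and wclosed: "weakstar_closed M"
    and inv: "\<forall>f\<in>M. (\<lambda>z. blaschke a z * f z) \<in> M"
  shows "\<exists>r J. r \<le> length a \<and> (\<forall>i<r. B_inner (blaschke a) (J i)) \<and>
           M = {(\<lambda>z. \<Sum>i<r. J i z * F i z) | F. \<forall>i<r. F i \<in> HinfB (blaschke a)} \<and>
           (\<forall>F. (\<forall>i<r. F i \<in> HinfB (blaschke a)) \<and> (\<forall>z. (\<Sum>i<r. J i z * F i z) = 0)
                 \<longrightarrow> (\<forall>i<r. \<forall>z. J i z * F i z = 0))"
proof -
  \<comment> \<open>The reciprocal of the squared norm of the Szego kernel at \<open>a ! i\<close>,
    so each weighted kernel contributes exactly 1 to the dimension count.\<close>
  define d where "d i = 1 - (cmod (a ! i))\<^sup>2" for i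
  have a1: "cmod (a ! i) < 1" if "i < length a" for i using zeros that by simp
  have d: "d i > 0" if "i < length a" for i using a1[OF that] by (simp add: d_def abs_square_less_1)
  \<comment> \<open>The sum bounds the weighted kernels on the disc, since |1 - cnj a z| >= 1 - |a|;
    the added 1 secures C >= 1.\<close>
  define C where "C = 1 + (\<Sum>i<length a. d i * (1 / (1 - cmod (a ! i)))\<^sup>2)"
  have defect: "1 - (cmod (blaschke a z))\<^sup>2 \<le> (1 - (cmod z)\<^sup>2) * (\<Sum>i<length a. d i * (cmod (ev (szego (a ! i)) z))\<^sup>2)"
    if "cmod z < 1" for z
    using blaschke_defect[OF zeros that] by (simp add: d_def)
  interpret weakstar_invariant "blaschke a" C M
  proof
    show "blaschke a holomorphic_on ball 0 1" by (rule blaschke_holomorphic[OF zeros])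
    show "cmod (blaschke a z) < 1" if "cmod z < 1" for z by (rule blaschke_lt_1[OF zeros first0(1) that])
    show "blaschke a 0 = 0"
      using first0 by (auto simp: blaschke_def intro!: bexI[of _ 0])
    have "0 \<le> (\<Sum>i<length a. d i * (1 / (1 - cmod (a ! i)))\<^sup>2)"
      using d by (intro sum_nonneg mult_nonneg_nonneg) (auto intro: less_imp_le)
    then show "1 \<le> C" by (simp add: C_def)
    fix z assume z: "cmod z < 1"
    have "(\<Sum>i<length a. d i * (cmod (ev (szego (a ! i)) z))\<^sup>2) \<le> (\<Sum>i<length a. d i * (1 / (1 - cmod (a ! i)))\<^sup>2)"
    proof (rule sum_mono)
      fix i assume "i \<in> {..<length a}"
      then have i: "i < length a" by simp
      have "cmod (cnj (a ! i) * z) \<le> cmod (a ! i) * 1"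
        unfolding norm_mult using z by (intro mult_mono) auto
      then have "1 - cmod (a ! i) \<le> cmod (1 - cnj (a ! i) * z)"
        using norm_triangle_ineq2[of 1 "cnj (a ! i) * z"] by simp
      then have "cmod (ev (szego (a ! i)) z) \<le> 1 / (1 - cmod (a ! i))"
        using a1[OF i] by (simp add: ev_szego[OF a1[OF i] z] norm_divide frac_le)
      then show "d i * (cmod (ev (szego (a ! i)) z))\<^sup>2 \<le> d i * (1 / (1 - cmod (a ! i)))\<^sup>2"
        using d[OF i] by (intro mult_left_mono power_mono) auto
    qed
    then have "(\<Sum>i<length a. d i * (cmod (ev (szego (a ! i)) z))\<^sup>2) \<le> C" by (simp add: C_def)
    then have "(1 - (cmod z)\<^sup>2) * (\<Sum>i<length a. d i * (cmod (ev (szego (a ! i)) z))\<^sup>2) \<le> (1 - (cmod z)\<^sup>2) * C"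
      using z by (intro mult_left_mono) (auto simp: abs_square_le_1)
    with defect[OF z] show "1 - (cmod (blaschke a z))\<^sup>2 \<le> C * (1 - (cmod z)\<^sup>2)" by (simp add: mult.commute)
  qed (use subsp wclosed inv in auto)
  show ?thesis
  proof (rule M_decomposition)
    fix r J assume "orthonormal_W r J"
    then show "r \<le> length a"
    proof (rule orthonormal_W_card_le[OF _ defect])
      show "0 \<le> d i" if "i < length a" for i using d[OF that] by simp
      show "d i * (norm (szego (a ! i)))\<^sup>2 \<le> 1" if "i < length a" for i
        using d[OF that] by (simp add: norm_szego[OF a1[OF that]] d_def[symmetric])
    qed
  qed
qed

end
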